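(* Let $u\in BV([0,T];X)$. Then $u$ is a $BV$ solution of the rate-independent system $(X,\mathcal E,\mathfrak p)$ if and only if it satisfies the doubly nonlinear differential inclusion $$\partial\Psi_0\Big(\frac{\mathrm d u'_{\rm co}}{\mathrm d\mu}(t)\Big)+D\mathcal E_t(u(t))\ni 0\quad\text{for }\mu\text{-a.e. }t\in[0,T],\qquad \mu:=\mathscr L^1+|u'_{\rm C}|,$$ and the following jump conditions at each point $t\in J_u$ of the jump set: $$\mathcal E_t(u(t))-\mathcal E_t(u(t_-))=-\Delta_{\mathfrak p,\mathcal E}(t;u(t_-),u(t)),$$ $$\mathcal E_t(u(t_+))-\mathcal E_t(u(t))=-\Delta_{\mathfrak p,\mathcal E}(t;u(t),u(t_+)),$$ $$\mathcal E_t(u(t_+))-\mathcal E_t(u(t_-))=-\Delta_{\mathfrak p,\mathcal E}(t;u(t_-),u(t_+)).$$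
   Context: Let $(X,\|\cdot\|_X)$ be a finite-dimensional real normed vector space with dual $X^*$ and pairing $\langle\cdot,\cdot\rangle$, and let $T>0$. $\Psi_0:X\to[0,+\infty)$ is a gauge: $\Psi_0(v)>0$ if $v\neq0$, $\Psi_0(v_1+v_2)\le\Psi_0(v_1)+\Psi_0(v_2)$, $\Psi_0(\lambda v)=\lambda\Psi_0(v)$ for all $\lambda\ge0$, $v,v_1,v_2\in X$. $\partial$ denotes the convex subdifferential and $K^*:=\partial\Psi_0(0)=\{w\in X^*:\langle w,z\rangle\le\Psi_0(z)\ \forall z\in X\}$. The energy $\mathcal E\in C^1([0,T]\times X)$, written $\mathcal E_t(u)$, satisfies for some $C>0$ and all $(t,u)$: $\mathcal E_t(u)\ge -C$ and $|\partial_t\mathcal E_t(u)|\le C(1+\mathcal E_t(u)^+)$, with $(\cdot)^+$ the positive part; $D\mathcal E_t(u)\in X^*$ is the differential in $u$. Viscosity: $\Psi:X\to[0,+\infty)$ is convex, $\Psi(0)=0$, $\Psi(v)/\|v\|_X\to+\infty$ as $\|v\|_X\to+\infty$; for $\varepsilon>0$, $\Psi_\varepsilon(v):=\varepsilon^{-1}\Psi(\varepsilon v)$, and $\Psi_0(v)=\lim_{\varepsilon\downarrow0}\Psi_\varepsilon(v)$ for every $v$. The Legendre conjugate of $\Psi_\varepsilon$ is $\Psi_\varepsilon^*=\varepsilon^{-1}\Psi^*$. The vanishing viscosity contact potential is $\mathfrak p(v,w):=\inf_{\varepsilon>0}\big(\Psi_\varepsilon(v)+\Psi_\varepsilon^*(w)\big)$,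 $v\in X$, $w\in X^*$. BV functions: elements of $BV([0,T];X)$ are defined at every point and have finite pointwise total variation. $u(t_\pm)$ are the right/left limits, with $u(0_-):=u(0)$, $u(T_+):=u(T)$; $J_u:=\{t\in[0,T]:u(t_-)\ne u(t)\text{ or }u(t)\neq u(t_+)\}$. The distributional derivative splits as $u'=u'_{\mathscr L}+u'_{\rm C}+u'_{J}$ (absolutely continuous, Cantor, jump part), and $u'_{\rm co}:=u'_{\mathscr L}+u'_{\rm C}$ is its diffuse part. $\mu:=\mathscr L^1+|u'_{\rm C}|$, where $\mathscr L^1$ is Lebesgue measure. Finsler cost at time $t$: $\Delta_{\mathfrak p,\mathcal E}(t;u_0,u_1):=\inf\big\{\int_{r_0}^{r_1}\mathfrak p(\dot\vartheta(r),-D\mathcal E_t(\vartheta(r)))\,\mathrm dr:\ \vartheta\in AC([r_0,r_1];X),\ \vartheta(r_0)=u_0,\ \vartheta(r_1)=u_1\big\}$, and $\Delta_{\mathfrak p,\mathcal E}(t;u_-,u,u_+):=\Delta_{\mathfrak p,\mathcal E}(t;u_-,u)+\Delta_{\mathfrak p,\mathcal E}(t;u,u_+)$. Pseudo-total variation on $[a,b]\subset[0,T]$: $$\mathit{Var}_{\mathfrak p,\mathcal E}(u;[a,b]):=\int_a^b\Psi_0\Big(\frac{\mathrm d u'_{\rm co}}{\mathrm d\mu}\Big)\mathrm d\mu+\Delta_{\mathfrak p,\mathcal E}(a;u(a),u(a_+))+\Delta_{\mathfrak p,\mathcal E}(b;u(b_-),u(b))+\sum_{t\in J_u\cap(a,b)}\Delta_{\mathfrak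 p,\mathcal E}(t;u(t_-),u(t),u(t_+)).$$ $u\in BV([0,T];X)$ is a $BV$ solution of $(X,\mathcal E,\mathfrak p)$ if $-D\mathcal E_t(u(t))\in K^*$ for a.a. $t\in[0,T]\setminus J_u$ and, for all $t\in[0,T]$, $\mathit{Var}_{\mathfrak p,\mathcal E}(u;[0,t])+\mathcal E_t(u(t))=\mathcal E_0(u(0))+\int_0^t\partial_t\mathcal E_s(u(s))\,\mathrm ds$.
   Formalization: The pseudo-total variation on the degenerate interval [0,0] is taken to be 0; the displayed formula read literally would give Δ(0;u(0),u(0+)), so the energy balance at t=0 would forbid an initial jump that the jump conditions allow. *)

theory Defs
  imports "HOL-Analysis.Analysis"
begin

text \<open>The dual space is the type \<open>'a \<Rightarrow>\<^sub>L real\<close>.  Functions on a compact interval are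
  represented by total functions on the reals of which only the values on that interval
  matter.\<close>

subsection \<open>Convex analysis\<close>

definition subdifferential ::
    "('a::real_normed_vector \<Rightarrow> real) \<Rightarrow> 'a \<Rightarrow> ('a \<Rightarrow>\<^sub>L real) set" where
  "subdifferential F v = {w. \<forall>z. F v + blinfun_apply w (z - v) \<le> F z}"

text \<open>The supremum is taken in the reals; it is only used for nonnegative \<open>F\<close> with superlinear
  growth on a finite-dimensional space, where it is finite.\<close>

definition legendre_conj ::
    "('a::real_normed_vector \<Rightarrow> real) \<Rightarrow> ('a \<Rightarrow>\<^sub>L real) \<Rightarrow> real" where
  "legendre_conj F w = (SUP v. blinfun_apply w v - F v)"

definition Psi_eps :: "('a::real_normed_vector \<Rightarrow> real) \<Rightarrow> real \<Rightarrow> 'a \<Rightarrow> real" where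
  "Psi_eps Psi e v = Psi (e *\<^sub>R v) / e"

definition contact_potential ::
    "('a::real_normed_vector \<Rightarrow> real) \<Rightarrow> 'a \<Rightarrow> ('a \<Rightarrow>\<^sub>L real) \<Rightarrow> real" where
  "contact_potential Psi v w =
     (INF e\<in>{0<..}. Psi_eps Psi e v + legendre_conj (Psi_eps Psi e) w)"


subsection \<open>BV and AC curves\<close>

definition BV :: "real \<Rightarrow> (real \<Rightarrow> 'a::real_normed_vector) \<Rightarrow> bool" where
  "BV T u \<longleftrightarrow> (\<exists>M. \<forall>(n::nat) s. (\<forall>i\<le>n. s i \<in> {0..T}) \<and> (\<forall>i<n. s i \<le> s (Suc i)) \<longrightarrow>
     (\<Sum>i<n. norm (u (s (Suc i)) - u (s i))) \<le> M)"

definition AC :: "real \<Rightarrow> real \<Rightarrow> (real \<Rightarrow> 'a::real_normed_vector) \<Rightarrow> bool" where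
  "AC r0 r1 \<theta> \<longleftrightarrow> (\<forall>\<epsilon>>0. \<exists>\<delta>>0. \<forall>(n::nat) a b.
     (\<forall>i<n. r0 \<le> a i \<and> a i \<le> b i \<and> b i \<le> r1) \<and>
     disjoint_family_on (\<lambda>i. {a i<..<b i}) {..<n} \<and> (\<Sum>i<n. b i - a i) < \<delta> \<longrightarrow>
     (\<Sum>i<n. norm (\<theta> (b i) - \<theta> (a i))) < \<epsilon>)"

definition lim_left :: "(real \<Rightarrow> 'a::real_normed_vector) \<Rightarrow> real \<Rightarrow> 'a" where
  "lim_left u t = (if t = 0 then u 0 else Lim (at_left t) u)"

definition lim_right :: "real \<Rightarrow> (real \<Rightarrow> 'a::real_normed_vector) \<Rightarrow> real \<Rightarrow> 'a" where
  "lim_right T u t = (if t = T then u T else Lim (at_right t) u)"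

definition jump_set :: "real \<Rightarrow> (real \<Rightarrow> 'a::real_normed_vector) \<Rightarrow> real set" where
  "jump_set T u = {t\<in>{0..T}. lim_left u t \<noteq> u t \<or> u t \<noteq> lim_right T u t}"


subsection \<open>Vector measures on the real line\<close>

text \<open>A vector measure is a countably additive function on the Borel sets; it is extended by
  \<open>0\<close> to the other sets, so that it is determined by its values on the Borel sets.\<close>

definition vmeasure :: "(real set \<Rightarrow> 'a::real_normed_vector) \<Rightarrow> bool" where
  "vmeasure \<nu> \<longleftrightarrow> (\<forall>A. A \<notin> sets borel \<longrightarrow> \<nu> A = 0) \<and> \<nu> {} = 0 \<and>
     (\<forall>A::nat \<Rightarrow> real set. range A \<subseteq> sets borel \<and> disjoint_family A \<longrightarrow>
        (\<lambda>n. \<nu> (A n)) sums \<nu> (\<Union>n. A n))"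

definition vm_variation :: "(real set \<Rightarrow> 'a::real_normed_vector) \<Rightarrow> real measure" where
  "vm_variation \<nu> = measure_of UNIV (sets borel)
     (\<lambda>A. SUP P\<in>{P. finite P \<and> P \<subseteq> sets borel \<and> disjoint P \<and> \<Union>P = A}.
        \<Sum>B\<in>P. ennreal (norm (\<nu> B)))"

text \<open>The Radon-Nikodym density of \<open>\<nu>\<close> with respect to the positive measure \<open>M\<close>; it is
  determined up to \<open>M\<close>-null sets.\<close>

definition vm_density :: "(real set \<Rightarrow> 'a::{banach,second_countable_topology}) \<Rightarrow>
    real measure \<Rightarrow> real \<Rightarrow> 'a" where
  "vm_density \<nu> M = (SOME h. integrable M h \<and>
     (\<forall>A\<in>sets borel. \<nu> A = (LINT t:A|M. h t)))"

text \<open>Integral of a scalar function, through the polar decomposition of \<open>\<nu>\<close>.\<close>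

definition vm_integral :: "(real set \<Rightarrow> 'a::{banach,second_countable_topology}) \<Rightarrow>
    (real \<Rightarrow> real) \<Rightarrow> 'a" where
  "vm_integral \<nu> \<phi> =
     (LINT t|vm_variation \<nu>. \<phi> t *\<^sub>R vm_density \<nu> (vm_variation \<nu>) t)"


subsection \<open>The distributional derivative and its parts\<close>

definition test_function :: "real \<Rightarrow> (real \<Rightarrow> real) \<Rightarrow> bool" where
  "test_function T \<phi> \<longleftrightarrow>
     (\<forall>k x. ((deriv ^^ k) \<phi>) differentiable (at x)) \<and>
     (\<exists>a b. 0 < a \<and> b < T \<and> (\<forall>x. x \<notin> {a..b} \<longrightarrow> \<phi> x = 0))"

text \<open>The derivative in the sense of distributions on \<open>(0,T)\<close>, as a vector measure carried by
  \<open>(0,T)\<close>.\<close>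

definition distr_deriv :: "real \<Rightarrow> (real \<Rightarrow> 'a::{banach,second_countable_topology}) \<Rightarrow>
    real set \<Rightarrow> 'a" where
  "distr_deriv T u = (THE \<nu>. vmeasure \<nu> \<and> (\<forall>A\<in>sets borel. \<nu> A = \<nu> (A \<inter> {0<..<T})) \<and>
     (\<forall>\<phi>. test_function T \<phi> \<longrightarrow>
        (LINT t:{0..T}|lborel. deriv \<phi> t *\<^sub>R u t) = - vm_integral \<nu> \<phi>))"

text \<open>Absolutely continuous part in the Lebesgue decomposition with respect to \<open>lborel\<close>.\<close>

definition ac_part :: "(real set \<Rightarrow> 'a::real_normed_vector) \<Rightarrow> real set \<Rightarrow> 'a" where
  "ac_part \<nu> = (THE \<nu>L. vmeasure \<nu>L \<and>
     (\<forall>A\<in>null_sets lborel. \<nu>L A = 0) \<and>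
     (\<exists>N\<in>null_sets lborel. \<forall>A\<in>sets borel. \<nu> A - \<nu>L A = \<nu> (A \<inter> N) - \<nu>L (A \<inter> N)))"

definition deriv_L :: "real \<Rightarrow> (real \<Rightarrow> 'a::{banach,second_countable_topology}) \<Rightarrow>
    real set \<Rightarrow> 'a" where
  "deriv_L T u = ac_part (distr_deriv T u)"

definition deriv_J :: "real \<Rightarrow> (real \<Rightarrow> 'a::{banach,second_countable_topology}) \<Rightarrow>
    real set \<Rightarrow> 'a" where
  "deriv_J T u A = distr_deriv T u (A \<inter> jump_set T u)"

definition deriv_C :: "real \<Rightarrow> (real \<Rightarrow> 'a::{banach,second_countable_topology}) \<Rightarrow>
    real set \<Rightarrow> 'a" where
  "deriv_C T u A = distr_deriv T u A - deriv_L T u A - deriv_J T u A"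

definition deriv_co :: "real \<Rightarrow> (real \<Rightarrow> 'a::{banach,second_countable_topology}) \<Rightarrow>
    real set \<Rightarrow> 'a" where
  "deriv_co T u A = deriv_L T u A + deriv_C T u A"

text \<open>The sum of Lebesgue measure on \<open>[0,T]\<close> and the total variation of the Cantor part.\<close>

definition mu_measure :: "real \<Rightarrow> (real \<Rightarrow> 'a::{banach,second_countable_topology}) \<Rightarrow>
    real measure" where
  "mu_measure T u = measure_of UNIV (sets borel)
     (\<lambda>A. emeasure lborel (A \<inter> {0..T}) + emeasure (vm_variation (deriv_C T u)) A)"

definition co_density :: "real \<Rightarrow> (real \<Rightarrow> 'a::{banach,second_countable_topology}) \<Rightarrow>
    real \<Rightarrow> 'a" where
  "co_density T u = vm_density (deriv_co T u) (mu_measure T u)"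


subsection \<open>Finsler cost, pseudo-total variation, BV solutions\<close>

text \<open>The endpoints of the parameter interval are free; as \<open>p\<close> is positively 1-homogeneous
  in its first argument, fixing them does not change the infimum.\<close>

definition finsler_cost :: "('a::real_normed_vector \<Rightarrow> ('a \<Rightarrow>\<^sub>L real) \<Rightarrow> real) \<Rightarrow>
    (real \<Rightarrow> 'a \<Rightarrow> ('a \<Rightarrow>\<^sub>L real)) \<Rightarrow> real \<Rightarrow> 'a \<Rightarrow> 'a \<Rightarrow> ennreal" where
  "finsler_cost p DE t u0 u1 =
     Inf {(\<integral>\<^sup>+r\<in>{r0..r1}. ennreal (p (vector_derivative \<theta> (at r)) (- DE t (\<theta> r))) \<partial>lborel)
          | \<theta> r0 r1. r0 < r1 \<and> AC r0 r1 \<theta> \<and> \<theta> r0 = u0 \<and> \<theta> r1 = u1}"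

definition finsler_cost3 :: "('a::real_normed_vector \<Rightarrow> ('a \<Rightarrow>\<^sub>L real) \<Rightarrow> real) \<Rightarrow>
    (real \<Rightarrow> 'a \<Rightarrow> ('a \<Rightarrow>\<^sub>L real)) \<Rightarrow> real \<Rightarrow> 'a \<Rightarrow> 'a \<Rightarrow> 'a \<Rightarrow> ennreal" where
  "finsler_cost3 p DE t ul uc ur = finsler_cost p DE t ul uc + finsler_cost p DE t uc ur"

text \<open>On a degenerate interval the variation is \<open>0\<close>: the boundary terms of the formula
  for \<open>a < b\<close> are the jumps inside \<open>[a,b]\<close>, from \<open>a\<close> to the right and to \<open>b\<close> from the left.\<close>

definition pseudo_Var :: "real \<Rightarrow> ('a::{banach,second_countable_topology} \<Rightarrow> real) \<Rightarrow>
    ('a \<Rightarrow> ('a \<Rightarrow>\<^sub>L real) \<Rightarrow> real) \<Rightarrow> (real \<Rightarrow> 'a \<Rightarrow> ('a \<Rightarrow>\<^sub>L real)) \<Rightarrow>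
    (real \<Rightarrow> 'a) \<Rightarrow> real \<Rightarrow> real \<Rightarrow> ennreal" where
  "pseudo_Var T Psi0 p DE u a b =
     (if a < b then
        (\<integral>\<^sup>+t\<in>{a..b}. ennreal (Psi0 (co_density T u t)) \<partial>mu_measure T u)
        + finsler_cost p DE a (u a) (lim_right T u a)
        + finsler_cost p DE b (lim_left u b) (u b)
        + (\<Sum>\<^sub>\<infinity>t\<in>jump_set T u \<inter> {a<..<b}.
             finsler_cost3 p DE t (lim_left u t) (u t) (lim_right T u t))
      else 0)"

text \<open>\<open>dtE\<close> and \<open>DE\<close> stand for the partial derivatives of \<open>E\<close> in time and in space.\<close>

definition BV_solution :: "real \<Rightarrow> ('a::{banach,second_countable_topology} \<Rightarrow> real) \<Rightarrow>
    ('a \<Rightarrow> ('a \<Rightarrow>\<^sub>L real) \<Rightarrow> real) \<Rightarrow> (real \<Rightarrow> 'a \<Rightarrow> real) \<Rightarrow> (real \<Rightarrow> 'a \<Rightarrow> real) \<Rightarrow>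
    (real \<Rightarrow> 'a \<Rightarrow> ('a \<Rightarrow>\<^sub>L real)) \<Rightarrow> (real \<Rightarrow> 'a) \<Rightarrow> bool" where
  "BV_solution T Psi0 p E dtE DE u \<longleftrightarrow>
     BV T u \<and>
     (AE t in lborel. t \<in> {0..T} - jump_set T u \<longrightarrow> - DE t (u t) \<in> subdifferential Psi0 0) \<and>
     (\<forall>t\<in>{0..T}.
        enn2ereal (pseudo_Var T Psi0 p DE u 0 t) + ereal (E t (u t)) =
        ereal (E 0 (u 0) + (LINT s:{0..t}|lborel. dtE s (u s))))"

end

theory Submission
  imports Defs "HOL-Computational_Algebra.Polynomial"
begin

text \<open>
  Along a BV curve the energy obeys a chain rule: \<open>\<E>\<^sub>t(u(t)) - \<E>\<^sub>0(u(0))\<close> is the sum of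
  \<open>\<integral> \<partial>\<^sub>t\<E> dt\<close>, of \<open>\<integral> \<langle>D\<E>, du'\<^sub>c\<^sub>o/d\<mu>\<rangle> d\<mu>\<close> and of the energy jumps.  Stability off the jump set
  means \<open>-D\<E> \<in> K*\<close>, so that \<open>\<Psi>\<^sub>0(v) \<ge> \<langle>-D\<E>, v\<rangle>\<close>; and \<open>\<pp>(v, w) \<ge> \<langle>w, v\<rangle>\<close> gives, integrated along
  curves, that the Finsler cost of a transition is at least the energy it releases.  Hence each
  contribution to the pseudo-total variation dominates the matching term of the chain rule, and
  the energy identity on \<open>[0,T]\<close> forces equality in all of them: \<open>\<mu>\<close>-a.e. equality is the
  differential inclusion, since \<open>w \<in> \<partial>\<Psi>\<^sub>0(v)\<close> iff \<open>w \<in> K*\<close> and \<open>\<langle>w, v\<rangle> = \<Psi>\<^sub>0(v)\<close>, and equality at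
  the jumps gives the jump conditions.  Conversely, inserting these equalities into the chain
  rule on \<open>[0,t]\<close> yields the energy identity.

  The diffuse part of the chain rule holds because the difference of the two sides is a finite
  measure without atoms whose value on a small interval around a continuity point of \<open>u\<close> is
  arbitrarily small relative to length plus variation; at a jump point the atom of the variation
  absorbs it.  A bisection argument then shows that the difference vanishes.
\<close>


section \<open>Coordinates on finite-dimensional spaces\<close>

text \<open>Two notions of "almost everywhere" have to be reconciled. Stability is required almost
  everywhere for Lebesgue measure, the inclusion for \<mu>, which may charge Lebesgue null sets
  through the Cantor part. The passage from the former to the latter goes through single points: off
  the jump set \<open>u\<close> and the differential of the energy are continuous, so stability
  there extends to every point, and \<mu> does not see the countable jump set. The way back is free,
  as \<mu> dominates Lebesgue measure on [0,T].

  The derivative of \<open>u\<close> and its parts are given by description operators, so they must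
  be identified with a Stieltjes measure, by means of smooth test functions, and with its Lebesgue
  decomposition. The space is a Banach space with a finite spanning set; vector statements are
  reduced to coordinates, each of which becomes monotone once a multiple of the variation is added.

  The lower bound of the cost concerns absolutely continuous curves and rests on their
  differentiability almost everywhere, obtained from Vitali covering. The third jump condition comes
  from the first two by the triangle inequality and that lower bound.\<close>

lemma span_coordinate_bound:
  fixes S :: "'a::real_normed_vector set"
  assumes cl: "closed (span S)" and b: "b \<notin> span S"
  obtains d where "d > 0" "\<And>k s. s \<in> span S \<Longrightarrow> \<bar>k\<bar> * d \<le> norm (k *\<^sub>R b + s)"
proof -
  have "open (- span S)" "b \<in> - span S" using cl b by auto
  then obtain d where d: "d > 0" "ball b d \<subseteq> - span S" by (meson openE)
  have "\<bar>k\<bar> * d \<le> norm (k *\<^sub>R b + s)" if s: "s \<in> span S" for k s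
  proof (cases "k = 0")
    case False
    have "(-(1/k)) *\<^sub>R s \<in> span S" using s by (rule span_mul)
    then have "(-(1/k)) *\<^sub>R s \<notin> ball b d" using d by auto
    then have *: "d \<le> norm (b + (1/k) *\<^sub>R s)" by (simp add: dist_norm)
    have "k *\<^sub>R b + s = k *\<^sub>R (b + (1/k) *\<^sub>R s)" using False by (simp add: algebra_simps)
    then have "norm (k *\<^sub>R b + s) = \<bar>k\<bar> * norm (b + (1/k) *\<^sub>R s)"
      by (metis norm_scaleR)
    then show ?thesis using * by (simp add: mult_left_mono)
  qed simp
  then show ?thesis using that d by blast
qed

text \<open>Along a convergent sequence in the larger span the coefficients of \<open>b\<close> are
  Cauchy, because \<open>b\<close> has positive distance from the closed span of \<open>S\<close>;
  the remainders then converge inside that span.\<close>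

lemma closed_span_insert:
  fixes S :: "'a::banach set"
  assumes cl: "closed (span S)"
  shows "closed (span (insert b S))"
proof (cases "b \<in> span S")
  case True
  then show ?thesis using cl by (simp add: span_redundant)
next
  case False
  then obtain d where d: "d > 0" "\<And>k s. s \<in> span S \<Longrightarrow> \<bar>k\<bar> * d \<le> norm (k *\<^sub>R b + s)"
    using span_coordinate_bound[OF cl] by blast
  show ?thesis unfolding closed_sequential_limits
  proof (intro allI impI, elim conjE)
    fix x l assume x: "\<forall>n. x n \<in> span (insert b S)" and lim: "x \<longlonglongrightarrow> l"
    have "\<forall>n. \<exists>k. x n - k *\<^sub>R b \<in> span S" using x span_breakdown_eq by blast
    then obtain k where k: "\<And>n. x n - k n *\<^sub>R b \<in> span S" by metis
    have kd: "\<bar>k m - k n\<bar> * d \<le> norm (x m - x n)" for m n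
      using d(2)[OF span_diff[OF k[of m] k[of n]], of "k m - k n"] by (simp add: algebra_simps)
    have "Cauchy k"
    proof (rule CauchyI)
      fix e :: real assume "e > 0"
      then have "e * d > 0" using d by simp
      then obtain M where M: "\<forall>m\<ge>M. \<forall>n\<ge>M. norm (x m - x n) < e * d"
        using CauchyD[OF LIMSEQ_imp_Cauchy[OF lim]] by blast
      show "\<exists>M. \<forall>m\<ge>M. \<forall>n\<ge>M. norm (k m - k n) < e"
      proof (intro exI allI impI)
        fix m n assume "m \<ge> M" "n \<ge> M"
        then have "\<bar>k m - k n\<bar> * d < e * d" using M kd[of m n] by fastforce
        then show "norm (k m - k n) < e" using d by simp
      qed
    qed
    then obtain K where K: "k \<longlonglongrightarrow> K" using Cauchy_convergent_iff convergent_def by blast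
    have "(\<lambda>n. x n - k n *\<^sub>R b) \<longlonglongrightarrow> l - K *\<^sub>R b" by (intro tendsto_intros lim K)
    then have "l - K *\<^sub>R b \<in> span S" using closed_sequentially[OF cl, of "\<lambda>n. x n - k n *\<^sub>R b"] k by blast
    then show "l \<in> span (insert b S)" using span_breakdown_eq by blast
  qed
qed

lemma closed_span_finite:
  fixes S :: "'a::banach set"
  assumes "finite S" shows "closed (span S)"
  using assms by induction (auto intro: closed_span_insert)

text \<open>Replaces a Euclidean structure: vector-valued statements are proved for the real
  functions \<open>c b\<close> and reassembled with \<open>c_sum\<close>. Compactness of balls and
  equivalence with the coordinate norm are derived from these data alone.\<close>

locale fin_coords =
  fixes B :: "'a::{banach,second_countable_topology} set" and c :: "'a \<Rightarrow> 'a \<Rightarrow> real"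
  assumes finB: "finite B"
    and c_bl: "b \<in> B \<Longrightarrow> bounded_linear (c b)"
    and c_sum: "(\<Sum>b\<in>B. c b x *\<^sub>R b) = x"

text \<open>A coordinate is continuous because the span of the other basis vectors is closed: if
  \<open>b\<close> has distance \<open>d\<close> from it, then \<bar>c b x\<bar> * d is at most the
  norm of \<open>x\<close>.\<close>

lemma ex_fin_coords:
  assumes "\<exists>B0::'a::{banach,second_countable_topology} set. finite B0 \<and> span B0 = UNIV"
  shows "\<exists>B c. fin_coords (B::'a set) c"
proof -
  obtain B0 :: "'a set" where B0: "finite B0" "span B0 = UNIV" using assms by blast
  obtain B where B: "B \<subseteq> B0" "independent B" "B0 \<subseteq> span B"
    using maximal_independent_subset[of B0] by blast
  have spB: "span B = UNIV"
    using span_mono[OF B(3)] B0(2) by (simp add: span_span top.extremum_uniqueI)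
  have fin: "finite B" using B B0 finite_subset by blast
  define c where "c = (\<lambda>b x. representation B x b)"
  have sum: "(\<Sum>b\<in>B. c b x *\<^sub>R b) = x" for x
    unfolding c_def using sum_representation_eq[of B x B] B spB fin by auto
  have lin: "linear (c b)" for b
    unfolding c_def using B spB by (intro linearI) (auto simp: representation_add representation_scale)
  have "bounded_linear (c b)" if b: "b \<in> B" for b
  proof -
    have "b \<notin> span (B - {b})" using B(2) b dependent_def by blast
    moreover have "closed (span (B - {b}))" using fin by (intro closed_span_finite) auto
    ultimately obtain d where d: "d > 0"
      "\<And>k s. s \<in> span (B - {b}) \<Longrightarrow> \<bar>k\<bar> * d \<le> norm (k *\<^sub>R b + s)"
      using span_coordinate_bound by blast
    have "\<bar>c b x\<bar> \<le> norm x * (1/d)" for x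
    proof -
      have "(\<Sum>b'\<in>B-{b}. c b' x *\<^sub>R b') \<in> span (B - {b})"
        by (intro span_sum span_mul span_base)
      moreover have "x = c b x *\<^sub>R b + (\<Sum>b'\<in>B-{b}. c b' x *\<^sub>R b')"
        using sum[of x] sum.remove[OF fin b, of "\<lambda>b. c b x *\<^sub>R b"] by simp
      ultimately have "\<bar>c b x\<bar> * d \<le> norm x" using d(2) by metis
      then show ?thesis using d(1) by (simp add: field_simps)
    qed
    then show ?thesis using lin[of b] by (intro bounded_linear_intro[of _ "1/d"])
      (auto simp: linear_add linear_cmul)
  qed
  then show ?thesis using fin sum by (intro exI[of _ B] exI[of _ c]) (simp add: fin_coords_def)
qed

text \<open>Lets the results on vector-valued curves and measures be applied to scalar ones, such as
  the energy along the curve.\<close>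

lemma fin_coords_real: "fin_coords {1::real} (\<lambda>_ x. x)"
  by (simp add: fin_coords_def bounded_linear_ident)

context fin_coords begin

lemma coord_bound: obtains K where "K > 0" "\<And>b x. b \<in> B \<Longrightarrow> \<bar>c b x\<bar> \<le> K * norm x"
proof -
  have "\<forall>b\<in>B. \<exists>K. \<forall>x. norm (c b x) \<le> norm x * K" by (intro ballI bounded_linear.bounded c_bl)
  then obtain k where k: "\<And>b x. b \<in> B \<Longrightarrow> norm (c b x) \<le> norm x * k b" by metis
  define K where "K = 1 + (\<Sum>b\<in>B. \<bar>k b\<bar>)"
  have "K > 0" unfolding K_def using sum_nonneg[of B "\<lambda>b. \<bar>k b\<bar>"] by (simp add: add_pos_nonneg)
  moreover have "\<bar>c b x\<bar> \<le> K * norm x" if b: "b \<in> B" for b x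
  proof -
    have "k b \<le> K" unfolding K_def using member_le_sum[OF b, of "\<lambda>b. \<bar>k b\<bar>"] finB by simp
    then have "norm x * k b \<le> norm x * K" by (simp add: mult_left_mono)
    then show ?thesis using k[OF b, of x] by (simp add: mult.commute)
  qed
  ultimately show ?thesis using that by blast
qed

lemma norm_le_coords: obtains K where "K > 0" "\<And>x. norm x \<le> K * (\<Sum>b\<in>B. \<bar>c b x\<bar>)"
proof -
  define K where "K = 1 + (\<Sum>b\<in>B. norm b)"
  have "K > 0" unfolding K_def using sum_nonneg[of B norm] by (simp add: add_pos_nonneg)
  moreover have "norm x \<le> K * (\<Sum>b\<in>B. \<bar>c b x\<bar>)" for x
  proof -
    have "norm x = norm (\<Sum>b\<in>B. c b x *\<^sub>R b)" by (simp add: c_sum)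
    also have "\<dots> \<le> (\<Sum>b\<in>B. \<bar>c b x\<bar> * norm b)" by (rule order_trans[OF norm_sum]) simp
    also have "\<dots> \<le> (\<Sum>b\<in>B. \<bar>c b x\<bar> * K)"
    proof (intro sum_mono mult_left_mono)
      fix b assume "b \<in> B"
      then show "norm b \<le> K" unfolding K_def using member_le_sum[of b B norm] finB by simp
    qed simp
    finally show ?thesis by (simp add: sum_distrib_left mult.commute)
  qed
  ultimately show ?thesis using that by blast
qed

text \<open>The vectors with bounded coefficients form a compact set, by induction as a sum of
  segments; since the coordinates are bounded on a ball, the ball is a closed subset of such a
  set.\<close>

lemma compact_cball_fin: "compact (cball (0::'a) r)"
proof -
  obtain K where K: "K > 0" "\<And>b x. b \<in> B \<Longrightarrow> \<bar>c b x\<bar> \<le> K * norm x" using coord_bound by blast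
  have "compact {\<Sum>b\<in>S. k b *\<^sub>R b | k. \<forall>b\<in>S. \<bar>k b\<bar> \<le> M}" if "finite S" for S :: "'a set" and M
    using that
  proof induction
    case (insert a S)
    have "compact ((\<lambda>x. x *\<^sub>R a) ` {-M..M})" by (intro compact_continuous_image continuous_intros) auto
    moreover have "{\<Sum>b\<in>insert a S. k b *\<^sub>R b | k. \<forall>b\<in>insert a S. \<bar>k b\<bar> \<le> M} =
      {x + y | x y. x \<in> (\<lambda>x. x *\<^sub>R a) ` {-M..M} \<and> y \<in> {\<Sum>b\<in>S. k b *\<^sub>R b | k. \<forall>b\<in>S. \<bar>k b\<bar> \<le> M}}"
      (is "?L = ?R")
    proof
      show "?L \<subseteq> ?R"
      proof clarify
        fix k assume k: "\<forall>b\<in>insert a S. \<bar>k b\<bar> \<le> M"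
        then show "\<exists>x y. (\<Sum>b\<in>insert a S. k b *\<^sub>R b) = x + y \<and> x \<in> (\<lambda>x. x *\<^sub>R a) ` {-M..M} \<and>
            y \<in> {\<Sum>b\<in>S. k b *\<^sub>R b | k. \<forall>b\<in>S. \<bar>k b\<bar> \<le> M}"
          using insert by (intro exI[of _ "k a *\<^sub>R a"] exI[of _ "\<Sum>b\<in>S. k b *\<^sub>R b"]) (auto simp: abs_le_iff)
      qed
      show "?R \<subseteq> ?L"
      proof clarify
        fix x k assume k: "\<forall>b\<in>S. \<bar>k b\<bar> \<le> M" and x: "x \<in> {-M..M}"
        have "(\<Sum>b\<in>S. (k(a := x)) b *\<^sub>R b) = (\<Sum>b\<in>S. k b *\<^sub>R b)"
          using insert by (intro sum.cong) auto
        then show "\<exists>k'. x *\<^sub>R a + (\<Sum>b\<in>S. k b *\<^sub>R b) = (\<Sum>b\<in>insert a S. k' b *\<^sub>R b) \<and>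
            (\<forall>b\<in>insert a S. \<bar>k' b\<bar> \<le> M)"
          using insert k x by (intro exI[of _ "k(a := x)"]) (auto simp: abs_le_iff)
      qed
    qed
    ultimately show ?case using compact_sums[OF _ insert.IH] by simp
  qed auto
  then have "compact {\<Sum>b\<in>B. k b *\<^sub>R b | k. \<forall>b\<in>B. \<bar>k b\<bar> \<le> K * r}" using finB by blast
  moreover have "cball 0 r \<subseteq> {\<Sum>b\<in>B. k b *\<^sub>R b | k. \<forall>b\<in>B. \<bar>k b\<bar> \<le> K * r}"
  proof
    fix x :: 'a assume "x \<in> cball 0 r"
    then have "\<bar>c b x\<bar> \<le> K * r" if "b \<in> B" for b
      using K(2)[OF that, of x] K(1) by (smt (verit) mem_cball_0 mult_left_mono)
    then show "x \<in> {\<Sum>b\<in>B. k b *\<^sub>R b | k. \<forall>b\<in>B. \<bar>k b\<bar> \<le> K * r}"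
      unfolding mem_Collect_eq using c_sum[of x] by (intro exI[of _ "\<lambda>b. c b x"]) auto
  qed
  ultimately show ?thesis
    using compact_Int_closed[OF _ closed_cball[of "0::'a" r], of "{\<Sum>b\<in>B. k b *\<^sub>R b | k. \<forall>b\<in>B. \<bar>k b\<bar> \<le> K * r}"]
    by (simp add: Int_absorb1)
qed

end

section \<open>Countably additive set functions\<close>

text \<open>The additivity part of \<open>vmeasure\<close>, without the convention of vanishing off
  the Borel sets; restrictions, linear images and integrals stay in this class without case
  distinctions.\<close>

definition cadd :: "(real set \<Rightarrow> 'a::real_normed_vector) \<Rightarrow> bool" where
  "cadd \<nu> \<longleftrightarrow> \<nu> {} = 0 \<and> (\<forall>A::nat \<Rightarrow> real set. range A \<subseteq> sets borel \<and> disjoint_family A \<longrightarrow>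
     (\<lambda>n. \<nu> (A n)) sums \<nu> (\<Union>n. A n))"

lemma vmeasure_cadd: "vmeasure \<nu> \<Longrightarrow> cadd \<nu>"
  by (simp add: vmeasure_def cadd_def)

lemma vmeasure_zero: "vmeasure \<nu> \<Longrightarrow> A \<notin> sets borel \<Longrightarrow> \<nu> A = 0"
  by (simp add: vmeasure_def)

lemma cadd_vmeasure: "cadd \<nu> \<Longrightarrow> vmeasure (\<lambda>A. if A \<in> sets borel then \<nu> A else 0)"
  unfolding cadd_def vmeasure_def by (auto simp: image_subset_iff)

lemma cadd_cong:
  assumes "cadd \<nu>" "\<And>A. A \<in> sets borel \<Longrightarrow> \<nu>' A = \<nu> A" shows "cadd \<nu>'"
  using assms unfolding cadd_def by (auto simp: image_subset_iff)

lemma cadd_empty: "cadd \<nu> \<Longrightarrow> \<nu> {} = 0"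
  by (simp add: cadd_def)

lemma cadd_sums:
  "cadd \<nu> \<Longrightarrow> (\<And>n. A n \<in> sets borel) \<Longrightarrow> disjoint_family A \<Longrightarrow> (\<lambda>n. \<nu> (A n)) sums \<nu> (\<Union>n::nat. A n)"
  by (auto simp: cadd_def)

lemma cadd_Un:
  assumes "cadd \<nu>" "A \<in> sets borel" "B \<in> sets borel" "A \<inter> B = {}"
  shows "\<nu> (A \<union> B) = \<nu> A + \<nu> B"
proof -
  have "(\<lambda>n. \<nu> (binaryset A B n)) sums \<nu> (\<Union>n. binaryset A B n)"
    using assms by (intro cadd_sums) (auto simp: binaryset_def disjoint_family_on_def)
  moreover have "(\<lambda>n. \<nu> (binaryset A B n)) sums (\<nu> A + \<nu> B)"
    using binaryset_sums[of \<nu> A B] cadd_empty[OF assms(1)] by simp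
  ultimately show ?thesis using sums_unique2 by (metis UN_binaryset_eq)
qed

lemma cadd_Diff:
  assumes "cadd \<nu>" "A \<in> sets borel" "B \<in> sets borel" "B \<subseteq> A"
  shows "\<nu> (A - B) = \<nu> A - \<nu> B"
proof -
  have "\<nu> ((A - B) \<union> B) = \<nu> (A - B) + \<nu> B" by (intro cadd_Un) (use assms in auto)
  moreover have "(A - B) \<union> B = A" using assms by auto
  ultimately show ?thesis by simp
qed

lemma cadd_split:
  assumes "cadd \<nu>" "A \<in> sets borel" "B \<in> sets borel"
  shows "\<nu> A = \<nu> (A - B) + \<nu> (A \<inter> B)"
proof -
  have "\<nu> ((A - B) \<union> (A \<inter> B)) = \<nu> (A - B) + \<nu> (A \<inter> B)"
    by (rule cadd_Un[OF assms(1)]) (use assms in auto)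
  then show ?thesis by (simp add: Un_Diff_Int)
qed

lemma cadd_finite_Union:
  assumes "cadd \<nu>" "finite P" "P \<subseteq> sets borel" "disjoint P"
  shows "\<nu> (\<Union>P) = (\<Sum>B\<in>P. \<nu> B)"
  using assms(2-)
proof induction
  case (insert x F)
  have "disjoint F" using insert.prems(2) unfolding disjoint_def pairwise_def by auto
  moreover have "x \<inter> X = {}" if "X \<in> F" for X
    using insert.hyps(2) insert.prems(2) that unfolding disjoint_def by (metis insertI1 insertI2)
  then have "x \<inter> \<Union>F = {}" by blast
  moreover have "disjoint F" using insert.prems(2) unfolding disjoint_def pairwise_def by auto
  moreover have "\<Union>F \<in> sets borel" using insert by (intro sets.finite_Union) auto
  ultimately show ?case using insert cadd_Un[OF assms(1), of x "\<Union>F"] by simp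
qed (simp add: cadd_empty[OF assms(1)])

lemma cadd_restrict:
  assumes "cadd \<nu>" "S \<in> sets borel" shows "cadd (\<lambda>A. \<nu> (A \<inter> S))"
  unfolding cadd_def
proof (intro conjI allI impI; (elim conjE)?)
  fix A :: "nat \<Rightarrow> real set" assume A: "range A \<subseteq> sets borel" "disjoint_family A"
  have "(\<lambda>n. \<nu> (A n \<inter> S)) sums \<nu> (\<Union>n. A n \<inter> S)"
    by (rule cadd_sums[OF assms(1)]) (use A assms in \<open>auto simp: disjoint_family_on_def\<close>)
  then show "(\<lambda>n. \<nu> (A n \<inter> S)) sums \<nu> ((\<Union>n. A n) \<inter> S)" by (simp add: Int_UN_distrib2)
qed (simp add: cadd_empty[OF assms(1)])

lemma cadd_restrict_diff:
  assumes "cadd \<nu>" "S \<in> sets borel" shows "cadd (\<lambda>A. \<nu> (A - S))"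
  using cadd_restrict[OF assms(1), of "- S"] assms(2) by (simp add: Diff_eq)

lemma cadd_linear:
  assumes "cadd \<nu>" "bounded_linear f" shows "cadd (\<lambda>A. f (\<nu> A))"
  using assms unfolding cadd_def by (auto intro: bounded_linear.sums simp: linear_simps)

lemma cadd_add: "cadd \<nu> \<Longrightarrow> cadd \<nu>' \<Longrightarrow> cadd (\<lambda>A. \<nu> A + \<nu>' A)"
  unfolding cadd_def by (auto intro: sums_add)

lemma cadd_diff: "cadd \<nu> \<Longrightarrow> cadd \<nu>' \<Longrightarrow> cadd (\<lambda>A. \<nu> A - \<nu>' A)"
  unfolding cadd_def by (auto intro: sums_diff)

lemma cadd_sum: "(\<And>i. i \<in> I \<Longrightarrow> cadd (\<nu> i)) \<Longrightarrow> cadd (\<lambda>A. \<Sum>i\<in>I. \<nu> i A)"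
  unfolding cadd_def by (auto intro!: sums_sum)

lemma cadd_measure:
  assumes "finite_measure M" "sets M = sets borel" shows "cadd (measure M)"
  unfolding cadd_def using finite_measure.finite_measure_UNION[OF assms(1)] assms(2) by auto

lemma cadd_set_integral:
  fixes h :: "real \<Rightarrow> 'a::{banach, second_countable_topology}"
  assumes h: "integrable M h" and M: "sets M = sets borel"
  shows "cadd (\<lambda>A. LINT t:A|M. h t)"
  unfolding cadd_def
proof (intro conjI allI impI; (elim conjE)?)
  fix A :: "nat \<Rightarrow> real set" assume A: "range A \<subseteq> sets borel" "disjoint_family A"
  have meas: "A n \<in> sets M" for n using A M by auto
  have disj: "A i \<inter> A j = {}" if "i \<noteq> j" for i j using A(2) that by (auto simp: disjoint_family_on_def)
  have int: "set_integrable M (\<Union>n. A n) h" "set_integrable M (A i) h" for i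
    unfolding set_integrable_def using meas h by (auto intro!: integrable_mult_indicator)
  have nint: "integrable M (\<lambda>t. norm (h t))" using h by (rule integrable_norm)
  have "summable (\<lambda>n. norm (LINT t:A n|M. h t))"
  proof (rule summableI_nonneg_bounded)
    fix n
    have "(\<Sum>i<n. norm (LINT t:A i|M. h t)) \<le> (\<Sum>i<n. LINT t:A i|M. norm (h t))"
      using set_integral_norm_bound[OF int(2)] by (intro sum_mono) (auto simp: set_lebesgue_integral_def)
    also have "\<dots> = (LINT t:(\<Union>i<n. A i)|M. norm (h t))"
      using nint meas disj by (subst set_integral_finite_Union)
        (auto simp: disjoint_family_on_def set_integrable_def simp del: real_scaleR_def intro!: integrable_mult_indicator)
    also have "\<dots> \<le> (LINT t|M. norm (h t))"
      unfolding set_lebesgue_integral_def using nint meas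
      by (intro integral_mono integrable_mult_indicator) (auto split: split_indicator)
    finally show "(\<Sum>i<n. norm (LINT t:A i|M. h t)) \<le> (LINT t|M. norm (h t))" .
  qed simp
  then have "summable (\<lambda>n. LINT t:A n|M. h t)" by (rule summable_norm_cancel)
  then show "(\<lambda>n. LINT t:A n|M. h t) sums (LINT t:(\<Union>n. A n)|M. h t)"
    using lebesgue_integral_countable_add[of A M h, OF meas disj int(1)] by (simp add: summable_sums)
qed (simp add: set_lebesgue_integral_def)

text \<open>Open intervals form an intersection-stable generator of the Borel sets. Agreement on
  \<open>UNIV\<close> is a separate hypothesis because complements are formed relative to it and it
  is no bounded interval.\<close>

lemma cadd_unique:
  assumes "cadd \<nu>" "cadd \<nu>'" "\<And>a b. \<nu> {a<..<b} = \<nu>' {a<..<b}" "\<nu> UNIV = \<nu>' UNIV" "A \<in> sets borel"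
  shows "\<nu> A = \<nu>' A"
proof -
  let ?G = "range (\<lambda>(a, b). {a<..<b::real})"
  have G: "sets borel = sigma_sets UNIV ?G"
    unfolding borel_eq_box by (simp add: box_real[abs_def] case_prod_unfold)
  have "Int_stable ?G" by (auto simp: Int_stable_def)
  moreover have "?G \<subseteq> Pow UNIV" by simp
  ultimately show ?thesis using assms(5) unfolding G
  proof (induction rule: sigma_sets_induct_disjoint)
    case (basic A) then show ?case using assms(3) by auto
  next
    case empty then show ?case using assms by (simp add: cadd_empty)
  next
    case (compl A)
    then have "A \<in> sets borel" using G by simp
    then show ?case using compl cadd_Diff[OF assms(1), of UNIV A] cadd_Diff[OF assms(2), of UNIV A] assms(4) by simp
  next
    case (union A)
    then have "range A \<subseteq> sets borel" using G by simp
    then have b: "A n \<in> sets borel" for n by auto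
    have "(\<lambda>n. \<nu> (A n)) sums \<nu> (\<Union>n. A n)" "(\<lambda>n. \<nu>' (A n)) sums \<nu>' (\<Union>n. A n)"
      by (rule cadd_sums[OF assms(1) b union(1)], rule cadd_sums[OF assms(2) b union(1)])
    then show ?case using union by (simp add: sums_unique2)
  qed
qed

text \<open>Splits a countable set into a sequence of singletons, with empty sets at the indices
  that are not attained, so that finite sets are covered too.\<close>

definition ptset :: "'b set \<Rightarrow> nat \<Rightarrow> 'b set" where
  "ptset C n = {x\<in>C. to_nat_on C x = n}"

lemma ptset:
  assumes "countable C"
  shows "(\<Union>n. ptset C n) = C" "disjoint_family (ptset C)" "ptset C n = {} \<or> (\<exists>x\<in>C. ptset C n = {x})"
proof -
  note inj = inj_onD[OF inj_on_to_nat_on[OF assms]]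
  show "(\<Union>n. ptset C n) = C" "disjoint_family (ptset C)"
    by (auto simp: ptset_def disjoint_family_on_def)
  show "ptset C n = {} \<or> (\<exists>x\<in>C. ptset C n = {x})"
  proof (cases "ptset C n = {}")
    case False
    then obtain x where x: "x \<in> C" "to_nat_on C x = n" by (auto simp: ptset_def)
    then have "ptset C n = {x}" using inj by (auto simp: ptset_def)
    then show ?thesis using x by blast
  qed simp
qed

lemma ptset_borel: "countable C \<Longrightarrow> ptset C n \<in> sets (borel :: real measure)"
  using ptset(3)[of C n] by auto

lemma countable_borel: "countable C \<Longrightarrow> (C::real set) \<in> sets borel"
  using sets.countable[of C borel] by auto

lemma cadd_countable_bound:
  assumes \<nu>: "cadd \<nu>" and m: "finite_measure m" "sets m = sets borel" and C: "countable C"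
    and le: "\<And>r. r \<in> C \<Longrightarrow> norm (\<nu> {r}) \<le> e * measure m {r}"
  shows "norm (\<nu> C) \<le> e * measure m C"
proof -
  have 1: "(\<lambda>n. \<nu> (ptset C n)) sums \<nu> C"
    using cadd_sums[OF \<nu>, of "ptset C"] ptset[OF C] ptset_borel[OF C] by simp
  have 2: "(\<lambda>n. e * measure m (ptset C n)) sums (e * measure m C)"
    using cadd_sums[OF cadd_measure[OF m], of "ptset C"] ptset[OF C] ptset_borel[OF C] by (simp add: sums_mult)
  have 3: "norm (\<nu> (ptset C n)) \<le> e * measure m (ptset C n)" for n
    using ptset(3)[OF C, of n] le by (auto simp: cadd_empty[OF \<nu>])
  have "(\<lambda>n. norm (\<Sum>i<n. \<nu> (ptset C i))) \<longlonglongrightarrow> norm (\<nu> C)"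
    using 1 unfolding sums_def by (rule tendsto_norm)
  moreover have "norm (\<Sum>i<n. \<nu> (ptset C i)) \<le> (\<Sum>i<n. e * measure m (ptset C i))" for n
    by (rule order_trans[OF norm_sum sum_mono]) (rule 3)
  ultimately show ?thesis using 2 unfolding sums_def by (intro LIMSEQ_le) auto
qed

text \<open>Countable additivity only gives convergence along an enumeration, whereas the jump terms
  are summed over an index set. The dominating finite measure bounds the remainder after any finite
  set that contains enough points, hence the sum is unconditional.\<close>

lemma cadd_has_sum:
  fixes \<nu> :: "real set \<Rightarrow> real"
  assumes \<nu>: "cadd \<nu>" and m: "finite_measure m" "sets m = sets borel" and C: "countable C"
    and le: "\<And>r. r \<in> C \<Longrightarrow> norm (\<nu> {r}) \<le> e * measure m {r}" and e: "e \<ge> 0"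
  shows "((\<lambda>r. \<nu> {r}) has_sum \<nu> C) C"
  unfolding has_sum_def tendsto_iff eventually_finite_subsets_at_top
proof (intro allI impI)
  fix d :: real assume d: "d > 0"
  let ?F = "\<lambda>n. \<Union>i<n. ptset C i"
  interpret finite_measure m by fact
  have "(\<lambda>n. \<Sum>i<n. measure m (ptset C i)) \<longlonglongrightarrow> measure m C"
    using cadd_sums[OF cadd_measure[OF m], of "ptset C"] ptset[OF C] ptset_borel[OF C] by (simp add: sums_def)
  moreover have "(\<Sum>i<n. measure m (ptset C i)) = measure m (?F n)" for n
    using ptset[OF C] ptset_borel[OF C] m
    by (subst finite_measure_finite_Union) (auto simp: disjoint_family_on_def)
  ultimately have "(\<lambda>n. e * (measure m C - measure m (?F n))) \<longlonglongrightarrow> e * (measure m C - measure m C)"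
    by (intro tendsto_intros) simp
  then have "\<forall>\<^sub>F n in sequentially. e * (measure m C - measure m (?F n)) < d"
    using d by (intro order_tendstoD(2)[where a=d]) auto
  then obtain n where n: "e * (measure m C - measure m (?F n)) < d"
    by (auto simp: eventually_sequentially)
  have fin: "finite (?F n)" using ptset(3)[OF C] by (metis finite_UN_I finite_lessThan finite.emptyI finite.insertI)
  have sub: "?F n \<subseteq> C" using ptset(1)[OF C] by auto
  show "\<exists>X. finite X \<and> X \<subseteq> C \<and> (\<forall>Y. finite Y \<and> X \<subseteq> Y \<and> Y \<subseteq> C \<longrightarrow> dist (\<Sum>r\<in>Y. \<nu> {r}) (\<nu> C) < d)"
  proof (intro exI[of _ "?F n"] conjI allI impI fin sub; (elim conjE)?)
    fix Y assume Y: "finite Y" "?F n \<subseteq> Y" "Y \<subseteq> C"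
    have bor: "C \<in> sets borel" "Y \<in> sets borel" "?F n \<in> sets borel"
      using C Y fin by (auto intro!: countable_borel countable_finite simp del: UN_simps)
    have inj: "inj_on (\<lambda>r. {r}) Y" "\<Union>((\<lambda>r. {r}) ` Y) = Y" by auto
    have "\<nu> Y = (\<Sum>r\<in>Y. \<nu> {r})"
      using cadd_finite_Union[OF \<nu>, of "(\<lambda>r. {r}) ` Y"] Y(1) inj
      by (auto simp: sum.reindex disjoint_def pairwise_def image_subset_iff)
    then have "dist (\<Sum>r\<in>Y. \<nu> {r}) (\<nu> C) = norm (\<nu> (C - Y))"
      using cadd_Diff[OF \<nu> bor(1,2) Y(3)] by (simp add: dist_norm norm_minus_commute)
    also have "\<dots> \<le> e * measure m (C - Y)"
      by (rule cadd_countable_bound[OF \<nu> m]) (use C le in auto)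
    also have "\<dots> \<le> e * measure m (C - ?F n)"
      using Y bor m e by (intro mult_left_mono finite_measure_mono) auto
    also have "\<dots> = e * (measure m C - measure m (?F n))"
      using bor m sub by (subst finite_measure_Diff) auto
    finally show "dist (\<Sum>r\<in>Y. \<nu> {r}) (\<nu> C) < d" using n by simp
  qed
qed

section \<open>Total variation and densities\<close>

definition borel_partitions :: "real set \<Rightarrow> real set set set" where
  "borel_partitions A = {P. finite P \<and> P \<subseteq> sets borel \<and> disjoint P \<and> \<Union>P = A}"

text \<open>The set function under \<open>measure_of\<close> in \<open>vm_variation\<close>; it
  becomes the value of that measure only after its countable additivity is proved.\<close>

definition vvar :: "(real set \<Rightarrow> 'a::real_normed_vector) \<Rightarrow> real set \<Rightarrow> ennreal" where
  "vvar \<nu> A = (SUP P\<in>borel_partitions A. \<Sum>B\<in>P. ennreal (norm (\<nu> B)))"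

lemma borel_partitions_single: "A \<in> sets borel \<Longrightarrow> {A} \<in> borel_partitions A"
  by (auto simp: borel_partitions_def disjoint_def)

lemma vvar_ge: "P \<in> borel_partitions A \<Longrightarrow> (\<Sum>B\<in>P. ennreal (norm (\<nu> B))) \<le> vvar \<nu> A"
  unfolding vvar_def by (rule SUP_upper)

lemma norm_le_vvar: "A \<in> sets borel \<Longrightarrow> ennreal (norm (\<nu> A)) \<le> vvar \<nu> A"
  using vvar_ge[OF borel_partitions_single, of A \<nu>] by simp

lemma vvar_zero:
  assumes "\<And>B. B \<in> sets borel \<Longrightarrow> B \<subseteq> A \<Longrightarrow> \<nu> B = 0" shows "vvar \<nu> A = 0"
proof -
  have "vvar \<nu> A \<le> 0" unfolding vvar_def
  proof (rule SUP_least)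
    fix P assume "P \<in> borel_partitions A"
    then have "\<nu> B = 0" if "B \<in> P" for B using that by (intro assms) (auto simp: borel_partitions_def)
    then show "(\<Sum>B\<in>P. ennreal (norm (\<nu> B))) \<le> 0" by simp
  qed
  then show ?thesis by simp
qed

text \<open>Partitions of two disjoint sets merge into one of the union; the only member they can
  share is the empty set, which contributes nothing.\<close>

lemma vvar_superadd:
  assumes \<nu>: "cadd \<nu>" and AB: "A \<in> sets borel" "B \<in> sets borel" "A \<inter> B = {}"
  shows "vvar \<nu> A + vvar \<nu> B \<le> vvar \<nu> (A \<union> B)"
proof -
  have *: "(\<Sum>D\<in>P. ennreal (norm (\<nu> D))) + (\<Sum>D\<in>Q. ennreal (norm (\<nu> D))) \<le> vvar \<nu> (A \<union> B)"
    if P: "P \<in> borel_partitions A" and Q: "Q \<in> borel_partitions B" for P Q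
  proof -
    have "D = {}" if "D \<in> P \<inter> Q" for D using that P Q AB(3) unfolding borel_partitions_def by blast
    then have 0: "(\<Sum>D\<in>P \<inter> Q. ennreal (norm (\<nu> D))) = 0" using cadd_empty[OF \<nu>] by (intro sum.neutral) auto
    have dj: "D \<inter> D' = {}" if "D \<in> P" "D' \<in> Q" for D D'
      using that P Q AB(3) unfolding borel_partitions_def by blast
    then have "P \<union> Q \<in> borel_partitions (A \<union> B)"
    proof -
      have "D1 \<inter> D2 = {}" if "D1 \<in> P \<union> Q" "D2 \<in> P \<union> Q" "D1 \<noteq> D2" for D1 D2
      proof -
        have "disjoint P" "disjoint Q" using P Q by (auto simp: borel_partitions_def)
        then have "\<And>D D'. D \<in> P \<Longrightarrow> D' \<in> P \<Longrightarrow> D \<noteq> D' \<Longrightarrow> D \<inter> D' = {}"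
          "\<And>D D'. D \<in> Q \<Longrightarrow> D' \<in> Q \<Longrightarrow> D \<noteq> D' \<Longrightarrow> D \<inter> D' = {}"
          unfolding disjoint_def by blast+
        then show ?thesis using that dj[of D1 D2] dj[of D2 D1] by blast
      qed
      then have "disjoint (P \<union> Q)" unfolding disjoint_def by blast
      then show ?thesis using P Q unfolding borel_partitions_def by auto
    qed
    then show ?thesis using sum.union_inter[of P Q "\<lambda>D. ennreal (norm (\<nu> D))"] P Q 0
      vvar_ge[of "P \<union> Q" "A \<union> B" \<nu>] by (simp add: borel_partitions_def)
  qed
  have ne: "borel_partitions A \<noteq> {}" "borel_partitions B \<noteq> {}" using AB borel_partitions_single by blast+
  have "(\<Sum>D\<in>P. ennreal (norm (\<nu> D))) + vvar \<nu> B \<le> vvar \<nu> (A \<union> B)" if P: "P \<in> borel_partitions A" for P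
    unfolding vvar_def[of \<nu> B] using *[OF P] ne by (subst ennreal_SUP_add_right) (auto intro!: SUP_least)
  then show ?thesis
    unfolding vvar_def[of \<nu> A] using ne by (subst ennreal_SUP_add_left[symmetric]) (auto intro!: SUP_least)
qed

lemma vvar_mono:
  assumes \<nu>: "cadd \<nu>" and AB: "A \<in> sets borel" "B \<in> sets borel" "A \<subseteq> B"
  shows "vvar \<nu> A \<le> vvar \<nu> B"
  using vvar_superadd[OF \<nu>, of A "B - A"] AB by (auto simp: Un_absorb1 dest: add_leE intro: order_trans[rotated])

text \<open>Each member \<open>D\<close> of a partition is cut along the sets \<open>A n\<close>. If
  the norms of the pieces have an infinite sum there is nothing to show for \<open>D\<close>;
  otherwise the triangle inequality passes to the series.\<close>

lemma vvar_countably_subadd: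
  fixes A :: "nat \<Rightarrow> real set"
  assumes \<nu>: "cadd \<nu>" and A: "\<And>n. A n \<in> sets borel" "disjoint_family A"
  shows "vvar \<nu> (\<Union>n. A n) \<le> (\<Sum>n. vvar \<nu> (A n))"
  unfolding vvar_def[of \<nu> "\<Union>n. A n"]
proof (rule SUP_least)
  fix P assume P: "P \<in> borel_partitions (\<Union>n. A n)"
  then have fin: "finite P" and PB: "P \<subseteq> sets borel" and dj: "disjoint P" and U: "\<Union>P = (\<Union>n. A n)"
    by (auto simp: borel_partitions_def)
  have 1: "ennreal (norm (\<nu> D)) \<le> (\<Sum>n. ennreal (norm (\<nu> (D \<inter> A n))))" if D: "D \<in> P" for D
  proof (cases "(\<Sum>n. ennreal (norm (\<nu> (D \<inter> A n)))) = top")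
    case False
    have s: "(\<lambda>n. \<nu> (D \<inter> A n)) sums \<nu> (\<Union>n. D \<inter> A n)"
    proof (rule cadd_sums[OF \<nu>])
      show "disjoint_family (\<lambda>n. D \<inter> A n)" using A(2) unfolding disjoint_family_on_def by blast
    qed (use D PB A in auto)
    have Deq: "(\<Union>n. D \<inter> A n) = D" using D U by auto
    have sm: "summable (\<lambda>n. norm (\<nu> (D \<inter> A n)))" using False by (intro summable_suminf_not_top) auto
    have "norm (\<nu> D) \<le> (\<Sum>n. norm (\<nu> (D \<inter> A n)))"
    proof (rule LIMSEQ_le_const2)
      show "(\<lambda>k. norm (\<Sum>n<k. \<nu> (D \<inter> A n))) \<longlonglongrightarrow> norm (\<nu> D)"
        using s unfolding sums_def Deq by (rule tendsto_norm)
      show "\<exists>N. \<forall>k\<ge>N. norm (\<Sum>n<k. \<nu> (D \<inter> A n)) \<le> (\<Sum>n. norm (\<nu> (D \<inter> A n)))"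
        by (intro exI allI impI order_trans[OF norm_sum sum_le_suminf[OF sm]]) auto
    qed
    then show ?thesis using sm by (subst suminf_ennreal2) (auto intro: ennreal_leI)
  qed simp
  have 2: "(\<Sum>D\<in>P. ennreal (norm (\<nu> (D \<inter> A n)))) \<le> vvar \<nu> (A n)" for n
  proof -
    let ?Q = "(\<lambda>D. D \<inter> A n) ` P"
    have "(\<Sum>D\<in>P. ennreal (norm (\<nu> (D \<inter> A n)))) = (\<Sum>D\<in>?Q. ennreal (norm (\<nu> D)))"
    proof (subst sum.reindex_nontrivial)
      fix D D' assume "D \<in> P" "D' \<in> P" "D \<noteq> D'" and eq: "D \<inter> A n = D' \<inter> A n"
      then have "D \<inter> D' = {}" using dj by (auto simp: disjoint_def)
      then have "D \<inter> A n = {}" using eq by auto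
      then show "ennreal (norm (\<nu> (D \<inter> A n))) = 0" using cadd_empty[OF \<nu>] by simp
    qed (use fin in auto)
    also have "?Q \<in> borel_partitions (A n)"
      unfolding borel_partitions_def
    proof (safe)
      show "finite ?Q" using fin by simp
      show "D \<inter> A n \<in> sets borel" if "D \<in> P" for D using that PB A(1) by auto
      show "disjoint ?Q" using dj unfolding disjoint_def by blast
      show "x \<in> \<Union>?Q" if "x \<in> A n" for x using that U by (metis IntI UN_I UnionE Union_iff UNIV_I)
    qed
    then have "(\<Sum>D\<in>?Q. ennreal (norm (\<nu> D))) \<le> vvar \<nu> (A n)" by (rule vvar_ge)
    finally show ?thesis .
  qed
  have "(\<Sum>D\<in>P. ennreal (norm (\<nu> D))) \<le> (\<Sum>D\<in>P. \<Sum>n. ennreal (norm (\<nu> (D \<inter> A n))))"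
    by (rule sum_mono) (rule 1)
  also have "\<dots> = (\<Sum>n. \<Sum>D\<in>P. ennreal (norm (\<nu> (D \<inter> A n))))"
    by (rule suminf_sum[symmetric]) auto
  also have "\<dots> \<le> (\<Sum>n. vvar \<nu> (A n))" by (intro suminf_le 2) auto
  finally show "(\<Sum>D\<in>P. ennreal (norm (\<nu> D))) \<le> (\<Sum>n. vvar \<nu> (A n))" .
qed

lemma vvar_countably_superadd:
  fixes A :: "nat \<Rightarrow> real set"
  assumes \<nu>: "cadd \<nu>" and A: "\<And>n. A n \<in> sets borel" "disjoint_family A"
  shows "(\<Sum>n. vvar \<nu> (A n)) \<le> vvar \<nu> (\<Union>n. A n)"
proof (rule suminf_le_const)
  fix k
  have "(\<Sum>n<k. vvar \<nu> (A n)) \<le> vvar \<nu> (\<Union>n<k. A n)"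
  proof (induction k)
    case (Suc k)
    have "(\<Sum>n<Suc k. vvar \<nu> (A n)) \<le> vvar \<nu> (\<Union>n<k. A n) + vvar \<nu> (A k)"
      using Suc by (simp add: add_mono)
    also have "\<dots> \<le> vvar \<nu> ((\<Union>n<k. A n) \<union> A k)"
    proof (rule vvar_superadd[OF \<nu>])
      have "A n \<inter> A k = {}" if "n < k" for n using A(2) that by (auto simp: disjoint_family_on_def)
      then show "(\<Union>n<k. A n) \<inter> A k = {}" by blast
    qed (use A in auto)
    finally show ?case by (simp add: lessThan_Suc Un_commute)
  qed simp
  also have "\<dots> \<le> vvar \<nu> (\<Union>n. A n)" using A by (intro vvar_mono[OF \<nu>]) auto
  finally show "(\<Sum>n<k. vvar \<nu> (A n)) \<le> vvar \<nu> (\<Union>n. A n)" .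
qed simp

lemma vm_variation_eq: "vm_variation \<nu> = measure_of UNIV (sets borel) (vvar \<nu>)"
  unfolding vm_variation_def vvar_def[abs_def] borel_partitions_def ..

lemma sets_vm_variation [simp, measurable_cong]: "sets (vm_variation \<nu>) = sets borel"
  unfolding vm_variation_eq by (metis sets.sets_measure_of_eq space_borel)

lemma space_vm_variation [simp]: "space (vm_variation \<nu>) = UNIV"
  unfolding vm_variation_eq by simp

lemma emeasure_vm_variation:
  assumes "cadd \<nu>" "A \<in> sets borel" shows "emeasure (vm_variation \<nu>) A = vvar \<nu> A"
proof -
  have "positive (sets borel) (vvar \<nu>)" unfolding positive_def using cadd_empty[OF assms(1)] by (auto intro!: vvar_zero)
  moreover have "countably_additive (sets borel) (vvar \<nu>)"
    unfolding countably_additive_def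
    using vvar_countably_subadd[OF assms(1)] vvar_countably_superadd[OF assms(1)] by (auto intro!: antisym)
  moreover have "sigma_algebra UNIV (sets (borel::real measure))" using sets.sigma_algebra_axioms[of borel] by simp
  ultimately show ?thesis unfolding vm_variation_eq using assms(2)
    by (intro emeasure_measure_of_sigma)
qed

context fin_coords begin

text \<open>Suppose the values on subsets of \<open>E\<close> are bounded. For each coordinate, the
  members of a partition are grouped by the sign of that coordinate; each group sums to the
  coordinate of a single value on a union, which bounds the sum over the partition. The factor 2
  counts the two signs.\<close>

lemma vvar_infinite_split:
  assumes \<nu>: "cadd \<nu>" and E: "E \<in> sets borel" and inf: "vvar \<nu> E = \<infinity>"
  shows "\<exists>A. A \<in> sets borel \<and> A \<subseteq> E \<and> norm ((\<nu> A)::'a) > R"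
proof (rule ccontr)
  assume neg: "\<not> (\<exists>A. A \<in> sets borel \<and> A \<subseteq> E \<and> norm ((\<nu> A)::'a) > R)"
  have R: "norm (\<nu> A) \<le> R" if "A \<in> sets borel" "A \<subseteq> E" for A
    using that neg not_less by blast
  obtain K1 where K1: "K1 > 0" "\<And>b x. b \<in> B \<Longrightarrow> \<bar>c b x\<bar> \<le> K1 * norm x" using coord_bound by blast
  obtain K2 where K2: "K2 > 0" "\<And>x. norm x \<le> K2 * (\<Sum>b\<in>B. \<bar>c b x\<bar>)" using norm_le_coords by blast
  have R0: "R \<ge> 0" using R[of "{}"] by (simp add: cadd_empty[OF \<nu>])
  have bd: "(\<Sum>D\<in>P. norm (\<nu> D)) \<le> K2 * (\<Sum>b\<in>B. 2 * (K1 * R))" if P: "P \<in> borel_partitions E" for P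
  proof -
    have fin: "finite P" and PB: "P \<subseteq> sets borel" and dj: "disjoint P" and U: "\<Union>P = E"
      using P by (auto simp: borel_partitions_def)
    have *: "(\<Sum>D\<in>P. \<bar>c b (\<nu> D)\<bar>) \<le> 2 * (K1 * R)" if b: "b \<in> B" for b
    proof -
      interpret cb: bounded_linear "c b" using c_bl[OF b] .
      have Q: "\<bar>\<Sum>D\<in>Q. c b (\<nu> D)\<bar> \<le> K1 * R" if Q: "Q \<subseteq> P" for Q
      proof -
        have "disjoint Q" using dj Q by (auto simp: disjoint_def)
        then have eq: "\<nu> (\<Union>Q) = (\<Sum>D\<in>Q. \<nu> D)"
          using Q PB fin by (intro cadd_finite_Union[OF \<nu>]) (auto intro: finite_subset)
        have "\<Union>Q \<in> sets borel" using Q PB fin by (intro sets.finite_Union) (auto intro: finite_subset)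
        then have "norm (\<nu> (\<Union>Q)) \<le> R" using Q U by (intro R) auto
        then have "K1 * norm (\<nu> (\<Union>Q)) \<le> K1 * R" using K1 by simp
        then show ?thesis using K1(2)[OF b, of "\<nu> (\<Union>Q)"] unfolding eq by (simp add: cb.sum)
      qed
      have "(\<Sum>D\<in>P. \<bar>c b (\<nu> D)\<bar>) = (\<Sum>D\<in>{D\<in>P. c b (\<nu> D) \<ge> 0}. \<bar>c b (\<nu> D)\<bar>) + (\<Sum>D\<in>{D\<in>P. \<not> c b (\<nu> D) \<ge> 0}. \<bar>c b (\<nu> D)\<bar>)"
        using fin by (subst sum.union_disjoint[symmetric]) (auto intro!: sum.cong)
      also have "\<dots> = (\<Sum>D\<in>{D\<in>P. c b (\<nu> D) \<ge> 0}. c b (\<nu> D)) + - (\<Sum>D\<in>{D\<in>P. \<not> c b (\<nu> D) \<ge> 0}. c b (\<nu> D))"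
        by (simp flip: sum_negf)
      also have "\<dots> \<le> 2 * (K1 * R)"
        using Q[of "{D\<in>P. c b (\<nu> D) \<ge> 0}"] Q[of "{D\<in>P. \<not> c b (\<nu> D) \<ge> 0}"] by auto
      finally show ?thesis .
    qed
    have "(\<Sum>D\<in>P. norm (\<nu> D)) \<le> (\<Sum>D\<in>P. K2 * (\<Sum>b\<in>B. \<bar>c b (\<nu> D)\<bar>))" by (intro sum_mono K2)
    also have "\<dots> = K2 * (\<Sum>b\<in>B. \<Sum>D\<in>P. \<bar>c b (\<nu> D)\<bar>)"
      by (simp add: sum_distrib_left sum.swap[of _ B])
    also have "\<dots> \<le> K2 * (\<Sum>b\<in>B. 2 * (K1 * R))"
      using K2(1) * by (intro mult_left_mono sum_mono) auto
    finally show ?thesis .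
  qed
  have "vvar \<nu> E \<le> ennreal (K2 * (\<Sum>b\<in>B. 2 * (K1 * R)))"
    unfolding vvar_def using bd by (intro SUP_least) (simp add: sum_ennreal ennreal_leI)
  then show False using inf by (simp add: top_unique)
qed

text \<open>Infinite variation would allow splitting off, again and again, disjoint pieces of value
  at least 1 in norm while infinite variation remains in the rest; but the values on a disjoint
  sequence tend to zero.\<close>

lemma vvar_finite:
  assumes \<nu>: "cadd (\<nu> :: real set \<Rightarrow> 'a)" shows "vvar \<nu> UNIV < \<infinity>"
proof (rule ccontr)
  assume "\<not> ?thesis"
  then have inf: "vvar \<nu> UNIV = \<infinity>" by (simp add: less_top[symmetric])
  define Pr where "Pr E \<longleftrightarrow> E \<in> sets borel \<and> vvar \<nu> E = \<infinity>" for E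
  have step: "\<exists>E'. Pr E' \<and> (E' \<subseteq> E \<and> norm (\<nu> (E - E')) \<ge> 1)" if E: "Pr E" for E
  proof -
    \<comment> \<open>With this threshold both \<open>A\<close> and \<open>E - A\<close> have values
      of norm at least 1, so whichever half has infinite variation can be kept.\<close>
    obtain A where A: "A \<in> sets borel" "A \<subseteq> E" "norm (\<nu> A) > 1 + norm (\<nu> E)"
      using vvar_infinite_split[OF \<nu>, of E] E unfolding Pr_def by blast
    have EB: "E \<in> sets borel" using E by (simp add: Pr_def)
    have 1: "norm (\<nu> (E - A)) \<ge> 1" using cadd_Diff[OF \<nu> EB A(1,2)] A(3)
      by (smt (verit) norm_triangle_ineq2 norm_minus_commute)
    have 2: "E - (E - A) = A" using A(2) by auto
    have "vvar \<nu> E \<le> vvar \<nu> A + vvar \<nu> (E - A)"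
    proof -
      have "vvar \<nu> E = emeasure (vm_variation \<nu>) (A \<union> (E - A))" using emeasure_vm_variation[OF \<nu> EB] A(2) by (simp add: Un_absorb1)
      also have "\<dots> \<le> emeasure (vm_variation \<nu>) A + emeasure (vm_variation \<nu>) (E - A)"
        using A EB by (intro emeasure_subadditive) auto
      finally show ?thesis using A EB by (simp add: emeasure_vm_variation[OF \<nu>])
    qed
    then have "vvar \<nu> A = \<infinity> \<or> vvar \<nu> (E - A) = \<infinity>" using E by (auto simp: Pr_def top_unique)
    then show ?thesis
    proof
      assume "vvar \<nu> A = \<infinity>"
      then show ?thesis using 1 A by (intro exI[of _ A]) (auto simp: Pr_def)
    next
      assume "vvar \<nu> (E - A) = \<infinity>"
      then show ?thesis using 2 A EB norm_ge_zero[of "\<nu> E"]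
        by (intro exI[of _ "E - A"]) (auto simp: Pr_def simp del: norm_ge_zero)
    qed
  qed
  have "\<exists>f. \<forall>n::nat. Pr (f n) \<and> (f (Suc n) \<subseteq> f n \<and> norm (\<nu> (f n - f (Suc n))) \<ge> 1)"
    by (rule dependent_nat_choice) (use inf step in \<open>auto simp: Pr_def\<close>)
  then obtain f where f: "\<And>n. Pr (f n)" "\<And>n. f (Suc n) \<subseteq> f n" "\<And>n. norm (\<nu> (f n - f (Suc n))) \<ge> 1" by blast
  have dec: "f n \<subseteq> f m" if "m \<le> n" for m n using lift_Suc_antimono_le[of f, OF f(2) that] .
  have "disjoint_family (\<lambda>n. f n - f (Suc n))"
    unfolding disjoint_family_on_def
  proof (intro ballI impI)
    fix m n :: nat assume "m \<noteq> n"
    then show "(f m - f (Suc m)) \<inter> (f n - f (Suc n)) = {}"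
      using dec[of "Suc m" n] dec[of "Suc n" m] by (cases "m < n") auto
  qed
  then have "(\<lambda>n. \<nu> (f n - f (Suc n))) sums \<nu> (\<Union>n. f n - f (Suc n))"
    using f(1) by (intro cadd_sums[OF \<nu>]) (auto simp: Pr_def)
  then have "(\<lambda>n. norm (\<nu> (f n - f (Suc n)))) \<longlonglongrightarrow> 0"
    using sums_summable summable_LIMSEQ_zero tendsto_norm_zero by blast
  then have "\<forall>\<^sub>F n in sequentially. norm (\<nu> (f n - f (Suc n))) < 1" by (rule order_tendstoD) simp
  then obtain n where "norm (\<nu> (f n - f (Suc n))) < 1" by (auto simp: eventually_sequentially)
  then show False using f(3)[of n] by simp
qed

lemma finite_vm_variation:
  assumes \<nu>: "cadd (\<nu> :: real set \<Rightarrow> 'a)" shows "finite_measure (vm_variation \<nu>)"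
  using vvar_finite[OF \<nu>] by (intro finite_measureI) (auto simp: emeasure_vm_variation[OF \<nu>])

lemma norm_le_measure_variation:
  assumes \<nu>: "cadd (\<nu> :: real set \<Rightarrow> 'a)" and A: "A \<in> sets borel"
  shows "norm (\<nu> A) \<le> measure (vm_variation \<nu>) A"
proof -
  interpret finite_measure "vm_variation \<nu>" by (rule finite_vm_variation[OF \<nu>])
  show ?thesis using norm_le_vvar[OF A, of \<nu>] emeasure_vm_variation[OF \<nu> A]
      ennreal_le_iff[OF measure_nonneg, of "norm (\<nu> A)" "vm_variation \<nu>" A]
    by (simp add: emeasure_eq_measure)
qed

end

section \<open>Radon-Nikodym densities of vector-valued set functions\<close>

lemma real_RN_finite:
  assumes M: "finite_measure M" and N: "finite_measure N" "sets N = sets M"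
    and ac: "\<And>A. A \<in> null_sets M \<Longrightarrow> emeasure N A = 0"
  shows "\<exists>g::_ \<Rightarrow> real. integrable M g \<and> (\<forall>A\<in>sets M. measure N A = (LINT t:A|M. g t))"
proof -
  interpret M: finite_measure M by fact
  interpret N: finite_measure N by fact
  have "absolutely_continuous M N" unfolding absolutely_continuous_def using ac N(2) by auto
  then obtain f where f: "f \<in> borel_measurable M" "density M f = N" using M.Radon_Nikodym N(2) by blast
  have e: "emeasure N A = (\<integral>\<^sup>+x\<in>A. f x \<partial>M)" if "A \<in> sets M" for A
    using emeasure_density[OF f(1) that] f(2) by simp
  have "(\<integral>\<^sup>+x. f x \<partial>M) = emeasure N (space M)" by (subst e) (auto intro!: nn_integral_cong)
  then have fin: "(\<integral>\<^sup>+x. f x \<partial>M) < \<infinity>" by (simp add: N.emeasure_eq_measure)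
  \<comment> \<open>The integral of \<open>f\<close> is the total mass of \<open>N\<close>, which is
    finite; hence \<open>f\<close> is finite almost everywhere and has a real version.\<close>
  then have AEf: "AE x in M. f x \<noteq> \<infinity>" using nn_integral_PInf_AE[OF f(1)] by auto
  then have AEe: "AE x in M. ennreal (enn2real (f x)) = f x" by eventually_elim (simp add: top.not_eq_extremum)
  have "(\<integral>\<^sup>+x. ennreal (enn2real (f x)) \<partial>M) = (\<integral>\<^sup>+x. f x \<partial>M)" by (rule nn_integral_cong_AE[OF AEe])
  then have int: "integrable M (\<lambda>x. enn2real (f x))"
    using f(1) fin by (intro integrableI_nonneg) auto
  have "measure N A = (LINT t:A|M. enn2real (f t))" if A: "A \<in> sets M" for A
  proof -
    have "ennreal (LINT t:A|M. enn2real (f t)) = (\<integral>\<^sup>+x. ennreal (indicator A x *\<^sub>R enn2real (f x)) \<partial>M)"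
      unfolding set_lebesgue_integral_def using int A
      by (intro nn_integral_eq_integral[symmetric] integrable_mult_indicator) auto
    also have "\<dots> = (\<integral>\<^sup>+x\<in>A. f x \<partial>M)"
      by (rule nn_integral_cong_AE) (use AEe in \<open>eventually_elim, auto split: split_indicator\<close>)
    also have "\<dots> = ennreal (measure N A)" using e[OF A] by (simp add: N.emeasure_eq_measure)
    finally show ?thesis
      by (subst (asm) ennreal_inj) (auto simp: set_lebesgue_integral_def intro!: integral_nonneg_AE)
  qed
  then show ?thesis using int by blast
qed

context fin_coords begin

text \<open>A coordinate of \<nu> is a signed measure. Adding \<open>K\<close> times the variation
  makes it a positive one, \<rho>, and the density of the coordinate is the difference of two scalar
  densities. The variation vanishes on null sets because their Borel subsets are null as
  well.\<close>

lemma vm_RN: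
  fixes \<nu> :: "real set \<Rightarrow> 'a"
  assumes \<nu>: "cadd \<nu>" and M: "finite_measure M" "sets M = sets borel"
    and ac: "\<And>A. A \<in> null_sets M \<Longrightarrow> \<nu> A = 0"
  shows "\<exists>h. integrable M h \<and> (\<forall>A\<in>sets borel. \<nu> A = (LINT t:A|M. h t))"
proof -
  let ?V = "vm_variation \<nu>"
  interpret V: finite_measure ?V by (rule finite_vm_variation[OF \<nu>])
  have Vac: "emeasure ?V A = 0" if A: "A \<in> null_sets M" for A
  proof -
    have "\<nu> D = 0" if "D \<in> sets borel" "D \<subseteq> A" for D
      using that A M(2) null_sets_subset[of A M D] by (intro ac) auto
    then have "vvar \<nu> A = 0" by (rule vvar_zero)
    moreover have "A \<in> sets borel" using A M(2) by auto
    ultimately show ?thesis using emeasure_vm_variation[OF \<nu>] by simp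
  qed
  obtain K where K: "K > 0" "\<And>b x. b \<in> B \<Longrightarrow> \<bar>c b x\<bar> \<le> K * norm x" using coord_bound by blast
  obtain g0 where g0: "integrable M g0" "\<And>A. A \<in> sets M \<Longrightarrow> measure ?V A = (LINT t:A|M. g0 t :: real)"
    using real_RN_finite[OF M(1) V.finite_measure_axioms] Vac M(2) by auto
  have ex: "\<exists>g. integrable M g \<and> (\<forall>A\<in>sets M. c b (\<nu> A) = (LINT t:A|M. g t :: real))" if b: "b \<in> B" for b
  proof -
    interpret cb: bounded_linear "c b" using c_bl[OF b] .
    define \<rho> where "\<rho> A = K * measure ?V A + c b (\<nu> A)" for A
    have \<rho>nn: "\<rho> A \<ge> 0" if A: "A \<in> sets borel" for A
    proof -
      have "\<bar>c b (\<nu> A)\<bar> \<le> K * norm (\<nu> A)" by (rule K(2)[OF b])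
      also have "\<dots> \<le> K * measure ?V A" using norm_le_measure_variation[OF \<nu> A] K(1) by simp
      finally show ?thesis unfolding \<rho>_def by auto
    qed
    have \<rho>: "cadd \<rho>" unfolding \<rho>_def
      by (intro cadd_add cadd_linear[OF cadd_measure] cadd_linear[OF \<nu>] V.finite_measure_axioms cb.bounded_linear_axioms bounded_linear_mult_right) simp
    define N where "N = measure_of UNIV (sets borel) (\<lambda>A. ennreal (\<rho> A))"
    have setsN: "sets N = sets borel" unfolding N_def by (metis sets.sets_measure_of_eq space_borel)
    have spN: "space N = UNIV" unfolding N_def by simp
    have eN: "emeasure N A = ennreal (\<rho> A)" if A: "A \<in> sets borel" for A
    proof -
      have "countably_additive (sets borel) (\<lambda>A. ennreal (\<rho> A))"
        unfolding countably_additive_def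
      proof (intro allI impI)
        fix A :: "nat \<Rightarrow> real set" assume A: "range A \<subseteq> sets borel" "disjoint_family A"
        then have s: "(\<lambda>n. \<rho> (A n)) sums \<rho> (\<Union>n. A n)" by (intro cadd_sums[OF \<rho>]) auto
        have "(\<Sum>n. ennreal (\<rho> (A n))) = ennreal (\<Sum>n. \<rho> (A n))"
          using A \<rho>nn by (intro suminf_ennreal2 sums_summable[OF s]) auto
        then show "(\<Sum>n. ennreal (\<rho> (A n))) = ennreal (\<rho> (\<Union>n. A n))" using sums_unique[OF s] by simp
      qed
      moreover have "positive (sets borel) (\<lambda>A. ennreal (\<rho> A))" by (simp add: positive_def cadd_empty[OF \<rho>])
      moreover have "sigma_algebra UNIV (sets (borel::real measure))" using sets.sigma_algebra_axioms[of borel] by simp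
      ultimately show ?thesis unfolding N_def using A by (intro emeasure_measure_of_sigma)
    qed
    have finN: "finite_measure N" by (intro finite_measureI) (simp add: spN eN)
    have "emeasure N A = 0" if A: "A \<in> null_sets M" for A
    proof -
      have "measure ?V A = 0" using Vac[OF A] by (simp add: measure_def)
      then show ?thesis using A ac[OF A] M(2) by (subst eN) (auto simp: \<rho>_def cb.zero null_sets_def)
    qed
    then obtain g where g: "integrable M g" "\<And>A. A \<in> sets M \<Longrightarrow> measure N A = (LINT t:A|M. g t :: real)"
      using real_RN_finite[OF M(1) finN] setsN M(2) by auto
    show ?thesis
    proof (intro exI[of _ "\<lambda>t. g t - K * g0 t"] conjI ballI)
      show "integrable M (\<lambda>t. g t - K * g0 t)" using g g0 by auto
      fix A assume A: "A \<in> sets M"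
      have i: "set_integrable M A g" "set_integrable M A g0"
        unfolding set_integrable_def using g g0 A by (auto intro!: integrable_mult_indicator simp del: real_scaleR_def)
      have "c b (\<nu> A) = measure N A - K * measure ?V A"
        using eN[of A] \<rho>nn[of A] A M(2) by (simp add: measure_def \<rho>_def)
      also have "\<dots> = (LINT t:A|M. g t) - K * (LINT t:A|M. g0 t)" using g(2)[OF A] g0(2)[OF A] by simp
      also have "\<dots> = (LINT t:A|M. g t - K * g0 t)"
        using i by (subst set_integral_diff) auto
      finally show "c b (\<nu> A) = (LINT t:A|M. g t - K * g0 t)" .
    qed
  qed
  then obtain g where g: "\<And>b. b \<in> B \<Longrightarrow> integrable M (g b)"
    "\<And>b A. b \<in> B \<Longrightarrow> A \<in> sets M \<Longrightarrow> c b (\<nu> A) = (LINT t:A|M. g b t :: real)" by metis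
  show ?thesis
  proof (intro exI[of _ "\<lambda>t. \<Sum>b\<in>B. g b t *\<^sub>R b"] conjI ballI)
    show "integrable M (\<lambda>t. \<Sum>b\<in>B. g b t *\<^sub>R b)" using g(1) by auto
    fix A :: "real set" assume "A \<in> sets borel"
    then have A: "A \<in> sets M" using M by simp
    have i: "integrable M (\<lambda>t. indicator A t *\<^sub>R g b t)" if "b \<in> B" for b
      using g(1)[OF that] A by (rule integrable_mult_indicator[rotated])
    have "(LINT t:A|M. (\<Sum>b\<in>B. g b t *\<^sub>R b)) = (LINT t|M. (\<Sum>b\<in>B. (indicator A t *\<^sub>R g b t) *\<^sub>R b))"
      unfolding set_lebesgue_integral_def by (simp add: scaleR_sum_right)
    also have "\<dots> = (\<Sum>b\<in>B. (LINT t:A|M. g b t) *\<^sub>R b)"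
      unfolding set_lebesgue_integral_def using i by (subst Bochner_Integration.integral_sum) (auto simp del: real_scaleR_def intro!: sum.cong)
    also have "\<dots> = (\<Sum>b\<in>B. c b (\<nu> A) *\<^sub>R b)" using g(2)[OF _ A] by simp
    also have "\<dots> = \<nu> A" by (rule c_sum)
    finally show "\<nu> A = (LINT t:A|M. (\<Sum>b\<in>B. g b t *\<^sub>R b))" by simp
  qed
qed

lemma vm_density_props:
  fixes \<nu> :: "real set \<Rightarrow> 'a"
  assumes \<nu>: "cadd \<nu>" and M: "finite_measure M" "sets M = sets borel"
    and ac: "\<And>A. A \<in> null_sets M \<Longrightarrow> \<nu> A = 0"
  shows "integrable M (vm_density \<nu> M)" "A \<in> sets borel \<Longrightarrow> \<nu> A = (LINT t:A|M. vm_density \<nu> M t)"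
  using someI_ex[OF vm_RN[OF assms]] unfolding vm_density_def by blast+

lemma vm_density_variation:
  fixes \<nu> :: "real set \<Rightarrow> 'a"
  assumes \<nu>: "cadd \<nu>"
  shows "integrable (vm_variation \<nu>) (vm_density \<nu> (vm_variation \<nu>))"
    "A \<in> sets borel \<Longrightarrow> \<nu> A = (LINT t:A|vm_variation \<nu>. vm_density \<nu> (vm_variation \<nu>) t)"
proof -
  have ac: "\<nu> A = 0" if "A \<in> null_sets (vm_variation \<nu>)" for A
    using norm_le_measure_variation[OF \<nu>, of A] that by (auto simp: null_sets_def measure_def)
  note props = vm_density_props[OF \<nu> finite_vm_variation[OF \<nu>] sets_vm_variation ac]
  show "integrable (vm_variation \<nu>) (vm_density \<nu> (vm_variation \<nu>))" by (rule props(1))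
  show "\<nu> A = (LINT t:A|vm_variation \<nu>. vm_density \<nu> (vm_variation \<nu>) t)" if "A \<in> sets borel"
    by (rule props(2)) (use that in auto)
qed

end

section \<open>Stieltjes measures\<close>

abbreviation rlim :: "(real \<Rightarrow> 'a::t2_space) \<Rightarrow> real \<Rightarrow> 'a" where
  "rlim f t \<equiv> Lim (at_right t) f"

abbreviation llim :: "(real \<Rightarrow> 'a::t2_space) \<Rightarrow> real \<Rightarrow> 'a" where
  "llim f t \<equiv> Lim (at_left t) f"

text \<open>One-sided limits are evaluated along this strictly decreasing null sequence, so that
  continuity of measures and comparison of sequences apply.\<close>

definition step :: "nat \<Rightarrow> real" where "step n = inverse (real (Suc n))"

lemma step_pos: "step n > 0" and step_Suc: "step (Suc n) < step n"
  by (auto simp: step_def field_simps)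

lemma step_tendsto: "step \<longlonglongrightarrow> 0"
  unfolding step_def by (rule LIMSEQ_inverse_real_of_nat)

lemma filterlim_step_right: "filterlim (\<lambda>n. t + step n) (at_right t) sequentially"
proof -
  have "(\<lambda>n. t + step n) \<longlonglongrightarrow> t + 0" by (intro tendsto_intros step_tendsto)
  moreover have "step n \<noteq> 0" for n using step_pos[of n] by simp
  ultimately show ?thesis by (auto simp: filterlim_at step_pos)
qed

lemma filterlim_step_left: "filterlim (\<lambda>n. t - step n) (at_left t) sequentially"
proof -
  have "(\<lambda>n. t - step n) \<longlonglongrightarrow> t - 0" by (intro tendsto_intros step_tendsto)
  moreover have "step n \<noteq> 0" for n using step_pos[of n] by simp
  ultimately show ?thesis by (auto simp: filterlim_at step_pos)
qed

lemma mono_rlim: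
  fixes G :: "real \<Rightarrow> real"
  assumes "mono G" shows "(G \<longlongrightarrow> rlim G t) (at_right t)"
proof -
  have "(G \<longlongrightarrow> Inf (G ` ({t<..} \<inter> UNIV))) (at t within ({t<..} \<inter> UNIV))"
    by (rule Lim_right_bound[where K="G t"]) (use assms in \<open>auto simp: mono_def\<close>)
  then show ?thesis using tendsto_Lim[of "at_right t" G] by simp
qed

lemma mono_llim:
  fixes G :: "real \<Rightarrow> real"
  assumes "mono G" shows "(G \<longlongrightarrow> llim G t) (at_left t)"
proof -
  have "(G \<longlongrightarrow> Sup (G ` ({..<t} \<inter> UNIV))) (at t within ({..<t} \<inter> UNIV))"
    by (rule Lim_left_bound[where K="G t"]) (use assms in \<open>auto simp: mono_def\<close>)
  then show ?thesis using tendsto_Lim[of "at_left t" G] by simp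
qed

text \<open>Bounded variation through a bounded monotone majorant of the increments. The majorant
  may exceed the variation function, which later makes room for a time term.\<close>

locale bvf =
  fixes u :: "real \<Rightarrow> 'a::banach" and W :: "real \<Rightarrow> real" and M :: real
  assumes dom: "a \<le> b \<Longrightarrow> norm (u b - u a) \<le> W b - W a"
    and bdW: "\<bar>W t\<bar> \<le> M"
begin

lemma mono_W: "mono W"
  unfolding mono_def using dom by (smt (verit) norm_ge_zero)

lemma cauchy_imp_limit:
  assumes F: "F \<noteq> bot" and e: "\<And>e. e > 0 \<Longrightarrow> \<exists>P. eventually P F \<and> (\<forall>x y. P x \<and> P y \<longrightarrow> norm (u x - u y) < e)"
  shows "(u \<longlongrightarrow> Lim F u) F"
proof -
  have "cauchy_filter (filtermap u F)"
    unfolding cauchy_filter_metric_filtermap using e by (simp add: dist_norm)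
  moreover have "filtermap u F \<noteq> bot" using F by (simp add: filtermap_bot_iff)
  ultimately obtain x where "filtermap u F \<le> nhds x"
    using complete_UNIV[where 'a='a] unfolding complete_uniform by force
  then have "(u \<longlongrightarrow> x) F" by (simp add: filterlim_def)
  then show ?thesis using tendsto_Lim[OF F] by metis
qed

lemma close_of_W_close: "norm (u x - u y) \<le> \<bar>W x - W y\<bar>"
  using dom[of x y] dom[of y x] by (cases "x \<le> y") (auto simp: norm_minus_commute)

text \<open>Convergence of \<open>W\<close> makes \<open>u\<close> Cauchy along the filter, and the
  space is complete.\<close>

lemma u_limit:
  assumes F: "F \<noteq> bot" and W: "(W \<longlongrightarrow> L) F" shows "(u \<longlongrightarrow> Lim F u) F"
proof (rule cauchy_imp_limit[OF F])
  fix e :: real assume "e > 0"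
  then have "\<forall>\<^sub>F x in F. dist (W x) L < e/2" using W tendstoD by (metis half_gt_zero)
  moreover have "norm (u x - u y) < e" if "dist (W x) L < e/2" "dist (W y) L < e/2" for x y
    using close_of_W_close[of x y] that unfolding dist_real_def by argo
  ultimately show "\<exists>P. eventually P F \<and> (\<forall>x y. P x \<and> P y \<longrightarrow> norm (u x - u y) < e)" by blast
qed

lemma u_rlim: "(u \<longlongrightarrow> rlim u t) (at_right t)"
  by (rule u_limit[OF _ mono_rlim[OF mono_W]]) simp

lemma u_llim: "(u \<longlongrightarrow> llim u t) (at_left t)"
  by (rule u_limit[OF _ mono_llim[OF mono_W]]) simp

lemma u_rlim_seq: "(\<lambda>n. u (t + step n)) \<longlonglongrightarrow> rlim u t"
  using filterlim_compose[OF u_rlim filterlim_step_right] .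

lemma u_llim_seq: "(\<lambda>n. u (t - step n)) \<longlonglongrightarrow> llim u t"
  using filterlim_compose[OF u_llim filterlim_step_left] .

lemma W_rlim_seq: "(\<lambda>n. W (t + step n)) \<longlonglongrightarrow> rlim W t"
  using filterlim_compose[OF mono_rlim[OF mono_W] filterlim_step_right] .

lemma W_llim_seq: "(\<lambda>n. W (t - step n)) \<longlonglongrightarrow> llim W t"
  using filterlim_compose[OF mono_llim[OF mono_W] filterlim_step_left] .

lemma dom_jump: "norm (rlim u t - llim u t) \<le> rlim W t - llim W t"
  by (rule LIMSEQ_le[OF tendsto_norm[OF tendsto_diff[OF u_rlim_seq u_llim_seq]]
        tendsto_diff[OF W_rlim_seq W_llim_seq]])
     (auto intro!: dom exI[of _ 0] simp: add_increasing less_imp_le step_pos intro: order_trans[of _ t])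

end

lemma mono_rlim_mono:
  fixes G :: "real \<Rightarrow> real"
  assumes "mono G" shows "mono (rlim G)" "G t \<le> rlim G t" "s < t \<Longrightarrow> rlim G s \<le> G t"
    "llim G t \<le> G t" "s < t \<Longrightarrow> G s \<le> llim G t"
proof -
  have seq: "(\<lambda>n. G (t + step n)) \<longlonglongrightarrow> rlim G t" for t
    using filterlim_compose[OF mono_rlim[OF assms] filterlim_step_right] .
  show "mono (rlim G)"
    by (intro monoI LIMSEQ_le[OF seq seq] exI[of _ 0] allI impI monoD[OF assms]) simp
  show "G t \<le> rlim G t"
    by (rule LIMSEQ_le_const[OF seq]) (auto intro!: monoD[OF assms] simp: step_pos less_imp_le)
  show "rlim G s \<le> G t" if "s < t"
  proof (rule tendsto_upperbound[OF mono_rlim[OF assms]])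
    show "\<forall>\<^sub>F x in at_right s. G x \<le> G t"
      using that by (auto simp: eventually_at_right intro!: exI[of _ t] monoD[OF assms])
  qed simp
  show "llim G t \<le> G t"
  proof (rule tendsto_upperbound[OF mono_llim[OF assms]])
    show "\<forall>\<^sub>F x in at_left t. G x \<le> G t"
      unfolding eventually_at_filter by (auto intro!: always_eventually monoD[OF assms])
  qed simp
  show "G s \<le> llim G t" if "s < t"
  proof (rule tendsto_lowerbound[OF mono_llim[OF assms]])
    show "\<forall>\<^sub>F x in at_left t. G s \<le> G x"
      using that by (auto simp: eventually_at_left intro!: exI[of _ s] monoD[OF assms])
  qed simp
qed

lemma rlim_right_continuous:
  fixes G :: "real \<Rightarrow> real"
  assumes "mono G" shows "continuous (at_right t) (rlim G)"
  unfolding continuous_within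
proof (rule order_tendstoI)
  note G = mono_rlim_mono[OF assms]
  fix a assume "a < rlim G t"
  then show "\<forall>\<^sub>F x in at_right t. a < rlim G x"
    using monoD[OF G(1), of t] unfolding eventually_at_filter
    by (auto intro!: always_eventually intro: less_le_trans)
next
  note G = mono_rlim_mono[OF assms]
  fix a assume "rlim G t < a"
  then have "\<forall>\<^sub>F x in at_right t. G x < a" using order_tendstoD(2)[OF mono_rlim[OF assms]] by blast
  then obtain s where s: "s > t" "\<And>x. t < x \<Longrightarrow> x < s \<Longrightarrow> G x < a" by (auto simp: eventually_at_right_field)
  have "rlim G x < a" if "t < x" "x < s" for x
    using G(3)[of x "(x + s)/2"] s(2)[of "(x + s)/2"] that by auto
  then show "\<forall>\<^sub>F x in at_right t. rlim G x < a" using s(1) by (auto simp: eventually_at_right_field)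
qed

text \<open>\<open>interval_measure\<close> works with right-continuous functions, hence the passage
  to right limits; the value of \<open>G\<close> at a jump does not enter the measure.\<close>

definition smeas :: "(real \<Rightarrow> real) \<Rightarrow> real measure" where
  "smeas G = interval_measure (rlim G)"

lemma sets_smeas [simp, measurable_cong]: "sets (smeas G) = sets borel"
  by (simp add: smeas_def)

lemma space_smeas [simp]: "space (smeas G) = UNIV"
  by (simp add: smeas_def)

lemma smeas:
  fixes G :: "real \<Rightarrow> real"
  assumes G: "mono G" and bd: "\<And>t. \<bar>G t\<bar> \<le> M"
  shows "a \<le> b \<Longrightarrow> measure (smeas G) {a<..b} = rlim G b - rlim G a" "finite_measure (smeas G)"
    "measure (smeas G) {t} = rlim G t - llim G t"
proof -
  note R = mono_rlim_mono[OF G]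
  show Ioc: "measure (smeas G) {a<..b} = rlim G b - rlim G a" if "a \<le> b" for a b
    unfolding smeas_def
    by (rule measure_interval_measure_Ioc[OF that _ rlim_right_continuous[OF G]]) (rule monoD[OF R(1)])
  have eIoc: "emeasure (smeas G) {a<..b} = ennreal (rlim G b - rlim G a)" if "a \<le> b" for a b
    unfolding smeas_def
    by (rule emeasure_interval_measure_Ioc[OF that _ rlim_right_continuous[OF G]]) (rule monoD[OF R(1)])
  have bd': "\<bar>rlim G t\<bar> \<le> M" for t
    using R(2)[of t] R(3)[of t "t + 1"] bd[of t] bd[of "t + 1"] by auto
  have "emeasure (smeas G) UNIV = emeasure (smeas G) (\<Union>n::nat. {- real n<..real n})"
  proof -
    have "\<exists>n. x \<in> {- real n<..real n}" for x :: real
    proof -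
      obtain n :: nat where "\<bar>x\<bar> < real n" using reals_Archimedean2 by blast
      then show ?thesis by (intro exI[of _ n]) auto
    qed
    then have "(\<Union>n::nat. {- real n<..real n}) = UNIV" by blast
    then show ?thesis by simp
  qed
  also have "\<dots> = (SUP n::nat. emeasure (smeas G) {- real n<..real n})"
    by (rule SUP_emeasure_incseq[symmetric]) (auto simp: incseq_def)
  also have "\<dots> \<le> ennreal (2 * M)"
    using bd' by (intro SUP_least) (simp add: eIoc, rule ennreal_leI, smt (verit))
  finally show fin: "finite_measure (smeas G)"
    by (intro finite_measureI) (auto simp: top_unique)
  interpret finite_measure "smeas G" by fact
  have "(\<lambda>n. measure (smeas G) {t - step n<..t}) \<longlonglongrightarrow> measure (smeas G) (\<Inter>n. {t - step n<..t})"
  proof (rule finite_Lim_measure_decseq)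
    have "decseq step" by (intro decseq_SucI less_imp_le step_Suc)
    then show "decseq (\<lambda>n. {t - step n<..t})" unfolding decseq_def by (smt (verit) greaterThanAtMost_iff subsetI)
  qed auto
  moreover have "(\<Inter>n. {t - step n<..t}) = {t}"
  proof (intro equalityI subsetI)
    fix x assume x: "x \<in> (\<Inter>n. {t - step n<..t})"
    have "t - 0 \<le> x" by (rule LIMSEQ_le_const2[OF tendsto_diff[OF tendsto_const step_tendsto]])
      (use x in \<open>auto intro: less_imp_le\<close>)
    then show "x \<in> {t}" using x by auto
  qed (auto simp: step_pos)
  moreover have "(\<lambda>n. measure (smeas G) {t - step n<..t}) \<longlonglongrightarrow> rlim G t - llim G t"
  proof -
    have 1: "(\<lambda>n. G (t - step n)) \<longlonglongrightarrow> llim G t"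
      using filterlim_compose[OF mono_llim[OF G] filterlim_step_left] .
    \<comment> \<open>By monotonicity the right limit at \<open>t - step n\<close> lies between the
      values of \<open>G\<close> at \<open>t - step n\<close> and at the next point
      \<open>t - step (Suc n)\<close>.\<close>
    have "(\<lambda>n. rlim G (t - step n)) \<longlonglongrightarrow> llim G t"
    proof (rule tendsto_sandwich[OF _ _ 1])
      show "(\<lambda>n. G (t - step (Suc n))) \<longlonglongrightarrow> llim G t" using 1 by (rule LIMSEQ_Suc)
    qed (auto intro!: R(2) R(3) always_eventually simp: step_Suc)
    then have "(\<lambda>n. rlim G t - rlim G (t - step n)) \<longlonglongrightarrow> rlim G t - llim G t" by (intro tendsto_intros)
    then show ?thesis by (subst Ioc) (auto simp: step_pos less_imp_le)
  qed
  ultimately show "measure (smeas G) {t} = rlim G t - llim G t" using LIMSEQ_unique by metis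
qed

locale bvf_coords = bvf u W M + fin_coords B c
  for u :: "real \<Rightarrow> 'a::{banach,second_countable_topology}" and W M and B :: "'a set" and c
begin

lemma finite_smeas_W: "finite_measure (smeas W)"
  and smeas_W_Ioc: "a \<le> b \<Longrightarrow> measure (smeas W) {a<..b} = rlim W b - rlim W a"
  and smeas_W_point: "measure (smeas W) {t} = rlim W t - llim W t"
  using smeas[OF mono_W bdW] by blast+

text \<open>Each coordinate plus \<open>K * W\<close> is monotone and so has a Stieltjes measure;
  subtracting \<open>K\<close> times the measure of \<open>W\<close> and recombining the coordinates
  gives the vector measure.\<close>

lemma stieltjes_ex:
  "\<exists>\<nu>. cadd \<nu> \<and> (\<forall>a b. a \<le> b \<longrightarrow> \<nu> {a<..b} = rlim u b - rlim u a) \<and> (\<forall>t. \<nu> {t} = rlim u t - llim u t)"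
proof -
  obtain K where K: "K > 0" "\<And>b x. b \<in> B \<Longrightarrow> \<bar>c b x\<bar> \<le> K * norm x" using coord_bound by blast
  define g where "g b t = K * W t + c b (u t)" for b t
  have g: "mono (g b)" "\<exists>M'. \<forall>t. \<bar>g b t\<bar> \<le> M'" "rlim (g b) t = K * rlim W t + c b (rlim u t)"
    "llim (g b) t = K * llim W t + c b (llim u t)" if b: "b \<in> B" for b t
  proof -
    interpret cb: bounded_linear "c b" using c_bl[OF b] .
    have le: "\<bar>c b (u y - u x)\<bar> \<le> K * (W y - W x)" if "x \<le> y" for x y
      by (rule order_trans[OF K(2)[OF b]]) (use K(1) dom[OF that] in simp)
    show "mono (g b)" unfolding g_def
      by (rule monoI) (use le in \<open>force simp: cb.diff algebra_simps abs_le_iff\<close>)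
    have "\<bar>g b t\<bar> \<le> K * M + (\<bar>c b (u 0)\<bar> + K * (2 * M))" for t
    proof -
      have "\<bar>c b (u t - u 0)\<bar> \<le> K * \<bar>W t - W 0\<bar>"
        by (rule order_trans[OF K(2)[OF b]]) (use K(1) close_of_W_close in simp)
      also have "\<dots> \<le> K * (2 * M)" using K(1) bdW[of t] bdW[of 0] by (intro mult_left_mono) auto
      finally have 1: "\<bar>c b (u t) - c b (u 0)\<bar> \<le> K * (2 * M)" by (simp add: cb.diff)
      have "\<bar>K * W t\<bar> \<le> K * M" using K(1) bdW[of t] by (simp add: abs_mult)
      then show ?thesis unfolding g_def using 1 by linarith
    qed
    then show "\<exists>M'. \<forall>t. \<bar>g b t\<bar> \<le> M'" by blast
    show "rlim (g b) t = K * rlim W t + c b (rlim u t)"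
      unfolding g_def by (intro tendsto_Lim tendsto_intros cb.tendsto u_rlim mono_rlim[OF mono_W]) simp
    show "llim (g b) t = K * llim W t + c b (llim u t)"
      unfolding g_def by (intro tendsto_Lim tendsto_intros cb.tendsto u_llim mono_llim[OF mono_W]) simp
  qed
  define \<nu> where "\<nu> A = (\<Sum>b\<in>B. (measure (smeas (g b)) A - K * measure (smeas W) A) *\<^sub>R b)" for A
  have "cadd \<nu>" unfolding \<nu>_def
  proof (intro cadd_sum cadd_linear[OF _ bounded_linear_scaleR_left] cadd_diff)
    fix b assume b: "b \<in> B"
    obtain M' where M': "\<And>t. \<bar>g b t\<bar> \<le> M'" using g(2)[OF b] by blast
    show "cadd (measure (smeas (g b)))" by (rule cadd_measure[OF smeas(2)[OF g(1)[OF b] M']]) simp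
    show "cadd (\<lambda>A. K * measure (smeas W) A)"
      by (intro cadd_linear[OF cadd_measure[OF finite_smeas_W] bounded_linear_mult_right]) simp
  qed
  moreover have "\<nu> {s<..t} = rlim u t - rlim u s" if st: "s \<le> t" for s t
  proof -
    have "\<nu> {s<..t} = (\<Sum>b\<in>B. c b (rlim u t - rlim u s) *\<^sub>R b)"
      unfolding \<nu>_def
    proof (rule sum.cong[OF refl])
      fix b assume b: "b \<in> B"
      interpret cb: bounded_linear "c b" using c_bl[OF b] .
      obtain M' where M': "\<And>t. \<bar>g b t\<bar> \<le> M'" using g(2)[OF b] by blast
      have "measure (smeas (g b)) {s<..t} - K * measure (smeas W) {s<..t} = c b (rlim u t - rlim u s)"
        unfolding smeas(1)[OF g(1)[OF b] M' st] smeas_W_Ioc[OF st] g(3)[OF b] cb.diff by (simp add: algebra_simps)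
      then show "(measure (smeas (g b)) {s<..t} - K * measure (smeas W) {s<..t}) *\<^sub>R b = c b (rlim u t - rlim u s) *\<^sub>R b"
        by simp
    qed
    then show ?thesis by (simp add: c_sum)
  qed
  moreover have "\<nu> {t} = rlim u t - llim u t" for t
  proof -
    have "\<nu> {t} = (\<Sum>b\<in>B. c b (rlim u t - llim u t) *\<^sub>R b)"
      unfolding \<nu>_def
    proof (rule sum.cong[OF refl])
      fix b assume b: "b \<in> B"
      interpret cb: bounded_linear "c b" using c_bl[OF b] .
      obtain M' where M': "\<And>t. \<bar>g b t\<bar> \<le> M'" using g(2)[OF b] by blast
      have "measure (smeas (g b)) {t} - K * measure (smeas W) {t} = c b (rlim u t - llim u t)"
        unfolding smeas(3)[OF g(1)[OF b] M', of t] smeas_W_point[of t] g(3,4)[OF b] cb.diff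
        by (simp add: algebra_simps)
      then show "(measure (smeas (g b)) {t} - K * measure (smeas W) {t}) *\<^sub>R b = c b (rlim u t - llim u t) *\<^sub>R b"
        by simp
    qed
    then show ?thesis by (simp add: c_sum)
  qed
  ultimately show ?thesis by blast
qed

end

text \<open>\<open>V t\<close> is the variation on the part of the interval up to \<open>t\<close>,
  a supremum over chains.\<close>

lemma variation_dominating:
  fixes u :: "real \<Rightarrow> 'a::real_normed_vector"
  assumes bv: "\<exists>M. \<forall>(n::nat) s. (\<forall>i\<le>n. s i \<in> {p..T}) \<and> (\<forall>i<n. s i \<le> s (Suc i)) \<longrightarrow>
     (\<Sum>i<n. norm (u (s (Suc i)) - u (s i))) \<le> M"
    and T: "T \<ge> p"
  shows "\<exists>V M. (\<forall>a b. p \<le> a \<and> a \<le> b \<and> b \<le> T \<longrightarrow> norm (u b - u a) \<le> V b - V a) \<and> (\<forall>t\<in>{p..T}. 0 \<le> V t \<and> V t \<le> (M::real))"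
proof -
  define chain where "chain n s t \<longleftrightarrow> (\<forall>i\<le>n. s i \<in> {p..t::real}) \<and> (\<forall>i<n. s i \<le> s (Suc i))" for n :: nat and s t
  define vs where "vs n s = (\<Sum>i<n. norm (u (s (Suc i)) - u (s i)))" for n :: nat and s :: "nat \<Rightarrow> real"
  obtain M where M: "\<And>n s. chain n s T \<Longrightarrow> vs n s \<le> M"
    using bv unfolding chain_def vs_def by blast
  define V where "V t = Sup {vs n s | n s. chain n s t}" for t
  have ch: "chain n s T" if "chain n s t" "t \<le> T" for n s t using that unfolding chain_def by fastforce
  have bdd: "bdd_above {vs n s | n s. chain n s t}" if "t \<le> T" for t
    using M ch that by (intro bdd_aboveI[of _ M]) blast
  have mem: "0 \<in> {vs n s | n s. chain n s t}" if "p \<le> t" for t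
  proof -
    have "chain 0 (\<lambda>_. p) t" "vs 0 (\<lambda>_. p) = 0" using that by (auto simp: chain_def vs_def)
    then show ?thesis by (metis (mono_tags, lifting) mem_Collect_eq)
  qed
  have "norm (u b - u a) \<le> V b - V a" if ab: "p \<le> a" "a \<le> b" "b \<le> T" for a b
  proof -
    have "V a \<le> V b - norm (u b - u a)"
      unfolding V_def[of a]
    proof (rule cSup_least)
      show "{vs n s | n s. chain n s a} \<noteq> {}" using mem[of a] ab by blast
      fix x assume "x \<in> {vs n s | n s. chain n s a}"
      then obtain n s where ns: "x = vs n s" "chain n s a" by blast
      \<comment> \<open>A chain up to \<open>a\<close> is prolonged by \<open>a\<close> and then
        \<open>b\<close>; the step into \<open>a\<close> can only increase the sum, the last step
        contributes the increment to be dominated.\<close>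
      define s' where "s' i = (if i \<le> n then s i else if i = Suc n then a else b)" for i
      have "chain (Suc (Suc n)) s' b"
        using ns(2) ab unfolding chain_def s'_def by (auto simp: less_Suc_eq le_Suc_eq)
      then have "vs (Suc (Suc n)) s' \<le> V b" unfolding V_def using bdd[OF ab(3)] by (intro cSup_upper) auto
      moreover have "vs n s \<le> vs (Suc n) s'"
        unfolding vs_def by (auto simp: s'_def intro!: order_trans[OF eq_refl add_increasing2] sum.cong)
      moreover have "vs (Suc (Suc n)) s' = vs (Suc n) s' + norm (u b - u a)"
        unfolding vs_def by (simp add: s'_def)
      ultimately show "x \<le> V b - norm (u b - u a)" using ns by simp
    qed
    then show ?thesis by simp
  qed
  moreover have "0 \<le> V t \<and> V t \<le> M" if t: "t \<in> {p..T}" for t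
  proof
    show "0 \<le> V t" unfolding V_def using mem[of t] bdd[of t] t by (intro cSup_upper) auto
    show "V t \<le> M" unfolding V_def
    proof (rule cSup_least)
      show "{vs n s | n s. chain n s t} \<noteq> {}" using mem[of t] t by auto
    qed (use M ch t in auto)
  qed
  ultimately show ?thesis by blast
qed

lemma BV_dominating:
  assumes bv: "BV T u" and T: "T \<ge> 0"
  shows "\<exists>V M. (\<forall>a b. 0 \<le> a \<and> a \<le> b \<and> b \<le> T \<longrightarrow> norm (u b - u a) \<le> V b - V a) \<and> (\<forall>t\<in>{0..T}. 0 \<le> V t \<and> V t \<le> (M::real))"
  using variation_dominating[OF _ T, of u] bv unfolding BV_def by blast

section \<open>Smooth approximation of indicators\<close>

text \<open>Powers of \<open>1/((x-a)(b-x))\<close> are included because differentiating the exponential produces them; the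
  family is closed under differentiation.\<close>

definition bump :: "real \<Rightarrow> real \<Rightarrow> real \<Rightarrow> real poly \<Rightarrow> nat \<Rightarrow> real \<Rightarrow> real" where
  "bump a b k P n x = (if a < x \<and> x < b
     then poly P x * (1 / ((x - a) * (b - x))) ^ n * exp (- k / ((x - a) * (b - x))) else 0)"

text \<open>The inequality y \<le> exp y at y = k z / m, raised to the power
  \<open>m\<close>.\<close>

lemma power_exp_bound:
  fixes z k :: real
  assumes "z \<ge> 0" "k > 0" "m > 0"
  shows "z ^ m * exp (- (k * z)) \<le> (real m / k) ^ m"
proof -
  have "k * z / real m \<le> exp (k * z / real m)" using exp_ge_add_one_self[of "k * z / real m"] by linarith
  then have "(k * z / real m) ^ m \<le> exp (k * z / real m) ^ m" using assms by (intro power_mono) auto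
  also have "\<dots> = exp (k * z)" using assms by (simp flip: exp_of_nat_mult)
  finally have "(k * z / real m) ^ m * exp (- (k * z)) \<le> exp (k * z) * exp (- (k * z))"
    by (intro mult_right_mono) auto
  then have "(k * z / real m) ^ m * exp (- (k * z)) \<le> 1" by (simp flip: exp_add)
  then have "(real m / k) ^ m * ((k * z / real m) ^ m * exp (- (k * z))) \<le> (real m / k) ^ m"
    using assms by (intro mult_left_le) auto
  moreover have "(real m / k) ^ m * (k * z / real m) ^ m = z ^ m"
    using assms by (simp flip: power_mult_distrib)
  ultimately show ?thesis by (simp add: mult.assoc[symmetric])
qed

text \<open>The exponential beats every power at the ends of the interval. Two extra factors are
  kept as the square of (x - a)(b - x), which is at most (b - a) times the distance to any point
  outside. This settles differentiability at the ends and beyond them at once.\<close>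

lemma bump_quadratic:
  assumes k: "k > 0"
  shows "\<exists>K. \<forall>x x0. \<not> (a < x0 \<and> x0 < b) \<longrightarrow> \<bar>bump a b k P n x\<bar> \<le> K * (x - x0)^2"
proof -
  have "bounded (poly P ` {a..b})"
    by (intro compact_imp_bounded compact_continuous_image continuous_intros) auto
  then obtain C where "\<forall>y\<in>poly P ` {a..b}. norm y \<le> C" unfolding bounded_iff by blast
  then have C: "\<And>x. a \<le> x \<Longrightarrow> x \<le> b \<Longrightarrow> \<bar>poly P x\<bar> \<le> C" by simp
  define K where "K = \<bar>C\<bar> * (real (n + 2) / k) ^ (n + 2) * (b - a)^2"
  have K0: "K \<ge> 0" unfolding K_def using k by simp
  have "\<bar>bump a b k P n x\<bar> \<le> K * (x - x0)^2" if x0: "\<not> (a < x0 \<and> x0 < b)" for x x0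
  proof (cases "a < x \<and> x < b")
    case True
    define z where "z = 1 / ((x - a) * (b - x))"
    have z: "z > 0" using True by (simp add: z_def)
    have eq: "bump a b k P n x = poly P x * z ^ n * exp (- (k * z))" using True by (simp add: bump_def z_def)
    have zz: "z ^ n = z ^ (n + 2) * ((x - a) * (b - x))^2"
    proof -
      have "z * ((x - a) * (b - x)) = 1" using True by (simp add: z_def)
      moreover have "z ^ (n + 2) * ((x - a) * (b - x))^2 = z ^ n * (z * ((x - a) * (b - x)))^2"
        by (simp add: power_add power_mult_distrib power2_eq_square)
      ultimately show ?thesis by simp
    qed
    have "\<bar>bump a b k P n x\<bar> = \<bar>poly P x\<bar> * (z ^ (n + 2) * exp (- (k * z))) * ((x - a) * (b - x))^2"
      unfolding eq zz using z by (simp add: abs_mult)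
    also have "\<dots> \<le> \<bar>C\<bar> * (real (n + 2) / k) ^ (n + 2) * ((x - x0)^2 * (b - a)^2)"
    proof (intro mult_mono power_exp_bound)
      show "\<bar>poly P x\<bar> \<le> \<bar>C\<bar>" using C[of x] True by force
      have "((x - a) * (b - x)) ^ 2 \<le> (\<bar>x - x0\<bar> * (b - a)) ^ 2"
      proof (cases "x0 \<le> a")
        case True': True
        show ?thesis using True True' by (intro power_mono mult_mono) auto
      next
        case False
        then have "(b - x) * (x - a) \<le> \<bar>x - x0\<bar> * (b - a)" using True x0 by (intro mult_mono) auto
        then show ?thesis using True by (intro power_mono) (auto simp: mult.commute)
      qed
      then show "((x - a) * (b - x))\<^sup>2 \<le> (x - x0)\<^sup>2 * (b - a)\<^sup>2" by (simp add: power_mult_distrib)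
    qed (use k z in auto)
    finally show ?thesis by (simp add: K_def mult_ac)
  qed (use K0 in \<open>auto simp: bump_def\<close>)
  then show ?thesis by blast
qed

lemma bump_has_derivative:
  assumes k: "k > 0"
  shows "\<exists>Q. \<forall>x. (bump a b k P n has_field_derivative bump a b k Q (n + 2) x) (at x)"
proof -
  define D where "D = [:- a, 1:] * [:b, - 1:]"
  have D: "poly D x = (x - a) * (b - x)" "poly (pderiv D) x = a + b - 2 * x" for x
    by (auto simp: D_def pderiv_mult pderiv_pCons algebra_simps)
  \<comment> \<open>The product rule for P D^(-n) exp(-k / D), with D^(-(n+2)) factored out.\<close>
  define Q where "Q = pderiv P * D ^ 2 - smult (real n) (P * pderiv D * D) + smult k (P * pderiv D)"
  have "(bump a b k P n has_field_derivative bump a b k Q (n + 2) x) (at x)" for x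
  proof (cases "a < x \<and> x < b")
    case True
    let ?z = "1 / poly D x" let ?e = "exp (- k / poly D x)"
    have D0: "poly D x > 0" using True by (simp add: D)
    have "((\<lambda>x. poly P x * (1 / poly D x) ^ n * exp (- k / poly D x)) has_field_derivative
        (poly (pderiv P) x * ?z ^ n + poly P x * (real n * ?z ^ (n - 1) * (- poly (pderiv D) x / (poly D x)^2))) * ?e
        + poly P x * ?z ^ n * (?e * (k * poly (pderiv D) x / (poly D x)^2))) (at x)"
      using D0 by (auto intro!: derivative_eq_intros simp: power2_eq_square algebra_simps diff_divide_distrib add_divide_distrib)
    also have "(poly (pderiv P) x * ?z ^ n + poly P x * (real n * ?z ^ (n - 1) * (- poly (pderiv D) x / (poly D x)^2))) * ?e
        + poly P x * ?z ^ n * (?e * (k * poly (pderiv D) x / (poly D x)^2)) = poly Q x * ?z ^ (n + 2) * ?e"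
    proof -
      have 1: "?z ^ n = ?z ^ (n + 2) * (poly D x)^2" using D0 by (simp add: power_add field_simps power2_eq_square)
      have 2: "real n * ?z ^ (n - 1) = real n * ?z ^ (n + 2) * (poly D x)^3"
        using D0 by (cases n) (simp_all add: power_add field_simps power2_eq_square power3_eq_cube)
      have "poly P x * (real n * ?z ^ (n - 1) * (- poly (pderiv D) x / (poly D x)^2)) =
         - (real n * poly P x * poly (pderiv D) x * poly D x * ?z ^ (n + 2))"
        unfolding 2 using D0 by (simp add: power2_eq_square power3_eq_cube field_simps)
      moreover have "poly P x * ?z ^ n * (?e * (k * poly (pderiv D) x / (poly D x)^2)) =
         k * poly P x * poly (pderiv D) x * ?z ^ (n + 2) * ?e"
        unfolding 1 using D0 by simp
      moreover have "poly (pderiv P) x * ?z ^ n = poly (pderiv P) x * (poly D x)^2 * ?z ^ (n + 2)"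
        unfolding 1 by simp
      ultimately show ?thesis unfolding Q_def by (simp add: algebra_simps)
    qed
    finally have "((\<lambda>x. poly P x * (1 / poly D x) ^ n * exp (- k / poly D x)) has_field_derivative bump a b k Q (n + 2) x) (at x)"
      using True by (simp add: bump_def D)
    then show ?thesis
      by (rule has_field_derivative_transform_within_open[where S="{a<..<b}"]) (use True in \<open>auto simp: bump_def D\<close>)
  next
    case False
    obtain K where K: "\<And>y. \<bar>bump a b k P n y\<bar> \<le> K * (y - x)^2" using bump_quadratic[OF k] False by blast
    have "(\<lambda>y. (bump a b k P n y - bump a b k P n x) / (y - x)) \<midarrow>x\<rightarrow> 0"
    proof (rule Lim_null_comparison)
      show "\<forall>\<^sub>F y in at x. norm ((bump a b k P n y - bump a b k P n x) / (y - x)) \<le> K * \<bar>y - x\<bar>"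
      proof (rule always_eventually, rule allI)
        fix y
        have "bump a b k P n x = 0" using False by (auto simp: bump_def)
        moreover have "\<bar>bump a b k P n y\<bar> / \<bar>y - x\<bar> \<le> K * \<bar>y - x\<bar>"
        proof (cases "y = x")
          case False
          then show ?thesis using K[of y] by (simp add: divide_le_eq power2_eq_square mult.assoc)
        qed simp
        ultimately show "norm ((bump a b k P n y - bump a b k P n x) / (y - x)) \<le> K * \<bar>y - x\<bar>" by simp
      qed
      have "(\<lambda>y. K * \<bar>y - x\<bar>) \<midarrow>x\<rightarrow> K * \<bar>x - x\<bar>" by (intro tendsto_intros)
      then show "(\<lambda>y. K * \<bar>y - x\<bar>) \<midarrow>x\<rightarrow> 0" by simp
    qed
    then have "(bump a b k P n has_field_derivative 0) (at x)" by (simp add: has_field_derivative_iff)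
    then show ?thesis using False by (auto simp: bump_def)
  qed
  then show ?thesis by blast
qed

lemma bump_smooth:
  assumes k: "k > 0" shows "((deriv ^^ m) (bump a b k P n)) differentiable (at x)"
proof -
  have "\<exists>Q j. (deriv ^^ m) (bump a b k P n) = bump a b k Q j"
  proof (induction m)
    case (Suc m)
    then obtain Q j where "(deriv ^^ m) (bump a b k P n) = bump a b k Q j" by blast
    moreover obtain R where "\<And>x. (bump a b k Q j has_field_derivative bump a b k R (j + 2) x) (at x)"
      using bump_has_derivative[OF k] by blast
    then have "deriv (bump a b k Q j) = bump a b k R (j + 2)" by (intro ext DERIV_imp_deriv)
    ultimately show ?case by auto
  qed auto
  then show ?thesis using bump_has_derivative[OF k] by (metis field_differentiable_def field_differentiable_imp_differentiable)
qed

text \<open>The exponent tends to zero, which sends the bump to 1 at each interior point, and the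
  support is shrunk at the same rate, which keeps it in a compact part of (0,T) even when
  \<open>a\<close> is 0 or \<open>b\<close> is \<open>T\<close>.\<close>

lemma test_function_approx:
  assumes "0 \<le> a" "b \<le> T"
  shows "\<exists>\<phi>. (\<forall>k::nat. test_function T (\<phi> k)) \<and> (\<forall>k x. \<bar>\<phi> k x\<bar> \<le> 1) \<and>
    (\<forall>x. (\<lambda>k. \<phi> k x) \<longlonglongrightarrow> (indicator {a<..<b} x :: real))"
proof (intro exI conjI allI)
  define \<phi> where "\<phi> k = bump (a + step k) (b - step k) (step k) 1 0" for k
  show "test_function T (\<phi> k)" for k
    unfolding test_function_def \<phi>_def
  proof (intro conjI allI bump_smooth step_pos exI impI)
    show "0 < a + step k" "b - step k < T" using assms step_pos[of k] by auto
    show "bump (a + step k) (b - step k) (step k) 1 0 x = 0" if "x \<notin> {a + step k..b - step k}" for x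
      using that by (auto simp: bump_def)
  qed
  show "\<bar>\<phi> k x\<bar> \<le> 1" for k x
    using step_pos[of k] by (auto simp: \<phi>_def bump_def)
  show "(\<lambda>k. \<phi> k x) \<longlonglongrightarrow> indicator {a<..<b} x" for x
  proof (cases "x \<in> {a<..<b}")
    case True
    have 1: "(\<lambda>k. exp (- step k / ((x - (a + step k)) * (b - step k - x)))) \<longlonglongrightarrow> exp (- 0 / ((x - (a + 0)) * (b - 0 - x)))"
      using True by (intro tendsto_intros step_tendsto) auto
    have "\<forall>\<^sub>F k in sequentially. step k < x - a" "\<forall>\<^sub>F k in sequentially. step k < b - x"
      using True by (auto intro!: order_tendstoD(2)[OF step_tendsto])
    then have "\<forall>\<^sub>F k in sequentially. exp (- step k / ((x - (a + step k)) * (b - step k - x))) = \<phi> k x"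
      by eventually_elim (auto simp: \<phi>_def bump_def)
    with 1 show ?thesis using True by (simp add: tendsto_cong)
  next
    case False
    then have "\<phi> k x = 0" for k using step_pos[of k] by (auto simp: \<phi>_def bump_def)
    then show ?thesis using False by simp
  qed
qed

lemma test_function_props:
  assumes "test_function T \<phi>"
  shows "(\<phi> has_real_derivative deriv \<phi> x) (at x)" "continuous_on UNIV (deriv \<phi>)" "continuous_on UNIV \<phi>"
    "\<phi> 0 = 0" "\<phi> T = 0" "\<exists>K. \<forall>x\<in>{0..T}. \<bar>deriv \<phi> x\<bar> \<le> K" "\<exists>K. \<forall>x. \<bar>\<phi> x\<bar> \<le> K"
proof -
  have d: "((deriv ^^ k) \<phi>) differentiable (at x)" for k x using assms by (auto simp: test_function_def)
  have d0: "\<phi> differentiable (at x)" for x using d[of 0] by simp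
  have d1: "deriv \<phi> differentiable (at x)" for x using d[of 1] by simp
  show "(\<phi> has_real_derivative deriv \<phi> x) (at x)"
    using d0 DERIV_deriv_iff_real_differentiable by blast
  show c1: "continuous_on UNIV (deriv \<phi>)"
    by (intro continuous_at_imp_continuous_on ballI differentiable_imp_continuous_within d1)
  show c0: "continuous_on UNIV \<phi>"
    by (intro continuous_at_imp_continuous_on ballI differentiable_imp_continuous_within d0)
  obtain a b where ab: "0 < a" "b < T" "\<And>x. x \<notin> {a..b} \<Longrightarrow> \<phi> x = 0"
    using assms by (auto simp: test_function_def)
  show "\<phi> 0 = 0" "\<phi> T = 0" using ab(1,2) by (auto intro!: ab(3))
  have "bounded (deriv \<phi> ` {0..T})" "bounded (\<phi> ` {a..b})"
    by (intro compact_imp_bounded compact_continuous_image continuous_on_subset[OF c1] continuous_on_subset[OF c0]; auto)+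
  then obtain K K' where K: "\<forall>x\<in>{0..T}. \<bar>deriv \<phi> x\<bar> \<le> K" "\<forall>x\<in>{a..b}. \<bar>\<phi> x\<bar> \<le> K'" by (auto simp: bounded_iff)
  show "\<exists>K. \<forall>x\<in>{0..T}. \<bar>deriv \<phi> x\<bar> \<le> K" using K by blast
  have "\<bar>\<phi> x\<bar> \<le> max K' 0" for x
    using K(2) ab(3)[of x] by (cases "x \<in> {a..b}") (auto intro: max.coboundedI1)
  then show "\<exists>K. \<forall>x. \<bar>\<phi> x\<bar> \<le> K" by blast
qed

lemma test_function_FTC:
  assumes "test_function T \<phi>" "a \<le> b"
  shows "(LINT s|lborel. indicator {a..b} s *\<^sub>R deriv \<phi> s) = \<phi> b - \<phi> a"
proof (rule integral_FTC_Icc[OF assms(2)])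
  note tf = test_function_props[OF assms(1)]
  show "continuous_on {a..b} (deriv \<phi>)" by (rule continuous_on_subset[OF tf(2)]) simp
  show "(\<phi> has_vector_derivative deriv \<phi> x) (at x within {a..b})" for x
    using tf(1)[of x] unfolding has_real_derivative_iff_has_vector_derivative
    by (rule has_vector_derivative_at_within)
qed

section \<open>The distributional derivative\<close>

context bvf begin

lemma dom_right: "norm (rlim u t - u t) \<le> rlim W t - W t"
  by (rule LIMSEQ_le[OF tendsto_norm[OF tendsto_diff[OF u_rlim_seq tendsto_const]]
        tendsto_diff[OF W_rlim_seq tendsto_const]]) (auto intro!: dom exI[of _ 0] simp: step_pos less_imp_le)

lemma dom_left: "norm (u t - llim u t) \<le> W t - llim W t"
  by (rule LIMSEQ_le[OF tendsto_norm[OF tendsto_diff[OF tendsto_const u_llim_seq]]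
        tendsto_diff[OF tendsto_const W_llim_seq]]) (auto intro!: dom exI[of _ 0] simp: step_pos less_imp_le)

text \<open>A jump of \<open>u\<close>, from either side, forces a discontinuity of the monotone
  function \<open>W\<close>.\<close>

lemma countable_jumps: "countable {t. \<not> (llim u t = u t \<and> rlim u t = u t)}"
proof (rule countable_subset[OF _ mono_ctble_discont[OF mono_W]], rule subsetI, rule CollectI, rule notI)
  fix t assume t: "t \<in> {t. \<not> (llim u t = u t \<and> rlim u t = u t)}" and c: "isCont W t"
  have "(W \<longlongrightarrow> W t) (at_right t)" "(W \<longlongrightarrow> W t) (at_left t)"
    using c by (auto simp: isCont_def filterlim_at_split)
  then have "rlim W t = W t" "llim W t = W t" by (auto intro!: tendsto_Lim)
  then show False using dom_right[of t] dom_left[of t] t by auto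
qed

lemma isCont_of_no_jump:
  assumes "llim u t = u t" "rlim u t = u t" shows "isCont u t"
  using u_rlim[of t] u_llim[of t] assms by (simp add: isCont_def filterlim_at_split)

end

context bvf_coords begin

lemma borel_measurable_u [measurable]: "u \<in> borel_measurable borel"
proof -
  obtain K where K: "K > 0" "\<And>b x. b \<in> B \<Longrightarrow> \<bar>c b x\<bar> \<le> K * norm x" using coord_bound by blast
  have "(\<lambda>t. c b (u t)) \<in> borel_measurable borel" if b: "b \<in> B" for b
  proof -
    interpret cb: bounded_linear "c b" using c_bl[OF b] .
    have "mono (\<lambda>t. K * W t + c b (u t))"
    proof (rule monoI)
      fix x y :: real assume "x \<le> y"
      then have "\<bar>c b (u y - u x)\<bar> \<le> K * (W y - W x)"
        by (intro order_trans[OF K(2)[OF b]]) (use K(1) dom in simp)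
      then show "K * W x + c b (u x) \<le> K * W y + c b (u y)" by (force simp: cb.diff algebra_simps abs_le_iff)
    qed
    then have "(\<lambda>t. (K * W t + c b (u t)) - K * W t) \<in> borel_measurable borel"
      by (intro borel_measurable_diff borel_measurable_times borel_measurable_const borel_measurable_mono mono_W)
    then show ?thesis by simp
  qed
  then have "(\<lambda>t. \<Sum>b\<in>B. c b (u t) *\<^sub>R b) \<in> borel_measurable borel" by (intro borel_measurable_sum borel_measurable_scaleR) auto
  then show ?thesis by (simp add: c_sum)
qed

text \<open>The Stieltjes measure of the curve on the whole line; a choice is enough, as its values
  on half-open intervals and points are all that is used.\<close>

definition nu0 :: "real set \<Rightarrow> 'a" where
  "nu0 = (SOME \<nu>. cadd \<nu> \<and> (\<forall>a b. a \<le> b \<longrightarrow> \<nu> {a<..b} = rlim u b - rlim u a) \<and> (\<forall>t. \<nu> {t} = rlim u t - llim u t))"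

lemma cadd_nu0: "cadd nu0"
  and nu0_Ioc: "a \<le> b \<Longrightarrow> nu0 {a<..b} = rlim u b - rlim u a"
  and nu0_point: "nu0 {t} = rlim u t - llim u t"
  using someI_ex[OF stieltjes_ex] unfolding nu0_def by blast+

lemma nu0_Ioo: "a < b \<Longrightarrow> nu0 {a<..<b} = llim u b - rlim u a"
proof -
  assume ab: "a < b"
  have "{a<..<b} = {a<..b} - {b}" using ab by auto
  then have "nu0 {a<..<b} = nu0 {a<..b} - nu0 {b}" using ab by (simp add: cadd_Diff[OF cadd_nu0])
  then show ?thesis using nu0_Ioc[of a b] nu0_point[of b] ab by simp
qed

end

section \<open>A curve on [0,T] extended by constants\<close>

definition clamp :: "real \<Rightarrow> real \<Rightarrow> real" where
  "clamp T t = max 0 (min T t)"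

lemma clamp_id: "t \<in> {0..T} \<Longrightarrow> clamp T t = t"
  by (auto simp: clamp_def)

lemma clamp_in: "T > 0 \<Longrightarrow> clamp T t \<in> {0..T}"
  by (auto simp: clamp_def)

lemma clamp_mono: "s \<le> t \<Longrightarrow> clamp T s \<le> clamp T t"
  by (auto simp: clamp_def)

locale bv_curve = fin_coords B c
  for B :: "'a::{banach,second_countable_topology} set" and c +
  fixes T :: real and u :: "real \<Rightarrow> 'a" and V :: "real \<Rightarrow> real" and M :: real
  assumes T: "T > 0"
    and V_dom: "0 \<le> a \<Longrightarrow> a \<le> b \<Longrightarrow> b \<le> T \<Longrightarrow> norm (u b - u a) \<le> V b - V a"
    and V_bd: "t \<in> {0..T} \<Longrightarrow> 0 \<le> V t \<and> V t \<le> M"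
begin

text \<open>Constant extension to the real line makes the one-sided limits at \<open>0\<close> and \<open>T\<close> agree with the
  conventions \<open>u(0-) = u(0)\<close> and \<open>u(T+) = u(T)\<close>.  The time summand of \<open>W\<close> lets \<open>W\<close> dominate also the
  increments of time-dependent functions of \<open>u\<close>.\<close>

definition uc :: "real \<Rightarrow> 'a" where "uc t = u (clamp T t)"
definition W :: "real \<Rightarrow> real" where "W t = clamp T t + V (clamp T t)"

lemma dom_uc: "a \<le> b \<Longrightarrow> norm (uc b - uc a) + (clamp T b - clamp T a) \<le> W b - W a"
  using V_dom[of "clamp T a" "clamp T b"] clamp_in[OF T, of a] clamp_in[OF T, of b] clamp_mono[of a b]
  by (auto simp: uc_def W_def)

lemma bd_W: "\<bar>W t\<bar> \<le> T + M"
  using V_bd[OF clamp_in[OF T, of t]] clamp_in[OF T, of t] by (auto simp: W_def)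

sublocale bvf_coords uc W "T + M" B c
proof
  show "norm (uc b - uc a) \<le> W b - W a" if "a \<le> b" for a b
    using dom_uc[OF that] clamp_mono[OF that, of T] by simp
qed (rule bd_W)

lemma uc_id: "t \<in> {0..T} \<Longrightarrow> uc t = u t"
  by (simp add: uc_def clamp_id)

lemma lim_left_eq: "t \<in> {0..T} \<Longrightarrow> lim_left u t = llim uc t"
proof -
  assume t: "t \<in> {0..T}"
  show ?thesis
  proof (cases "t = 0")
    case True
    have "\<forall>\<^sub>F x in at_left 0. uc x = u 0"
      unfolding eventually_at_filter using T by (auto intro!: always_eventually simp: uc_def clamp_def)
    then have "(uc \<longlongrightarrow> u 0) (at_left 0)" by (simp add: tendsto_eventually)
    then show ?thesis using True by (simp add: lim_left_def tendsto_Lim)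
  next
    case False
    then have "\<forall>\<^sub>F x in at_left t. uc x = u x"
      using t by (auto simp: eventually_at_left_field uc_id intro!: exI[of _ 0])
    then have "(u \<longlongrightarrow> llim uc t) (at_left t)" using u_llim[of t] by (simp add: tendsto_cong)
    then show ?thesis using False by (simp add: lim_left_def tendsto_Lim)
  qed
qed

lemma lim_right_eq: "t \<in> {0..T} \<Longrightarrow> lim_right T u t = rlim uc t"
proof -
  assume t: "t \<in> {0..T}"
  show ?thesis
  proof (cases "t = T")
    case True
    have "\<forall>\<^sub>F x in at_right T. uc x = u T"
      unfolding eventually_at_filter using T by (auto intro!: always_eventually simp: uc_def clamp_def)
    then have "(uc \<longlongrightarrow> u T) (at_right T)" by (simp add: tendsto_eventually)
    then show ?thesis using True by (simp add: lim_right_def tendsto_Lim)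
  next
    case False
    then have "\<forall>\<^sub>F x in at_right t. uc x = u x"
      using t by (auto simp: eventually_at_right_field uc_id intro!: exI[of _ T])
    then have "(u \<longlongrightarrow> rlim uc t) (at_right t)" using u_rlim[of t] by (simp add: tendsto_cong)
    then show ?thesis using False by (simp add: lim_right_def tendsto_Lim)
  qed
qed

definition J where "J = jump_set T u"

lemma J_iff: "t \<in> J \<longleftrightarrow> t \<in> {0..T} \<and> \<not> (llim uc t = u t \<and> rlim uc t = u t)"
  unfolding J_def jump_set_def using lim_left_eq lim_right_eq by force

lemma countable_J: "countable J"
  by (rule countable_subset[OF _ countable_jumps]) (auto simp: J_iff uc_id)

lemma J_borel [measurable]: "J \<in> sets borel"
  using countable_borel[OF countable_J] .

text \<open>Cutting down to (0,T) and to the Borel sets matches the clauses in the description of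
  \<open>distr_deriv\<close>. Atoms at 0 and \<open>T\<close>, which \<open>nu0\<close> may have,
  are lost here; they return as boundary terms.\<close>

definition nu :: "real set \<Rightarrow> 'a" where
  "nu A = (if A \<in> sets borel then nu0 (A \<inter> {0<..<T}) else 0)"

lemma vmeasure_nu: "vmeasure nu"
  unfolding nu_def[abs_def] by (intro cadd_vmeasure cadd_restrict cadd_nu0) simp

lemma cadd_nu: "cadd nu"
  using vmeasure_nu by (rule vmeasure_cadd)

lemma nu_carrier: "A \<in> sets borel \<Longrightarrow> nu (A \<inter> {0<..<T}) = nu A"
  by (simp add: nu_def)

lemma nu_lessThan: "0 < s \<Longrightarrow> s \<le> T \<Longrightarrow> nu {..<s} = llim uc s - rlim uc 0"
proof -
  assume s: "0 < s" "s \<le> T"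
  then have "{..<s} \<inter> {0<..<T} = {0<..<s}" by auto
  then show ?thesis using nu0_Ioo[of 0 s] s by (simp add: nu_def)
qed

lemma bounded_uc: "norm (uc t) \<le> norm (u 0) + M"
proof -
  have "norm (uc t - u 0) \<le> M"
    using V_dom[of 0 "clamp T t"] clamp_in[OF T, of t] V_bd[of 0] V_bd[of "clamp T t"] T by (auto simp: uc_def)
  then show ?thesis by norm
qed

lemma AE_llim_uc: "AE s in lborel. llim uc s = uc s"
proof -
  have "{t. \<not> (llim uc t = uc t \<and> rlim uc t = uc t)} \<in> null_sets lborel"
    using countable_imp_null_set_lborel[OF countable_jumps] .
  then show ?thesis by (rule AE_I') auto
qed

lemma set_integrable_test_uc:
  assumes \<phi>: "test_function T \<phi>"
  shows "set_integrable lborel {0..T} (\<lambda>s. deriv \<phi> s *\<^sub>R uc s)" "set_integrable lborel {0..T} (deriv \<phi>)"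
proof -
  note tf = test_function_props[OF \<phi>]
  have [measurable]: "deriv \<phi> \<in> borel_measurable borel" by (rule borel_measurable_continuous_onI[OF tf(2)])
  obtain K where K: "\<forall>x\<in>{0..T}. \<bar>deriv \<phi> x\<bar> \<le> K" using tf(6) by blast
  have ind: "integrable lborel (indicat_real {0..T})"
    by (rule integrable_real_indicator) (use T in auto)
  show "set_integrable lborel {0..T} (\<lambda>s. deriv \<phi> s *\<^sub>R uc s)"
  proof (rule set_integrable_bound[where f="\<lambda>_. K * (norm (u 0) + M)"])
    show "AE x in lborel. x \<in> {0..T} \<longrightarrow> norm (deriv \<phi> x *\<^sub>R uc x) \<le> norm (K * (norm (u 0) + M))"
    proof (intro AE_I2 impI)
      fix x assume "x \<in> {0..T}"
      then have "norm (deriv \<phi> x *\<^sub>R uc x) \<le> K * (norm (u 0) + M)"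
        using mult_mono'[of "\<bar>deriv \<phi> x\<bar>" K "norm (uc x)" "norm (u 0) + M"] K bounded_uc[of x] by simp
      then show "norm (deriv \<phi> x *\<^sub>R uc x) \<le> norm (K * (norm (u 0) + M))" by simp
    qed
  qed (use ind in \<open>auto simp: set_integrable_def set_borel_measurable_def\<close>)
  show "set_integrable lborel {0..T} (deriv \<phi>)"
    by (rule borel_integrable_atLeastAtMost'[OF continuous_on_subset[OF tf(2)]]) simp
qed

text \<open>Fubini for the kernel that is deriv \<phi> (s) times the density at x on the region x <
  s. Integration in s gives -\<phi>(x) times the density, integration in x gives
  \<open>nu {..<s}\<close>.\<close>

lemma parts_formula:
  assumes \<phi>: "test_function T \<phi>"
  shows "(LINT t:{0..T}|lborel. deriv \<phi> t *\<^sub>R uc t) = - vm_integral nu \<phi>"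
proof -
  note tf = test_function_props[OF \<phi>]
  have [measurable]: "deriv \<phi> \<in> borel_measurable borel" "\<phi> \<in> borel_measurable borel"
    by (rule borel_measurable_continuous_onI[OF tf(2)], rule borel_measurable_continuous_onI[OF tf(3)])
  obtain K where K: "\<forall>x\<in>{0..T}. \<bar>deriv \<phi> x\<bar> \<le> K" using tf(6) by blast
  have K0: "K \<ge> 0" using K T by (metis abs_ge_zero atLeastAtMost_iff less_imp_le order_refl order_trans)
  let ?V = "vm_variation nu"
  define h where "h = vm_density nu ?V"
  have h: "integrable ?V h" "\<And>A. A \<in> sets borel \<Longrightarrow> nu A = (LINT t:A|?V. h t)"
    unfolding h_def using vm_density_variation[OF cadd_nu] by blast+
  have [measurable]: "h \<in> borel_measurable borel" using borel_measurable_integrable[OF h(1)] by simp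
  interpret V: finite_measure ?V by (rule finite_vm_variation[OF cadd_nu])
  interpret P: pair_sigma_finite lborel ?V by unfold_locales
  have AE_in: "AE x in ?V. x \<in> {0<..<T}"
  proof -
    have "nu A = 0" if "A \<in> sets borel" "A \<subseteq> - {0<..<T}" for A
    proof -
      have "A \<inter> {0<..<T} = {}" using that by auto
      then show ?thesis using nu_carrier[OF that(1)] cadd_empty[OF cadd_nu] by simp
    qed
    then have "- {0<..<T} \<in> null_sets ?V"
      by (intro null_setsI) (auto simp: emeasure_vm_variation[OF cadd_nu] intro!: vvar_zero)
    then show ?thesis by (rule AE_I') auto
  qed
  define f where "f s x = (indicator {0..T} s * indicator {x<..} s * deriv \<phi> s) *\<^sub>R h x" for s x
  have ft: "\<phi> x = - (LINT s|lborel. indicator {0..T} s * indicator {x<..} s * deriv \<phi> s)" if x: "x \<in> {0<..<T}" for x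
  proof -
    have "(LINT s|lborel. indicator {x..T} s *\<^sub>R deriv \<phi> s) = \<phi> T - \<phi> x"
      by (rule test_function_FTC[OF \<phi>]) (use x in auto)
    moreover have "(LINT s|lborel. indicator {x..T} s *\<^sub>R deriv \<phi> s) = (LINT s|lborel. indicator {0..T} s * indicator {x<..} s * deriv \<phi> s)"
    proof (rule integral_cong_AE)
      show "AE s in lborel. indicator {x..T} s *\<^sub>R deriv \<phi> s = indicator {0..T} s * indicator {x<..} s * deriv \<phi> s"
        using AE_lborel_singleton[of x] by eventually_elim (use x in \<open>auto split: split_indicator\<close>)
    qed auto
    ultimately show ?thesis using tf(5) by simp
  qed
  have meas: "(\<lambda>(s, x). f s x) \<in> borel_measurable (lborel \<Otimes>\<^sub>M ?V)"
  proof -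
    have "(\<lambda>(s, x). f s x) = (\<lambda>p. (indicator {0..T} (fst p) * indicator {p. snd p < fst p} p * deriv \<phi> (fst p)) *\<^sub>R h (snd p))"
      by (auto simp: f_def fun_eq_iff split: split_indicator)
    also have "\<dots> \<in> borel_measurable (lborel \<Otimes>\<^sub>M ?V)"
    proof -
      have [measurable]: "{p. snd p < fst p} \<in> sets (lborel \<Otimes>\<^sub>M ?V)"
      proof -
        have "{p \<in> space (lborel \<Otimes>\<^sub>M ?V). snd p < fst p} \<in> sets (lborel \<Otimes>\<^sub>M ?V)" by measurable
        then show ?thesis by (simp add: space_pair_measure)
      qed
      show ?thesis by measurable
    qed
    finally show ?thesis .
  qed
  have int: "integrable (lborel \<Otimes>\<^sub>M ?V) (\<lambda>(s, x). f s x)"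
  \<comment> \<open>The kernel is bounded by the constant \<open>K\<close> on [0,T] times the norm
    of the density, a product of two integrable functions.\<close>
  proof (rule Bochner_Integration.integrable_bound[OF _ meas])
    have ind: "integrable lborel (\<lambda>s. indicator {0..T} s *\<^sub>R (K * (LINT x|?V. norm (h x))))"
      by (rule integrable_indicator) (use T in auto)
    show "integrable (lborel \<Otimes>\<^sub>M ?V) (\<lambda>p. (indicator {0..T} (fst p) * K) * norm (h (snd p)))"
    proof (rule P.Fubini_integrable)
      show "integrable lborel (\<lambda>s. LINT x|?V. norm (indicator {0..T} (fst (s, x)) * K * norm (h (snd (s, x)))))"
        using ind K0 by (simp add: abs_mult mult.assoc)
    qed (use integrable_norm[OF h(1)] in auto)
    show "AE p in lborel \<Otimes>\<^sub>M ?V. norm (case p of (s, x) \<Rightarrow> f s x) \<le> norm (indicator {0..T} (fst p) * K * norm (h (snd p)))"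
      using K K0 by (intro AE_I2) (auto simp: f_def abs_mult split: split_indicator intro!: mult_right_mono)
  qed
  have inner: "(LINT x|?V. f s x) = (indicator {0..T} s * deriv \<phi> s) *\<^sub>R nu {..<s}" for s
  proof -
    have "(LINT x|?V. f s x) = (LINT x|?V. (indicator {0..T} s * deriv \<phi> s) *\<^sub>R (indicator {..<s} x *\<^sub>R h x))"
      by (rule Bochner_Integration.integral_cong) (auto simp: f_def split: split_indicator)
    also have "\<dots> = (indicator {0..T} s * deriv \<phi> s) *\<^sub>R nu {..<s}"
      unfolding integral_scaleR_right using h(2)[of "{..<s}"] by (simp add: set_lebesgue_integral_def)
    finally show ?thesis .
  qed
  have "vm_integral nu \<phi> = (LINT x|?V. \<phi> x *\<^sub>R h x)" by (simp add: vm_integral_def h_def)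
  also have "\<dots> = (LINT x|?V. - (LINT s|lborel. f s x))"
  proof (rule integral_cong_AE)
    show "(\<lambda>x. - (LINT s|lborel. f s x)) \<in> borel_measurable ?V"
      using P.integrable_snd[OF int] by (intro borel_measurable_uminus) auto
    show "AE x in ?V. \<phi> x *\<^sub>R h x = - (LINT s|lborel. f s x)"
      using AE_in
    proof eventually_elim
      case (elim x)
      have "(LINT s|lborel. f s x) = (LINT s|lborel. indicator {0..T} s * indicator {x<..} s * deriv \<phi> s) *\<^sub>R h x"
      proof -
        have "integrable lborel (\<lambda>s. indicator {0..T} s * indicator {x<..} s * deriv \<phi> s)"
        proof (rule Bochner_Integration.integrable_bound)
          show "integrable lborel (\<lambda>s. indicator {0..T} s *\<^sub>R deriv \<phi> s)"
            using set_integrable_test_uc(2)[OF \<phi>] by (simp add: set_integrable_def)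
        qed (auto split: split_indicator)
        then show ?thesis unfolding f_def by simp
      qed
      then show ?case using ft[OF elim] by simp
    qed
  qed measurable
  also have "\<dots> = - (LINT s|lborel. LINT x|?V. f s x)"
    using P.Fubini_integral[OF int] by simp
  \<comment> \<open>\<open>nu {..<s}\<close> is u(s-) - u(0+), and u(s-) = u(s) off a countable set.
    The constant u(0+) disappears at the end since \<phi> vanishes at 0 and
    \<open>T\<close>.\<close>
  also have "(LINT s|lborel. LINT x|?V. f s x) = (LINT s|lborel. indicator {0..T} s *\<^sub>R (deriv \<phi> s *\<^sub>R uc s) - (indicator {0..T} s *\<^sub>R deriv \<phi> s) *\<^sub>R rlim uc 0)"
  proof (rule integral_cong_AE)
    show "(\<lambda>s. LINT x|?V. f s x) \<in> borel_measurable lborel"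
      using P.integrable_fst[OF int] by auto
    show "AE s in lborel. (LINT x|?V. f s x) = indicator {0..T} s *\<^sub>R (deriv \<phi> s *\<^sub>R uc s) - (indicator {0..T} s *\<^sub>R deriv \<phi> s) *\<^sub>R rlim uc 0"
      using AE_llim_uc AE_lborel_singleton[of 0]
    proof eventually_elim
      case (elim s)
      then show ?case unfolding inner using nu_lessThan[of s] by (auto split: split_indicator simp: scaleR_diff_right)
    qed
  qed measurable
  also have "\<dots> = (LINT t:{0..T}|lborel. deriv \<phi> t *\<^sub>R uc t) - (LINT t:{0..T}|lborel. deriv \<phi> t) *\<^sub>R rlim uc 0"
    using set_integrable_test_uc[OF \<phi>]
    by (simp add: set_lebesgue_integral_def set_integrable_def del: real_scaleR_def)
  also have "(LINT t:{0..T}|lborel. deriv \<phi> t) = \<phi> T - \<phi> 0"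
    unfolding set_lebesgue_integral_def
    by (rule test_function_FTC[OF \<phi>]) (use T in auto)
  finally show ?thesis using tf(4,5) by simp
qed

lemma vm_integral_limit:
  assumes \<nu>: "cadd (\<nu> :: real set \<Rightarrow> 'a)"
    and \<phi>: "\<And>k::nat. test_function T (\<phi> k)" "\<And>k x. \<bar>\<phi> k x\<bar> \<le> 1" "\<And>x. (\<lambda>k. \<phi> k x) \<longlonglongrightarrow> (indicator {a<..<b} x :: real)"
  shows "(\<lambda>k. vm_integral \<nu> (\<phi> k)) \<longlonglongrightarrow> \<nu> {a<..<b}"
proof -
  let ?V = "vm_variation \<nu>"
  define h where "h = vm_density \<nu> ?V"
  have h: "integrable ?V h" "\<And>A. A \<in> sets borel \<Longrightarrow> \<nu> A = (LINT t:A|?V. h t)"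
    unfolding h_def using vm_density_variation[OF \<nu>] by blast+
  have [measurable]: "\<phi> k \<in> borel_measurable borel" for k
    by (rule borel_measurable_continuous_onI[OF test_function_props(3)[OF \<phi>(1)]])
  have [measurable]: "h \<in> borel_measurable borel" using borel_measurable_integrable[OF h(1)] by simp
  have "(\<lambda>k. LINT t|?V. \<phi> k t *\<^sub>R h t) \<longlonglongrightarrow> (LINT t|?V. indicator {a<..<b} t *\<^sub>R h t)"
  proof (rule integral_dominated_convergence[where w="\<lambda>t. norm (h t)"])
    show "AE x in ?V. norm (\<phi> k x *\<^sub>R h x) \<le> norm (h x)" for k
      using \<phi>(2) by (intro AE_I2) (auto intro!: mult_left_le_one_le)
    show "AE x in ?V. (\<lambda>k. \<phi> k x *\<^sub>R h x) \<longlonglongrightarrow> indicator {a<..<b} x *\<^sub>R h x"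
      by (intro AE_I2 tendsto_scaleR \<phi>(3) tendsto_const)
  qed (use h in \<open>auto\<close>)
  then show ?thesis using h(2)[of "{a<..<b}"] by (simp add: vm_integral_def h_def set_lebesgue_integral_def)
qed

text \<open>Uniqueness in the description: two candidates have the same integrals of test functions,
  hence by dominated convergence the same values on open subintervals of (0,T), and both are carried
  by (0,T).\<close>

lemma distr_deriv_eq: "distr_deriv T u = nu"
proof -
  have eq: "(LINT t:{0..T}|lborel. deriv \<phi> t *\<^sub>R u t) = (LINT t:{0..T}|lborel. deriv \<phi> t *\<^sub>R uc t)" for \<phi>
    by (rule set_lebesgue_integral_cong) (auto simp: uc_id)
  show ?thesis unfolding distr_deriv_def eq
  proof (rule the_equality)
    show "vmeasure nu \<and> (\<forall>A\<in>sets borel. nu A = nu (A \<inter> {0<..<T})) \<and>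
      (\<forall>\<phi>. test_function T \<phi> \<longrightarrow> (LINT t:{0..T}|lborel. deriv \<phi> t *\<^sub>R uc t) = - vm_integral nu \<phi>)"
      using vmeasure_nu nu_carrier parts_formula by auto
    fix \<nu> :: "real set \<Rightarrow> 'a" assume \<nu>: "vmeasure \<nu> \<and> (\<forall>A\<in>sets borel. \<nu> A = \<nu> (A \<inter> {0<..<T})) \<and>
      (\<forall>\<phi>. test_function T \<phi> \<longrightarrow> (LINT t:{0..T}|lborel. deriv \<phi> t *\<^sub>R uc t) = - vm_integral \<nu> \<phi>)"
    have \<nu>c: "cadd \<nu>" by (rule vmeasure_cadd[OF conjunct1[OF \<nu>]])
    have \<nu>car: "\<nu> A = \<nu> (A \<inter> {0<..<T})" if "A \<in> sets borel" for A
      using conjunct1[OF conjunct2[OF \<nu>]] that by (rule bspec)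
    have \<nu>t: "- vm_integral \<nu> \<phi> = (LINT t:{0..T}|lborel. deriv \<phi> t *\<^sub>R uc t)" if "test_function T \<phi>" for \<phi>
      using conjunct2[OF conjunct2[OF \<nu>]] that by simp
    have open_eq: "\<nu> {a<..<b} = nu {a<..<b}" if ab: "0 \<le> a" "b \<le> T" for a b
    proof -
      obtain \<phi> where \<phi>: "\<And>k::nat. test_function T (\<phi> k)" "\<And>k x. \<bar>\<phi> k x\<bar> \<le> 1"
        "\<And>x. (\<lambda>k. \<phi> k x) \<longlonglongrightarrow> (indicator {a<..<b} x :: real)"
        using test_function_approx[OF ab] by blast
      have "vm_integral \<nu> (\<phi> k) = vm_integral nu (\<phi> k)" for k
        using \<nu>t[OF \<phi>(1)] parts_formula[OF \<phi>(1)] by (metis neg_equal_iff_equal)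
      then show ?thesis using vm_integral_limit[OF \<nu>c \<phi>] vm_integral_limit[OF cadd_nu \<phi>] LIMSEQ_unique by force
    qed
    have "\<nu> A = nu A" if A: "A \<in> sets borel" for A
    proof (rule cadd_unique[OF \<nu>c cadd_nu _ _ A])
      fix a b :: real
      have "{a<..<b} \<inter> {0<..<T} = {max a 0<..<min b T}" by auto
      moreover have "\<nu> {a<..<b} = \<nu> ({a<..<b} \<inter> {0<..<T})" by (rule \<nu>car) simp
      moreover have "nu {a<..<b} = nu ({a<..<b} \<inter> {0<..<T})" by (rule nu_carrier[symmetric]) simp
      ultimately show "\<nu> {a<..<b} = nu {a<..<b}" using open_eq[of "max a 0" "min b T"] by simp
    next
      have "\<nu> UNIV = \<nu> (UNIV \<inter> {0<..<T})" by (rule \<nu>car) simp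
      moreover have "nu UNIV = nu (UNIV \<inter> {0<..<T})" by (rule nu_carrier[symmetric]) simp
      ultimately show "\<nu> UNIV = nu UNIV" using open_eq[of 0 T] by simp
    qed
    moreover have "\<nu> A = nu A" if "A \<notin> sets borel" for A
      using vmeasure_zero[OF conjunct1[OF \<nu>] that] vmeasure_zero[OF vmeasure_nu that] by simp
    ultimately show "\<nu> = nu" by blast
  qed
qed

end

section \<open>The parts of the derivative\<close>

context fin_coords begin

text \<open>A Lebesgue null set of maximal variation carries the singular part.\<close>

lemma singular_carrier_ex:
  assumes \<nu>: "cadd (\<nu> :: real set \<Rightarrow> 'a)"
  shows "\<exists>N\<in>null_sets lborel. \<forall>A\<in>null_sets lborel. \<nu> (A - N) = 0"
proof -
  let ?V = "vm_variation \<nu>"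
  interpret V: finite_measure ?V by (rule finite_vm_variation[OF \<nu>])
  define S where "S = measure ?V ` null_sets lborel"
  have ne: "S \<noteq> {}" unfolding S_def by auto
  have bdd: "bdd_above S" unfolding S_def using V.bounded_measure by (auto simp: bdd_above_def)
  have "\<exists>A\<in>null_sets lborel. Sup S - step n < measure ?V A" for n
    using less_cSup_iff[OF ne bdd, of "Sup S - step n"] step_pos[of n] by (auto simp: S_def)
  then obtain X where X: "\<And>n. X n \<in> null_sets lborel" "\<And>n. Sup S - step n < measure ?V (X n)" by metis
  define N where "N = (\<Union>n. X n)"
  have N: "N \<in> null_sets lborel" unfolding N_def using X(1) by auto
  have Nb: "N \<in> sets borel" using N by auto
  have "Sup S \<le> measure ?V N"
  proof -
    have "Sup S - step n \<le> measure ?V N" for n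
    proof -
      have "measure ?V (X n) \<le> measure ?V N" using Nb by (intro V.finite_measure_mono) (auto simp: N_def)
      then show ?thesis using X(2)[of n] by simp
    qed
    moreover have "(\<lambda>n. Sup S - step n) \<longlonglongrightarrow> Sup S - 0" by (intro tendsto_intros step_tendsto)
    ultimately show ?thesis by (intro LIMSEQ_le_const2[of "\<lambda>n. Sup S - step n"]) auto
  qed
  have "\<nu> (A - N) = 0" if A: "A \<in> null_sets lborel" for A
  proof -
    have Ab: "A \<in> sets borel" using A by auto
    \<comment> \<open>The union with \<open>N\<close> is again a null set, so its variation cannot
      exceed the supremum, which \<open>N\<close> already attains.\<close>
    have "N \<union> (A - N) \<in> null_sets lborel" using A N by auto
    then have "measure ?V (N \<union> (A - N)) \<le> Sup S" unfolding S_def by (intro cSup_upper bdd[unfolded S_def]) auto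
    moreover have "measure ?V (N \<union> (A - N)) = measure ?V N + measure ?V (A - N)"
      using Ab Nb by (intro V.finite_measure_Union) auto
    ultimately have "measure ?V (A - N) \<le> 0" using \<open>Sup S \<le> measure ?V N\<close> by simp
    then have "norm (\<nu> (A - N)) \<le> 0"
      using norm_le_measure_variation[OF \<nu>, of "A - N"] Ab Nb by (meson order_trans sets.Diff)
    then show ?thesis by simp
  qed
  then show ?thesis using N by blast
qed

text \<open>For uniqueness, let \<open>N\<close> and \<open>N'\<close> carry the singular parts of
  two decompositions. Both absolutely continuous parts vanish on \<open>N\<close> and on
  \<open>N'\<close>, and both agree with \<nu> off their union.\<close>

lemma ac_part_eq:
  assumes \<nu>: "vmeasure (\<nu> :: real set \<Rightarrow> 'a)" and N: "N \<in> null_sets lborel"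
    and ac: "\<And>A. A \<in> null_sets lborel \<Longrightarrow> \<nu> (A - N) = 0"
  shows "ac_part \<nu> = (\<lambda>A. if A \<in> sets borel then \<nu> (A - N) else 0)"
  unfolding ac_part_def
proof (rule the_equality)
  note \<nu>c = vmeasure_cadd[OF \<nu>]
  have Nb: "N \<in> sets borel" using N by auto
  let ?L = "\<lambda>A. if A \<in> sets borel then \<nu> (A - N) else 0"
  show "vmeasure ?L \<and> (\<forall>A\<in>null_sets lborel. ?L A = 0) \<and>
    (\<exists>N\<in>null_sets lborel. \<forall>A\<in>sets borel. \<nu> A - ?L A = \<nu> (A \<inter> N) - ?L (A \<inter> N))"
  proof (intro conjI ballI bexI[OF _ N])
    show "vmeasure ?L" by (intro cadd_vmeasure cadd_restrict_diff \<nu>c Nb)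
    show "?L A = 0" if "A \<in> null_sets lborel" for A using ac[OF that] by simp
    fix A :: "real set" assume A: "A \<in> sets borel"
    have "\<nu> (A \<inter> N - N) = 0" using cadd_empty[OF \<nu>c] by (metis Diff_cancel Int_Diff inf_bot_right)
    then show "\<nu> A - ?L A = \<nu> (A \<inter> N) - ?L (A \<inter> N)"
      using A Nb cadd_split[OF \<nu>c A Nb] by simp
  qed
  fix \<nu>L :: "real set \<Rightarrow> 'a"
  assume L: "vmeasure \<nu>L \<and> (\<forall>A\<in>null_sets lborel. \<nu>L A = 0) \<and>
    (\<exists>N\<in>null_sets lborel. \<forall>A\<in>sets borel. \<nu> A - \<nu>L A = \<nu> (A \<inter> N) - \<nu>L (A \<inter> N))"
  have Lv: "vmeasure \<nu>L" and L0: "\<And>A. A \<in> null_sets lborel \<Longrightarrow> \<nu>L A = 0" using L by auto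
  obtain N' where N': "N' \<in> null_sets lborel" and
    eq: "\<And>A. A \<in> sets borel \<Longrightarrow> \<nu> A - \<nu>L A = \<nu> (A \<inter> N') - \<nu>L (A \<inter> N')" using L by meson
  note Lc = vmeasure_cadd[OF Lv]
  have N'b: "N' \<in> sets borel" using N' by auto
  have null_sub: "D \<in> null_sets lborel" if "D \<in> sets borel" "D \<subseteq> N \<or> D \<subseteq> N'" for D
    using that null_sets_subset[OF N, of D] null_sets_subset[OF N', of D] by auto
  have 1: "\<nu>L D = \<nu> (D - N')" if D: "D \<in> sets borel" for D
  proof -
    have "\<nu>L (D \<inter> N') = 0" using D N'b by (intro L0 null_sub) auto
    then show ?thesis using eq[OF D] cadd_split[OF \<nu>c D N'b] by (simp add: algebra_simps)
  qed
  show "\<nu>L = ?L"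
  proof
    fix A :: "real set"
    show "\<nu>L A = ?L A"
    proof (cases "A \<in> sets borel")
      case A: True
      have "\<nu>L (A \<inter> N) = 0" using A Nb by (intro L0 null_sub) auto
      then have "\<nu>L A = \<nu>L (A - N)" using cadd_split[OF Lc A Nb] by simp
      also have "\<dots> = \<nu> (A - N - N')" using A Nb by (intro 1) auto
      also have "\<dots> = \<nu> (A - N)"
      proof -
        have "(A - N) \<inter> N' = (A \<inter> N') - N" by auto
        moreover have "\<nu> (A \<inter> N' - N) = 0" using A N'b by (intro ac null_sub) auto
        ultimately show ?thesis using cadd_split[OF \<nu>c, of "A - N" N'] A Nb N'b by simp
      qed
      finally show ?thesis using A by simp
    qed (use Lv in \<open>simp add: vmeasure_zero\<close>)
  qed
qed

end

context bv_curve begin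

lemma J_null: "J \<in> null_sets lborel"
  by (rule countable_imp_null_set_lborel[OF countable_J])

lemma nu_point:
  assumes "t \<notin> J" shows "nu {t} = 0"
proof (cases "t \<in> {0<..<T}")
  case True
  then have "{t} \<inter> {0<..<T} = {t}" by auto
  then show ?thesis using assms True nu0_point[of t] J_iff[of t] by (auto simp: nu_def)
next
  case False
  then have "{t} \<inter> {0<..<T} = {}" by auto
  then show ?thesis by (simp add: nu_def cadd_empty[OF cadd_nu0])
qed

lemma cadd_nuJ: "cadd (\<lambda>A. nu (A - J))"
  by (intro cadd_restrict_diff cadd_nu J_borel)

text \<open>The absolutely continuous part cancels between \<open>deriv_L\<close> and
  \<open>deriv_C\<close>; the diffuse part is the derivative off the jump set.\<close>

lemma deriv_co_eq: "A \<in> sets borel \<Longrightarrow> deriv_co T u A = nu (A - J)"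
  using cadd_split[OF cadd_nu _ J_borel, of A]
  by (simp add: deriv_co_def deriv_C_def deriv_J_def distr_deriv_eq J_def)

text \<open>The singular part lives on \<open>N\<close>. Since \<open>J\<close> is a Lebesgue null
  set, the derivative vanishes on subsets of \<open>J\<close> outside \<open>N\<close>, so
  subtracting the jump part removes exactly the points of \<open>J\<close> in
  \<open>N\<close>.\<close>

lemma deriv_C_ex:
  "\<exists>N\<in>null_sets lborel. (\<forall>A\<in>null_sets lborel. nu (A - N) = 0) \<and> (\<forall>A\<in>sets borel. deriv_C T u A = nu (A \<inter> N - J))"
proof -
  obtain N where N: "N \<in> null_sets lborel" "\<And>A. A \<in> null_sets lborel \<Longrightarrow> nu (A - N) = 0"
    using singular_carrier_ex[OF cadd_nu] by blast
  have Nb: "N \<in> sets borel" using N by auto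
  have "deriv_C T u A = nu (A \<inter> N - J)" if A: "A \<in> sets borel" for A
  proof -
    have "deriv_C T u A = nu A - nu (A - N) - nu (A \<inter> J)"
      using A ac_part_eq[OF vmeasure_nu N] by (simp add: deriv_C_def deriv_L_def deriv_J_def distr_deriv_eq J_def)
    also have "nu A - nu (A - N) = nu (A \<inter> N)" using cadd_split[OF cadd_nu A Nb] by simp
    also have "nu (A \<inter> J) = nu (A \<inter> N \<inter> J)"
    proof -
      have "A \<inter> J \<in> null_sets lborel" using null_set_Int1[OF J_null, of A] A by (simp add: Int_commute)
      then have "nu (A \<inter> J - N) = 0" by (rule N(2))
      moreover have "A \<inter> J \<inter> N = A \<inter> N \<inter> J" by auto
      ultimately show ?thesis using cadd_split[OF cadd_nu, of "A \<inter> J" N] A Nb by simp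
    qed
    also have "nu (A \<inter> N) - nu (A \<inter> N \<inter> J) = nu (A \<inter> N - J)"
      using cadd_split[OF cadd_nu, of "A \<inter> N" J] A Nb by simp
    finally show ?thesis .
  qed
  then show ?thesis using N by blast
qed

lemma cadd_deriv_C: "cadd (deriv_C T u)"
proof -
  obtain N where N: "N \<in> null_sets lborel" "\<forall>A\<in>sets borel. deriv_C T u A = nu (A \<inter> N - J)"
    using deriv_C_ex by blast
  have "cadd (\<lambda>A. nu (A \<inter> N - J))"
    using cadd_restrict[OF cadd_nuJ, of N] N(1) by auto
  then show ?thesis by (rule cadd_cong) (use N in auto)
qed

abbreviation mu :: "real measure" where "mu \<equiv> mu_measure T u"
abbreviation VC :: "real measure" where "VC \<equiv> vm_variation (deriv_C T u)"

lemma sets_mu [simp, measurable_cong]: "sets mu = sets borel"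
  unfolding mu_measure_def by (metis sets.sets_measure_of_eq space_borel)

lemma space_mu [simp]: "space mu = UNIV"
  unfolding mu_measure_def by simp

lemma emeasure_mu:
  assumes "A \<in> sets borel"
  shows "emeasure mu A = emeasure lborel (A \<inter> {0..T}) + emeasure VC A"
proof -
  let ?f = "\<lambda>A. emeasure lborel (A \<inter> {0..T}) + emeasure VC A"
  have "countably_additive (sets borel) ?f"
    unfolding countably_additive_def
  proof (intro allI impI)
    fix A :: "nat \<Rightarrow> real set" assume A: "range A \<subseteq> sets borel" "disjoint_family A"
    have "disjoint_family (\<lambda>n. A n \<inter> {0..T})" using A(2) unfolding disjoint_family_on_def by blast
    then have "(\<Sum>n. emeasure lborel (A n \<inter> {0..T})) = emeasure lborel (\<Union>n. A n \<inter> {0..T})"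
      using A by (intro suminf_emeasure) auto
    moreover have "(\<Sum>n. emeasure VC (A n)) = emeasure VC (\<Union>n. A n)"
      using A by (intro suminf_emeasure) auto
    moreover have "(\<Union>n. A n \<inter> {0..T}) = (\<Union>n. A n) \<inter> {0..T}" by auto
    ultimately show "(\<Sum>n. ?f (A n)) = ?f (\<Union>n. A n)" by (simp add: suminf_add[symmetric])
  qed
  moreover have "positive (sets borel) ?f" by (simp add: positive_def)
  moreover have "sigma_algebra UNIV (sets (borel::real measure))" using sets.sigma_algebra_axioms[of borel] by simp
  ultimately show ?thesis unfolding mu_measure_def using assms by (intro emeasure_measure_of_sigma)
qed

lemma finite_mu: "finite_measure mu"
proof (rule finite_measureI)
  interpret V: finite_measure VC by (rule finite_vm_variation[OF cadd_deriv_C])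
  show "emeasure mu (space mu) \<noteq> \<infinity>"
    using T V.emeasure_finite[of UNIV] by (simp add: emeasure_mu)
qed

lemma null_mu_lborel: "A \<in> null_sets mu \<Longrightarrow> A \<inter> {0..T} \<in> null_sets lborel"
  by (auto simp: null_sets_def emeasure_mu)

text \<open>\<mu> is at least Lebesgue measure on [0,T]; this turns the inclusion into
  stability.\<close>

lemma AE_mu_lborel:
  assumes "AE t in mu. P t" shows "AE t in lborel. t \<in> {0..T} \<longrightarrow> P t"
proof -
  obtain A where A: "{x \<in> space mu. \<not> P x} \<subseteq> A" "A \<in> null_sets mu"
    using AE_E[OF assms] by (metis null_setsI)
  have "{t. \<not> (t \<in> {0..T} \<longrightarrow> P t)} \<subseteq> A \<inter> {0..T}" using A by auto
  then show ?thesis using null_mu_lborel[OF A(2)] by (intro AE_I'[of "A \<inter> {0..T}"]) auto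
qed

lemma deriv_C_J: "A \<in> sets borel \<Longrightarrow> A \<subseteq> J \<Longrightarrow> deriv_C T u A = 0"
proof -
  assume A: "A \<in> sets borel" "A \<subseteq> J"
  obtain N where N: "\<forall>A\<in>sets borel. deriv_C T u A = nu (A \<inter> N - J)" using deriv_C_ex by blast
  have "A \<inter> N - J = {}" using A by auto
  then have "nu (A \<inter> N - J) = 0" using cadd_empty[OF cadd_nu] by (simp only:)
  then show ?thesis using N A by simp
qed

lemma deriv_C_point: "A \<subseteq> {t} \<Longrightarrow> deriv_C T u A = 0"
proof -
  assume A: "A \<subseteq> {t}"
  then have Ab: "A \<in> sets borel" using subset_singletonD by fastforce
  obtain N where N: "\<forall>A\<in>sets borel. deriv_C T u A = nu (A \<inter> N - J)" using deriv_C_ex by blast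
  have "A \<inter> N - J = {} \<or> (A \<inter> N - J = {t} \<and> t \<notin> J)" using A by auto
  then have "nu (A \<inter> N - J) = 0" using cadd_empty[OF cadd_nu] nu_point[of t] by (metis (no_types))
  then show ?thesis using N Ab by simp
qed

text \<open>\<open>J\<close> is countable, hence Lebesgue null, and the Cantor part vanishes on its
  subsets. The values of the density at jump times are thus immaterial.\<close>

lemma mu_J: "J \<in> null_sets mu"
proof -
  have "J \<inter> {0..T} \<in> null_sets lborel" using null_set_Int1[OF J_null, of "{0..T}"] by (simp add: Int_commute)
  moreover have "emeasure VC J = 0"
    by (simp add: emeasure_vm_variation[OF cadd_deriv_C] vvar_zero deriv_C_J)
  ultimately show ?thesis by (auto simp: null_sets_def emeasure_mu)
qed

lemma mu_point: "{t} \<in> null_sets mu"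
proof -
  have "emeasure lborel ({t} \<inter> {0..T}) = 0"
    using emeasure_mono[of "{t} \<inter> {0..T}" "{t}" lborel] by simp
  moreover have "emeasure VC {t} = 0"
    by (simp add: emeasure_vm_variation[OF cadd_deriv_C] vvar_zero deriv_C_point)
  ultimately show ?thesis by (auto simp: null_sets_def emeasure_mu)
qed

text \<open>Absolute continuity of the diffuse derivative, which makes the chosen density
  meaningful. On the singular carrier \<open>N\<close> the derivative off \<open>J\<close> is the
  Cantor part, and off \<open>N\<close> it vanishes on Lebesgue null sets.\<close>

lemma nuJ_null:
  assumes A: "A \<in> null_sets mu" shows "nu (A - J) = 0"
proof -
  obtain N where N: "N \<in> null_sets lborel" "\<forall>A\<in>null_sets lborel. nu (A - N) = 0"
    "\<forall>A\<in>sets borel. deriv_C T u A = nu (A \<inter> N - J)" using deriv_C_ex by blast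
  have Ab: "A \<in> sets borel" and Nb: "N \<in> sets borel" using A N by auto
  have "emeasure VC A = 0" using A by (auto simp: null_sets_def emeasure_mu)
  then have "deriv_C T u A = 0"
    using norm_le_measure_variation[OF cadd_deriv_C Ab] by (simp add: measure_def)
  then have 1: "nu (A \<inter> N - J) = 0" using N(3) Ab by simp
  \<comment> \<open>Outside [0,T] a \<mu>-null set may have positive Lebesgue measure, so the set is
    first cut down to (0,T), which carries \<open>nu\<close>.\<close>
  have Ab': "A \<inter> {0<..<T} - J \<in> sets borel" using Ab by auto
  have "A \<inter> {0<..<T} - J \<in> null_sets lborel"
    by (rule null_sets_subset[OF null_mu_lborel[OF A]]) (use Ab' in auto)
  then have "nu ((A \<inter> {0<..<T} - J) - N) = 0" using N(2) by blast
  moreover have "(A \<inter> {0<..<T} - J) - N = (A - J - N) \<inter> {0<..<T}" by auto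
  ultimately have 2: "nu (A - J - N) = 0" using nu_carrier[of "A - J - N"] Ab Nb by simp
  have "(A - J) \<inter> N = A \<inter> N - J" by auto
  then show ?thesis using cadd_split[OF cadd_nu, of "A - J" N] Ab Nb 1 2 by simp
qed

abbreviation h :: "real \<Rightarrow> 'a" where "h \<equiv> co_density T u"

lemma integrable_h: "integrable mu h"
  and h_integral: "A \<in> sets borel \<Longrightarrow> nu (A - J) = (LINT t:A|mu. h t)"
proof -
  have c: "cadd (deriv_co T u)" by (rule cadd_cong[OF cadd_nuJ deriv_co_eq])
  have z: "deriv_co T u A = 0" if "A \<in> null_sets mu" for A
  proof -
    have "A \<in> sets borel" using that by auto
    then show ?thesis using nuJ_null[OF that] by (simp add: deriv_co_eq)
  qed
  note props = vm_density_props[OF c finite_mu sets_mu z]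
  show "integrable mu h" unfolding co_density_def by (rule props(1))
  show "nu (A - J) = (LINT t:A|mu. h t)" if "A \<in> sets borel"
    using props(2)[OF _ that] that unfolding co_density_def by (simp add: deriv_co_eq)
qed

end

section \<open>The chain rule\<close>

locale C1_energy =
  fixes T :: real and E dtE :: "real \<Rightarrow> 'a::real_normed_vector \<Rightarrow> real" and DE :: "real \<Rightarrow> 'a \<Rightarrow> ('a \<Rightarrow>\<^sub>L real)"
  assumes E_deriv: "t \<in> {0..T} \<Longrightarrow>
      ((\<lambda>(s, y). E s y) has_derivative (\<lambda>(s, y). s * dtE t x + blinfun_apply (DE t x) y))
        (at (t, x) within {0..T} \<times> UNIV)"
    and dtE_cont: "continuous_on ({0..T} \<times> UNIV) (\<lambda>(s, y). dtE s y)"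
    and DE_cont: "continuous_on ({0..T} \<times> UNIV) (\<lambda>(s, y). DE s y)"
begin

lemma E_cont: "continuous_on ({0..T} \<times> UNIV) (\<lambda>(s, y). E s y)"
  unfolding continuous_on_eq_continuous_within
proof safe
  fix t x assume "t \<in> {0..T}"
  then show "continuous (at (t, x) within {0..T} \<times> UNIV) (\<lambda>(s, y). E s y)"
    using E_deriv has_derivative_continuous by blast
qed

text \<open>Mean value inequality for the energy minus an affine function with frozen slopes
  \<open>p\<close> and \<open>l\<close>; time and space each contribute \<open>e\<close> to the norm
  of the derivative. With zero slopes this is a Lipschitz estimate.\<close>

lemma E_linearization:
  fixes p :: real and l :: "'a \<Rightarrow>\<^sub>L real"
  assumes S: "convex S" "S \<subseteq> {0..T} \<times> UNIV"
    and e: "\<And>s y. (s, y) \<in> S \<Longrightarrow> \<bar>dtE s y - p\<bar> \<le> e \<and> norm (DE s y - l) \<le> e"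
    and in_S: "(s, y) \<in> S" "(s', y') \<in> S"
  shows "\<bar>E s y - E s' y' - p * (s - s') - l (y - y')\<bar> \<le> 2 * e * (\<bar>s - s'\<bar> + norm (y - y'))"
proof -
  let ?f = "\<lambda>z. (case z of (s, y) \<Rightarrow> E s y) - p * fst z - l (snd z)"
  let ?f' = "\<lambda>z w. fst w * (dtE (fst z) (snd z) - p) + (DE (fst z) (snd z) - l) (snd w)"
  have e0: "e \<ge> 0" using e[OF in_S(1)] by (auto intro: order_trans[OF abs_ge_zero])
  have "norm (?f (s, y) - ?f (s', y')) \<le> 2 * e * norm ((s, y) - (s', y'))"
  proof (rule differentiable_bound[OF S(1)])
    fix z assume z: "z \<in> S"
    obtain t x where tx: "z = (t, x)" by (cases z)
    have t: "t \<in> {0..T}" using z S(2) tx by auto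
    have "((\<lambda>z. (case z of (s, y) \<Rightarrow> E s y)) has_derivative (\<lambda>(s, y). s * dtE t x + blinfun_apply (DE t x) y)) (at z within S)"
      using E_deriv[OF t, of x] has_derivative_subset[OF _ S(2)] unfolding tx by blast
    then have "(?f has_derivative (\<lambda>w. (case w of (s, y) \<Rightarrow> s * dtE t x + blinfun_apply (DE t x) y) - p * fst w - l (snd w))) (at z within S)"
      by (intro has_derivative_diff has_derivative_mult_right has_derivative_fst has_derivative_snd has_derivative_ident
        bounded_linear.has_derivative[OF blinfun.bounded_linear_right])
    moreover have "(\<lambda>w. (case w of (s, y) \<Rightarrow> s * dtE t x + blinfun_apply (DE t x) y) - p * fst w - l (snd w)) = ?f' z"
      by (auto simp: tx fun_eq_iff algebra_simps blinfun.diff_left)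
    ultimately show "(?f has_derivative ?f' z) (at z within S)" by simp
    show "onorm (?f' z) \<le> 2 * e"
    proof (rule onorm_bound)
      fix w :: "real \<times> 'a"
      have b: "\<bar>dtE t x - p\<bar> \<le> e" "norm (DE t x - l) \<le> e" using e z tx by auto
      have "norm (?f' z w) \<le> \<bar>fst w\<bar> * \<bar>dtE t x - p\<bar> + norm (DE t x - l) * norm (snd w)"
        unfolding tx using norm_blinfun[of "DE t x - l" "snd w"]
        by (simp add: abs_mult[symmetric])
      also have "\<dots> \<le> norm w * e + e * norm w"
        using b norm_fst_le[of "fst w" "snd w"] norm_snd_le[of "snd w" "fst w"] e0
        by (intro add_mono mult_mono) auto
      finally show "norm (?f' z w) \<le> 2 * e * norm w" by simp
    qed (use e0 in simp)
  qed (rule in_S)+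
  also have "\<dots> \<le> 2 * e * (\<bar>s - s'\<bar> + norm (y - y'))"
    using e0 norm_Pair_le[of "s - s'" "y - y'"] by (intro mult_left_mono) auto
  finally show ?thesis by (simp add: algebra_simps blinfun.diff_right)
qed

end

lemma fin_coords_compact_strip:
  assumes "fin_coords (B :: 'a::{banach,second_countable_topology} set) c"
  shows "compact ({0..T::real} \<times> cball (0::'a) R)"
  using fin_coords.compact_cball_fin[OF assms] by (intro compact_Times) auto

lemma C1_energy_bound:
  assumes "fin_coords (B :: 'a::{banach,second_countable_topology} set) c" "C1_energy T E dtE (DE :: real \<Rightarrow> 'a \<Rightarrow> _)"
  shows "\<exists>L\<ge>0. \<forall>t\<in>{0..T}. \<forall>x. norm x \<le> R \<longrightarrow> \<bar>dtE t x\<bar> \<le> L \<and> norm (DE t x) \<le> L"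
proof -
  interpret C1_energy T E dtE DE by fact
  have sub: "{0..T} \<times> cball (0::'a) R \<subseteq> {0..T} \<times> UNIV" by auto
  have "bounded ((\<lambda>(s, y). dtE s y) ` ({0..T} \<times> cball (0::'a) R))"
    by (intro compact_imp_bounded compact_continuous_image continuous_on_subset[OF dtE_cont sub] fin_coords_compact_strip[OF assms(1)])
  moreover have "bounded ((\<lambda>(s, y). DE s y) ` ({0..T} \<times> cball (0::'a) R))"
    by (intro compact_imp_bounded compact_continuous_image continuous_on_subset[OF DE_cont sub] fin_coords_compact_strip[OF assms(1)])
  ultimately obtain L1 L2 where L: "\<And>z. z \<in> {0..T} \<times> cball (0::'a) R \<Longrightarrow> norm (case z of (s, y) \<Rightarrow> dtE s y) \<le> L1"
    "\<And>z. z \<in> {0..T} \<times> cball (0::'a) R \<Longrightarrow> norm (case z of (s, y) \<Rightarrow> DE s y) \<le> L2"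
    unfolding bounded_iff by (meson imageI)
  show ?thesis
  proof (intro exI[of _ "max 0 (max L1 L2)"] conjI ballI allI impI)
    fix t x assume "t \<in> {0..T}" "norm (x::'a) \<le> R"
    then have "(t, x) \<in> {0..T} \<times> cball 0 R" by simp
    from L[OF this] show "\<bar>dtE t x\<bar> \<le> max 0 (max L1 L2)" "norm (DE t x) \<le> max 0 (max L1 L2)" by auto
  qed simp
qed

section \<open>The energy along a BV curve\<close>

locale energy_curve = bv_curve B c T u V M + C1_energy T E dtE DE
  for B :: "'a::{banach,second_countable_topology} set" and c T u V M
    and E dtE :: "real \<Rightarrow> 'a \<Rightarrow> real" and DE +
  fixes L :: real
  assumes L: "L \<ge> 0" "t \<in> {0..T} \<Longrightarrow> norm x \<le> norm (u 0) + M \<Longrightarrow> \<bar>dtE t x\<bar> \<le> L \<and> norm (DE t x) \<le> L"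
begin

definition F :: "real \<Rightarrow> real" where "F t = E (clamp T t) (uc t)"

lemma F_dom: "a \<le> b \<Longrightarrow> \<bar>F b - F a\<bar> \<le> 2 * L * (W b - W a)"
proof -
  assume ab: "a \<le> b"
  have "\<bar>E (clamp T b) (uc b) - E (clamp T a) (uc a) - 0 * (clamp T b - clamp T a) - (0 :: 'a \<Rightarrow>\<^sub>L real) (uc b - uc a)\<bar>
     \<le> 2 * L * (\<bar>clamp T b - clamp T a\<bar> + norm (uc b - uc a))"
  proof (rule E_linearization)
    show "convex ({0..T} \<times> cball (0::'a) (norm (u 0) + M))" by (intro convex_Times) auto
  qed (use L(2) clamp_in[OF T] bounded_uc in auto)
  also have "\<dots> \<le> 2 * L * (W b - W a)"
    using dom_uc[OF ab] clamp_mono[OF ab, of T] L(1) by (intro mult_left_mono) auto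
  finally show ?thesis by (simp add: F_def)
qed

text \<open>The energy along the curve is itself dominated by a multiple of \<open>W\<close>, so it
  has one-sided limits and a Stieltjes measure by the results for curves.\<close>

sublocale F: bvf_coords F "\<lambda>t. 2 * L * W t" "2 * L * (T + M)" "{1::real}" "\<lambda>_ x. x"
proof -
  interpret fr: fin_coords "{1::real}" "\<lambda>_ x. x" by (rule fin_coords_real)
  show "bvf_coords F (\<lambda>t. 2 * L * W t) (2 * L * (T + M)) {1::real} (\<lambda>_ x. x)"
  proof
    show "norm (F b - F a) \<le> 2 * L * W b - 2 * L * W a" if "a \<le> b" for a b
      using F_dom[OF that] by (simp add: algebra_simps)
    show "\<bar>2 * L * W t\<bar> \<le> 2 * L * (T + M)" for t
      using L(1) bd_W[of t] by (simp add: abs_mult mult_left_mono)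
  qed
qed

lemma tendsto_strip:
  assumes f: "continuous_on ({0..T} \<times> UNIV) (\<lambda>(s, y). f s (y::'a) :: 'b::topological_space)"
    and t: "t \<in> {0..T}" and G: "(clamp T \<longlongrightarrow> t) G" "(uc \<longlongrightarrow> x) G"
  shows "((\<lambda>s. f (clamp T s) (uc s)) \<longlongrightarrow> f t x) G"
proof -
  have "((\<lambda>s. (case (clamp T s, uc s) of (s, y) \<Rightarrow> f s y)) \<longlongrightarrow> (case (t, x) of (s, y) \<Rightarrow> f s y)) G"
    by (rule continuous_on_tendsto_compose[OF f tendsto_Pair[OF G]]) (use t clamp_in[OF T] in auto)
  then show ?thesis by simp
qed

lemma clamp_tendsto: "t \<in> {0..T} \<Longrightarrow> (clamp T \<longlongrightarrow> t) (at t within S)"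
proof -
  assume t: "t \<in> {0..T}"
  have "continuous_on UNIV (clamp T)" unfolding clamp_def by (intro continuous_intros)
  then have "(clamp T \<longlongrightarrow> clamp T t) (at t within S)"
    using continuous_on_eq_continuous_within[of UNIV] continuous_within_subset[of t UNIV "clamp T" S]
    by (auto simp: continuous_within)
  then show ?thesis using clamp_id[OF t] by simp
qed

lemma rlim_F: "t \<in> {0..T} \<Longrightarrow> rlim F t = E t (rlim uc t)"
  unfolding F_def[abs_def] by (intro tendsto_Lim tendsto_strip[OF E_cont] clamp_tendsto u_rlim) auto

lemma llim_F: "t \<in> {0..T} \<Longrightarrow> llim F t = E t (llim uc t)"
  unfolding F_def[abs_def] by (intro tendsto_Lim tendsto_strip[OF E_cont] clamp_tendsto u_llim) auto

lemma borel_clamp [measurable]: "clamp T \<in> borel_measurable borel"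
  unfolding clamp_def[abs_def] by measurable

lemma borel_strip:
  assumes f: "continuous_on ({0..T} \<times> UNIV) (\<lambda>(s, y). f s (y::'a) :: real)"
  shows "(\<lambda>t. f (clamp T t) (uc t)) \<in> borel_measurable borel"
proof -
  let ?S = "{0..T} \<times> (UNIV :: 'a set)"
  have 1: "(\<lambda>z. indicator ?S z *\<^sub>R (case z of (s, y) \<Rightarrow> f s y)) \<in> borel_measurable borel"
    by (rule borel_measurable_continuous_on_indicator[OF _ f]) (auto intro!: borel_closed closed_Times)
  have "(\<lambda>t. (clamp T t, uc t)) \<in> borel_measurable borel" by measurable
  from measurable_compose[OF this 1] show ?thesis using clamp_in[OF T] by simp
qed

text \<open>The indicator makes the time derivative integrable on the line; the companion
  \<open>g2\<close> is integrated against a finite measure.\<close>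

definition g1 :: "real \<Rightarrow> real" where "g1 s = indicator {0..T} s * dtE (clamp T s) (uc s)"
definition g2 :: "real \<Rightarrow> real" where "g2 t = blinfun_apply (DE (clamp T t) (uc t)) (h t)"

lemma bound_strip: "\<bar>dtE (clamp T t) (uc t)\<bar> \<le> L" "norm (DE (clamp T t) (uc t)) \<le> L"
  using L(2)[OF clamp_in[OF T] bounded_uc] by auto

lemma integrable_ind: "integrable lborel (indicat_real {0..T})"
  by (rule integrable_real_indicator) (use T in auto)

lemma integrable_g1: "integrable lborel g1"
proof (rule Bochner_Integration.integrable_bound)
  show "integrable lborel (\<lambda>s. indicator {0..T} s * L)" using integrable_ind by simp
  show "g1 \<in> borel_measurable lborel" unfolding g1_def[abs_def] using borel_strip[OF dtE_cont] by measurable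
  show "AE s in lborel. norm (g1 s) \<le> norm (indicator {0..T} s * L)"
    using bound_strip L(1) by (intro AE_I2) (auto simp: g1_def split: split_indicator)
qed

lemma borel_h [measurable]: "h \<in> borel_measurable borel"
  using borel_measurable_integrable[OF integrable_h] by simp

lemma integrable_g2: "integrable mu g2"
proof (rule Bochner_Integration.integrable_bound)
  show "integrable mu (\<lambda>t. L * norm (h t))" using integrable_norm[OF integrable_h] by simp
  show "AE t in mu. norm (g2 t) \<le> norm (L * norm (h t))"
  proof (rule AE_I2)
    fix t
    have "norm (g2 t) \<le> norm (DE (clamp T t) (uc t)) * norm (h t)" unfolding g2_def by (rule norm_blinfun)
    also have "\<dots> \<le> L * norm (h t)" by (intro mult_right_mono bound_strip) auto
    finally show "norm (g2 t) \<le> norm (L * norm (h t))" using L(1) by simp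
  qed
  \<comment> \<open>Measurability is read off a finite sum of products: the differential is paired
    with fixed basis vectors, which gives real functions continuous in time and state.\<close>
  have "g2 = (\<lambda>t. \<Sum>b\<in>B. c b (h t) * blinfun_apply (DE (clamp T t) (uc t)) b)"
  proof
    fix t
    have "g2 t = blinfun_apply (DE (clamp T t) (uc t)) (\<Sum>b\<in>B. c b (h t) *\<^sub>R b)" by (simp add: g2_def c_sum)
    then show "g2 t = (\<Sum>b\<in>B. c b (h t) * blinfun_apply (DE (clamp T t) (uc t)) b)"
      by (simp add: blinfun.sum_right blinfun.scaleR_right)
  qed
  moreover have "(\<lambda>t. c b (h t) * blinfun_apply (DE (clamp T t) (uc t)) b) \<in> borel_measurable borel" if b: "b \<in> B" for b
  proof -
    have "continuous_on ({0..T} \<times> UNIV) (\<lambda>z. blinfun_apply (case z of (s, y) \<Rightarrow> DE s y) b)"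
      using DE_cont by (intro continuous_intros)
    then have [measurable]: "(\<lambda>t. blinfun_apply (DE (clamp T t) (uc t)) b) \<in> borel_measurable borel"
      by (intro borel_strip) (simp add: case_prod_unfold)
    have [measurable]: "c b \<in> borel_measurable borel"
      by (intro borel_measurable_continuous_onI linear_continuous_on c_bl b)
    show ?thesis by measurable
  qed
  ultimately show "g2 \<in> borel_measurable mu" by simp
qed

section \<open>The defect of the diffuse chain rule and its local smallness\<close>

definition kappa :: "real set \<Rightarrow> real" where
  "kappa A = F.nu0 (A - J) - (LINT s:A|lborel. g1 s) - (LINT t:A|mu. g2 t)"

lemma cadd_kappa: "cadd kappa"
  unfolding kappa_def[abs_def]
  by (intro cadd_diff cadd_restrict_diff F.cadd_nu0 J_borel cadd_set_integral integrable_g1 integrable_g2) auto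

lemma set_integral_null_set:
  fixes f :: "real \<Rightarrow> real"
  assumes "A \<in> null_sets N" shows "(LINT t:A|N. f t) = 0"
proof -
  have "AE t in N. indicator A t *\<^sub>R f t = 0" by (rule AE_I'[OF assms]) (auto split: split_indicator)
  then show ?thesis unfolding set_lebesgue_integral_def by (rule integral_eq_zero_AE)
qed

lemma lborel_singleton_null: "{s::real} \<in> null_sets lborel"
  by (rule countable_imp_null_set_lborel) simp

lemma kappa_point: "s \<in> {0..T} \<Longrightarrow> kappa {s} = 0"
proof -
  assume s: "s \<in> {0..T}"
  have "F.nu0 ({s} - J) = 0"
  proof (cases "s \<in> J")
    case False
    then have "rlim F s = llim F s" using rlim_F[OF s] llim_F[OF s] J_iff s by simp
    moreover have "{s} - J = {s}" using False by auto
    ultimately show ?thesis using F.nu0_point[of s] by simp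
  qed (simp add: cadd_empty[OF F.cadd_nu0])
  then show ?thesis using set_integral_null_set[OF lborel_singleton_null] set_integral_null_set[OF mu_point] by (simp add: kappa_def)
qed

text \<open>Measures the error made in the \<mu>-integral when the differential of the energy is
  replaced by a constant functional.\<close>

definition q :: "real set \<Rightarrow> real" where "q A = (LINT t:A|mu. norm (h t))"

lemma cadd_q: "cadd q"
  unfolding q_def[abs_def] by (intro cadd_set_integral integrable_norm integrable_h) simp

lemma q_nonneg: "q A \<ge> 0"
  unfolding q_def set_lebesgue_integral_def by (intro integral_nonneg_AE) (auto split: split_indicator)

text \<open>The variation enters both as \<open>(a,b]\<close> and as \<open>[a,b)\<close>, so that an interval with an endpoint at a
  jump point still has at least the weight of the jump.\<close>

definition H :: "real \<Rightarrow> real" where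
  "H t = measure (smeas W) {..t} + measure (smeas W) {..<t} + q {..t}"

lemma H_diff:
  assumes "a < b"
  shows "H b - H a = measure (smeas W) {a<..b} + measure (smeas W) {a..<b} + q {a<..b}"
proof -
  have m: "cadd (measure (smeas W))" by (rule cadd_measure[OF finite_smeas_W]) simp
  have "{a<..b} = {..b} - {..a}" "{a..<b} = {..<b} - {..<a}" by auto
  then show ?thesis using assms cadd_Diff[OF m, of "{..b}" "{..a}"] cadd_Diff[OF m, of "{..<b}" "{..<a}"]
    cadd_Diff[OF cadd_q, of "{..b}" "{..a}"] by (auto simp: H_def)
qed

text \<open>Inside (0,T] the two measures can differ only by an atom at \<open>T\<close>, which
  either belongs to \<open>J\<close> or is zero.\<close>

lemma nu0_nu:
  assumes A: "A \<in> sets borel" "A \<subseteq> {0<..T}" shows "nu0 (A - J) = nu (A - J)"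
proof -
  have "A - J - {T} = (A - J) \<inter> {0<..<T}" using A by auto
  then have 1: "nu0 (A - J - {T}) = nu (A - J)" using A by (simp add: nu_def)
  have "(A - J) \<inter> {T} = {} \<or> ((A - J) \<inter> {T} = {T} \<and> T \<notin> J)" by auto
  then have "nu0 ((A - J) \<inter> {T}) = 0"
  proof
    assume *: "(A - J) \<inter> {T} = {T} \<and> T \<notin> J"
    then have "nu0 {T} = 0" using nu0_point[of T] J_iff[of T] T by simp
    then show ?thesis using * by (simp only:)
  qed (simp only: cadd_empty[OF cadd_nu0])
  then show ?thesis using cadd_split[OF cadd_nu0, of "A - J" "{T}"] A 1 by simp
qed

lemma local_jump:
  assumes s: "s \<in> J" and e: "e > 0"
  shows "\<exists>d>0. \<forall>a b. a \<le> s \<and> s \<le> b \<and> b - a < d \<longrightarrow> \<bar>kappa {a<..b}\<bar> \<le> e * (H b - H a)"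
proof -
  have sT: "s \<in> {0..T}" using s J_iff by auto
  \<comment> \<open>Both one-sided gaps are used: at an isolated excursion with u(s-) = u(s+)
    \<noteq> u(s) the measure of the curve has no atom, but that of \<open>W\<close> has
    one.\<close>
  have pos: "measure (smeas W) {s} > 0"
    using s J_iff[of s] dom_right[of s] dom_left[of s] uc_id[OF sT] smeas_W_point[of s]
      norm_ge_zero[of "rlim uc s - uc s"] norm_ge_zero[of "uc s - llim uc s"]
    by (smt (verit) norm_eq_zero eq_iff_diff_eq_0)
  let ?V = "vm_variation kappa"
  interpret V: finite_measure ?V by (rule F.finite_vm_variation[OF cadd_kappa])
  interpret mW: finite_measure "smeas W" by (rule finite_smeas_W)
  \<comment> \<open>These punctured neighbourhoods decrease to the empty set, so the variation of
    \<open>kappa\<close> on them tends to zero; \<open>kappa\<close> has no mass at \<open>s\<close>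
    itself.\<close>
  let ?C = "\<lambda>n. {s - step n..s + step n} - {s}"
  have dec: "decseq step" by (intro decseq_SucI less_imp_le step_Suc)
  have "(\<lambda>n. measure ?V (?C n)) \<longlonglongrightarrow> measure ?V (\<Inter>n. ?C n)"
  proof (rule V.finite_Lim_measure_decseq)
    show "decseq ?C" using dec unfolding decseq_def by (force intro: order_trans)
  qed auto
  moreover have "(\<Inter>n. ?C n) = {}"
  proof -
    have False if x: "x \<in> (\<Inter>n. ?C n)" for x
    proof -
      have "\<bar>x - s\<bar> \<le> 0"
        by (rule LIMSEQ_le_const[OF step_tendsto]) (use x in \<open>auto simp: abs_le_iff algebra_simps\<close>)
      then show False using x by auto
    qed
    then show ?thesis by blast
  qed
  then have "measure ?V (\<Inter>n. ?C n) = 0" by (simp only: measure_empty)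
  ultimately have lim0: "(\<lambda>n. measure ?V (?C n)) \<longlonglongrightarrow> 0" by (simp only:)
  have "\<forall>\<^sub>F n in sequentially. measure ?V (?C n) < e * measure (smeas W) {s}"
    by (rule order_tendstoD(2)[OF lim0]) (use e pos in simp)
  then obtain n where n: "measure ?V (?C n) < e * measure (smeas W) {s}" by (auto simp: eventually_sequentially)
  show ?thesis
  proof (intro exI[of _ "step n"] conjI step_pos allI impI, elim conjE)
    fix a b assume ab: "a \<le> s" "s \<le> b" "b - a < step n"
    show "\<bar>kappa {a<..b}\<bar> \<le> e * (H b - H a)"
    proof (cases "a < b")
      case True
      have "kappa ({a<..b} \<inter> {s}) = 0" using kappa_point[OF sT] cadd_empty[OF cadd_kappa] by (cases "s \<in> {a<..b}") auto
      then have "\<bar>kappa {a<..b}\<bar> = \<bar>kappa ({a<..b} - {s})\<bar>" using cadd_split[OF cadd_kappa, of "{a<..b}" "{s}"] by simp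
      also have "\<dots> \<le> measure ?V ({a<..b} - {s})" using F.norm_le_measure_variation[OF cadd_kappa, of "{a<..b} - {s}"] by simp
      also have "\<dots> \<le> measure ?V (?C n)" using ab by (intro V.finite_measure_mono) auto
      also have "\<dots> \<le> e * measure (smeas W) {s}" using n by simp
      also have "\<dots> \<le> e * (H b - H a)"
      proof (intro mult_left_mono)
        have "measure (smeas W) {s} \<le> measure (smeas W) {a<..b} + measure (smeas W) {a..<b}"
        proof (cases "a < s")
          case True
          then have "measure (smeas W) {s} \<le> measure (smeas W) {a<..b}" using ab by (intro mW.finite_measure_mono) auto
          then show ?thesis by (simp add: add_increasing2)
        next
          case False
          then have "measure (smeas W) {s} \<le> measure (smeas W) {a..<b}" using ab \<open>a < b\<close> by (intro mW.finite_measure_mono) auto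
          then show ?thesis by (simp add: add_increasing)
        qed
        then show "measure (smeas W) {s} \<le> H b - H a" using H_diff[OF True] q_nonneg[of "{a<..b}"] by simp
      qed (use e in simp)
      finally show ?thesis .
    next
      case False
      then have "a = b" using ab by simp
      then show ?thesis using cadd_empty[OF cadd_kappa] by simp
    qed
  qed
qed

lemma set_integral_le:
  fixes f g :: "real \<Rightarrow> real"
  assumes f: "integrable N f" and g: "integrable N g" and A: "A \<in> sets N"
    and le: "\<And>t. t \<in> A \<Longrightarrow> \<bar>f t\<bar> \<le> g t"
  shows "\<bar>LINT t:A|N. f t\<bar> \<le> (LINT t:A|N. g t)"
proof -
  have "norm (LINT t|N. indicator A t *\<^sub>R f t) \<le> (LINT t|N. norm (indicator A t *\<^sub>R f t))"
    by (rule integral_norm_bound)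
  also have "\<dots> \<le> (LINT t|N. indicator A t *\<^sub>R g t)"
    using integrable_mult_indicator[OF A f] integrable_mult_indicator[OF A g] le
    by (intro integral_mono integrable_norm) (auto split: split_indicator)
  finally show ?thesis by (simp add: set_lebesgue_integral_def)
qed

definition lam :: "real set \<Rightarrow> real" where "lam A = (LINT s:A|lborel. indicator {0..T} s)"

lemma cadd_lam: "cadd lam"
  unfolding lam_def[abs_def] by (intro cadd_set_integral integrable_ind) simp

lemma lam_Ioc: "0 \<le> a \<Longrightarrow> a \<le> b \<Longrightarrow> b \<le> T \<Longrightarrow> lam {a<..b} = b - a"
proof -
  assume ab: "0 \<le> a" "a \<le> b" "b \<le> T"
  have "lam {a<..b} = (LINT s|lborel. indicator {a<..b} s)"
    unfolding lam_def set_lebesgue_integral_def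
    by (rule Bochner_Integration.integral_cong) (use ab in \<open>auto split: split_indicator\<close>)
  then show ?thesis using ab by simp
qed

lemma Ioc_le_W: "0 \<le> a \<Longrightarrow> a \<le> b \<Longrightarrow> b \<le> T \<Longrightarrow> b - a \<le> rlim W b - rlim W a"
proof -
  assume ab: "0 \<le> a" "a \<le> b" "b \<le> T"
  have cl: "(\<lambda>n. clamp T (t + step n)) \<longlonglongrightarrow> t" if "t \<in> {0..T}" for t
    using filterlim_compose[OF clamp_tendsto[OF that] filterlim_step_right] .
  show ?thesis
  proof (rule LIMSEQ_le[OF tendsto_diff[OF cl cl] tendsto_diff[OF W_rlim_seq W_rlim_seq]])
    show "\<exists>N. \<forall>n\<ge>N. clamp T (b + step n) - clamp T (a + step n) \<le> W (b + step n) - W (a + step n)"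
      using dom_uc[of "a + step n" "b + step n" for n] ab
      by (intro exI[of _ 0] allI impI) (smt (verit) norm_ge_zero)
  qed (use ab in auto)
qed

text \<open>The slopes of the energy are frozen at (s, u(s)). The constant 5 collects two units for
  the linearization error on the interval, two for removing its jumps from that error, and one for
  the time integral; the \<mu>-integral costs one unit of \<open>q\<close>.\<close>

lemma local_regular:
  assumes s: "s \<in> {0..T}" "s \<notin> J" and e: "e > 0"
  shows "\<exists>d>0. \<forall>a b. a \<le> s \<and> s \<le> b \<and> b - a < d \<longrightarrow> 0 \<le> a \<and> b \<le> T \<longrightarrow> \<bar>kappa {a<..b}\<bar> \<le> 5 * e * (H b - H a)"
proof -
  define p where "p = dtE s (u s)"
  define l where "l = DE s (u s)"
  have cont_uc: "isCont uc s" using isCont_of_no_jump[of s] s J_iff uc_id by simp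
  have uct: "(uc \<longlongrightarrow> u s) (at s)" using cont_uc uc_id[OF s(1)] by (simp add: isCont_def)
  obtain d where d: "d > 0" and near: "\<And>t. \<bar>t - s\<bar> < d \<Longrightarrow>
      \<bar>dtE (clamp T t) (uc t) - p\<bar> \<le> e \<and> norm (DE (clamp T t) (uc t) - l) \<le> e"
    and PhiW: "\<And>x y. \<bar>x - s\<bar> < d \<Longrightarrow> \<bar>y - s\<bar> < d \<Longrightarrow> x \<le> y \<Longrightarrow>
      \<bar>(F y - p * clamp T y - l (uc y)) - (F x - p * clamp T x - l (uc x))\<bar> \<le> 2 * e * (W y - W x)"
  proof -
    have ins: "(s, u s) \<in> {0..T} \<times> UNIV" using s by auto
    obtain r1 where r1: "r1 > 0" "\<And>z. z \<in> {0..T} \<times> UNIV \<Longrightarrow> dist z (s, u s) < r1 \<Longrightarrow>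
        dist (case z of (s, y) \<Rightarrow> dtE s y) (case (s, u s) of (s, y) \<Rightarrow> dtE s y) < e"
      using dtE_cont ins e unfolding continuous_on_iff by metis
    obtain r2 where r2: "r2 > 0" "\<And>z. z \<in> {0..T} \<times> UNIV \<Longrightarrow> dist z (s, u s) < r2 \<Longrightarrow>
        dist (case z of (s, y) \<Rightarrow> DE s y) (case (s, u s) of (s, y) \<Rightarrow> DE s y) < e"
      using DE_cont ins e unfolding continuous_on_iff by metis
    \<comment> \<open>A ball cut with the strip is convex, so the linearization may compare two
      points of the curve even if the curve jumps between them.\<close>
    define S where "S = ({0..T} \<times> UNIV) \<inter> ball (s, u s) (min r1 r2)"
    have S: "convex S" "S \<subseteq> {0..T} \<times> UNIV" unfolding S_def by (auto intro!: convex_Int convex_Times convex_ball)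
    have Sb: "\<bar>dtE t y - p\<bar> \<le> e \<and> norm (DE t y - l) \<le> e" if "(t, y) \<in> S" for t y
      using r1(2)[of "(t, y)"] r2(2)[of "(t, y)"] that
      by (auto simp: S_def p_def l_def dist_commute dist_norm less_imp_le)
    have "((\<lambda>t. (clamp T t, uc t)) \<longlongrightarrow> (s, u s)) (at s)"
      by (intro tendsto_Pair clamp_tendsto s uct)
    then have "\<forall>\<^sub>F t in at s. dist (clamp T t, uc t) (s, u s) < min r1 r2" using r1(1) r2(1) by (intro tendstoD) auto
    then obtain d where d: "d > 0" "\<And>t. t \<noteq> s \<Longrightarrow> dist t s < d \<Longrightarrow> dist (clamp T t, uc t) (s, u s) < min r1 r2"
      unfolding eventually_at by auto
    have in_S: "(clamp T t, uc t) \<in> S" if "\<bar>t - s\<bar> < d" for t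
      using d(2)[of t] that r1(1) r2(1) clamp_in[OF T, of t] clamp_id[OF s(1)] uc_id[OF s(1)]
      by (cases "t = s") (auto simp: S_def dist_commute dist_real_def)
    show ?thesis
    proof (rule that[OF d(1)])
      show "\<bar>dtE (clamp T t) (uc t) - p\<bar> \<le> e \<and> norm (DE (clamp T t) (uc t) - l) \<le> e" if "\<bar>t - s\<bar> < d" for t
        by (rule Sb[OF in_S[OF that]])
      fix x y assume xy: "\<bar>x - s\<bar> < d" "\<bar>y - s\<bar> < d" "x \<le> y"
      have "\<bar>E (clamp T y) (uc y) - E (clamp T x) (uc x) - p * (clamp T y - clamp T x) - l (uc y - uc x)\<bar>
          \<le> 2 * e * (\<bar>clamp T y - clamp T x\<bar> + norm (uc y - uc x))"
        by (rule E_linearization[OF S Sb in_S[OF xy(2)] in_S[OF xy(1)]])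
      also have "\<dots> \<le> 2 * e * (W y - W x)"
        using dom_uc[OF xy(3)] clamp_mono[OF xy(3), of T] e by (intro mult_left_mono) auto
      finally show "\<bar>(F y - p * clamp T y - l (uc y)) - (F x - p * clamp T x - l (uc x))\<bar> \<le> 2 * e * (W y - W x)"
        by (simp add: F_def algebra_simps blinfun.diff_right)
    qed
  qed
  \<comment> \<open>The measure of the energy minus its affine approximation along the curve, that
    is, of F - p t - l(u). Its values on short intervals and at points are bounded by 2 e times
    those of the measure of \<open>W\<close>.\<close>
  define nP where "nP A = F.nu0 A - p * lam A - l (nu0 A)" for A
  have cadd_nP: "cadd nP"
    unfolding nP_def[abs_def]
    by (intro cadd_diff F.cadd_nu0 cadd_linear[OF cadd_lam bounded_linear_mult_right]
        cadd_linear[OF cadd_nu0 blinfun.bounded_linear_right])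
  interpret mW: finite_measure "smeas W" by (rule finite_smeas_W)
  have ev_near: "\<exists>N. \<forall>n\<ge>N. \<bar>t + step n - s\<bar> < d \<and> \<bar>t - step n - s\<bar> < d" if "\<bar>t - s\<bar> < d" for t
  proof -
    have "\<forall>\<^sub>F n in sequentially. step n < d - \<bar>t - s\<bar>" using that by (intro order_tendstoD(2)[OF step_tendsto]) simp
    then obtain N where N: "\<And>n. n \<ge> N \<Longrightarrow> step n < d - \<bar>t - s\<bar>" by (auto simp: eventually_sequentially)
    then show ?thesis using step_pos by (intro exI[of _ N]) (smt (verit))
  qed
  have clr: "(\<lambda>n. clamp T (t + step n)) \<longlonglongrightarrow> t" "(\<lambda>n. clamp T (t - step n)) \<longlonglongrightarrow> t" if "t \<in> {0..T}" for t
    using filterlim_compose[OF clamp_tendsto[OF that] filterlim_step_right]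
      filterlim_compose[OF clamp_tendsto[OF that] filterlim_step_left] by auto
  have lr: "(\<lambda>n. l (uc (t + step n))) \<longlonglongrightarrow> l (rlim uc t)" "(\<lambda>n. l (uc (t - step n))) \<longlonglongrightarrow> l (llim uc t)" for t
    by (intro bounded_linear.tendsto[OF blinfun.bounded_linear_right] u_rlim_seq u_llim_seq)+
  have nP_Ioc: "\<bar>nP {a<..b}\<bar> \<le> 2 * e * measure (smeas W) {a<..b}"
    if ab: "0 \<le> a" "a \<le> b" "b \<le> T" and nr: "\<bar>a - s\<bar> < d" "\<bar>b - s\<bar> < d" for a b
  proof -
    have abT: "a \<in> {0..T}" "b \<in> {0..T}" using ab by auto
    have eq: "nP {a<..b} = (rlim F b - p * b - l (rlim uc b)) - (rlim F a - p * a - l (rlim uc a))"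
      using ab by (simp add: nP_def F.nu0_Ioc nu0_Ioc lam_Ioc blinfun.diff_right algebra_simps)
    obtain Na Nb where N: "\<And>n. n \<ge> Na \<Longrightarrow> \<bar>a + step n - s\<bar> < d" "\<And>n. n \<ge> Nb \<Longrightarrow> \<bar>b + step n - s\<bar> < d"
      using ev_near[OF nr(1)] ev_near[OF nr(2)] by blast
    have "\<bar>(rlim F b - p * b - l (rlim uc b)) - (rlim F a - p * a - l (rlim uc a))\<bar> \<le> 2 * e * (rlim W b - rlim W a)"
    proof (rule LIMSEQ_le)
      show "(\<lambda>n. \<bar>(F (b + step n) - p * clamp T (b + step n) - l (uc (b + step n))) - (F (a + step n) - p * clamp T (a + step n) - l (uc (a + step n)))\<bar>)
        \<longlonglongrightarrow> \<bar>(rlim F b - p * b - l (rlim uc b)) - (rlim F a - p * a - l (rlim uc a))\<bar>"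
        by (intro tendsto_rabs tendsto_diff tendsto_mult tendsto_const F.u_rlim_seq clr abT lr)
      show "(\<lambda>n. 2 * e * (W (b + step n) - W (a + step n))) \<longlonglongrightarrow> 2 * e * (rlim W b - rlim W a)"
        by (intro tendsto_diff tendsto_mult tendsto_const W_rlim_seq)
      show "\<exists>N. \<forall>n\<ge>N. \<bar>(F (b + step n) - p * clamp T (b + step n) - l (uc (b + step n))) - (F (a + step n) - p * clamp T (a + step n) - l (uc (a + step n)))\<bar>
         \<le> 2 * e * (W (b + step n) - W (a + step n))"
        using N ab by (intro exI[of _ "max Na Nb"] allI impI PhiW) auto
    qed
    then show ?thesis unfolding eq smeas_W_Ioc[OF ab(2)] .
  qed
  have lam_point: "lam {r} = 0" for r
    unfolding lam_def by (rule set_integral_null_set[OF lborel_singleton_null])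
  have nP_point: "norm (nP {r}) \<le> 2 * e * measure (smeas W) {r}" if rT: "r \<in> {0..T}" and nr: "\<bar>r - s\<bar> < d" for r
  proof -
    have eq: "nP {r} = (rlim F r - p * r - l (rlim uc r)) - (llim F r - p * r - l (llim uc r))"
      by (simp add: nP_def F.nu0_point nu0_point lam_point blinfun.diff_right algebra_simps)
    obtain N where N: "\<And>n. n \<ge> N \<Longrightarrow> \<bar>r + step n - s\<bar> < d \<and> \<bar>r - step n - s\<bar> < d"
      using ev_near[OF nr] by blast
    have "\<bar>(rlim F r - p * r - l (rlim uc r)) - (llim F r - p * r - l (llim uc r))\<bar> \<le> 2 * e * (rlim W r - llim W r)"
    proof (rule LIMSEQ_le)
      show "(\<lambda>n. \<bar>(F (r + step n) - p * clamp T (r + step n) - l (uc (r + step n))) - (F (r - step n) - p * clamp T (r - step n) - l (uc (r - step n)))\<bar>)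
        \<longlonglongrightarrow> \<bar>(rlim F r - p * r - l (rlim uc r)) - (llim F r - p * r - l (llim uc r))\<bar>"
        by (intro tendsto_rabs tendsto_diff tendsto_mult tendsto_const F.u_rlim_seq F.u_llim_seq clr rT lr)
      show "(\<lambda>n. 2 * e * (W (r + step n) - W (r - step n))) \<longlonglongrightarrow> 2 * e * (rlim W r - llim W r)"
        by (intro tendsto_diff tendsto_mult tendsto_const W_rlim_seq W_llim_seq)
      show "\<exists>N. \<forall>n\<ge>N. \<bar>(F (r + step n) - p * clamp T (r + step n) - l (uc (r + step n))) - (F (r - step n) - p * clamp T (r - step n) - l (uc (r - step n)))\<bar>
         \<le> 2 * e * (W (r + step n) - W (r - step n))"
        using N step_pos by (intro exI[of _ N] allI impI PhiW) (auto intro: order_trans[of _ r] less_imp_le)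
    qed
    then show ?thesis unfolding eq smeas_W_point by simp
  qed
  show ?thesis
  proof (intro exI[of _ d] conjI d allI impI, elim conjE)
    fix a b assume abs: "a \<le> s" "s \<le> b" "b - a < d" and ab: "0 \<le> a" "b \<le> T"
    show "\<bar>kappa {a<..b}\<bar> \<le> 5 * e * (H b - H a)"
    proof (cases "a < b")
      case True
      let ?I = "{a<..b}"
      have nr: "\<bar>t - s\<bar> < d" if "a \<le> t" "t \<le> b" for t using abs that by auto
      let ?m = "measure (smeas W) ?I"
      have k1: "\<bar>nP ?I\<bar> \<le> 2 * e * ?m" by (rule nP_Ioc) (use ab True nr in auto)
      have IJ: "?I \<inter> J \<in> null_sets lborel" using null_set_Int1[OF J_null, of ?I] by (simp add: Int_commute)
      \<comment> \<open>The jump part is estimated atom by atom and then summed over the countable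
        set.\<close>
      have "norm (nP (?I \<inter> J)) \<le> 2 * e * measure (smeas W) (?I \<inter> J)"
      proof (rule cadd_countable_bound[OF cadd_nP finite_smeas_W])
        show "countable (?I \<inter> J)" using countable_J by auto
        show "norm (nP {r}) \<le> 2 * e * measure (smeas W) {r}" if "r \<in> ?I \<inter> J" for r
          using that ab by (intro nP_point nr) auto
      qed simp
      also have "\<dots> \<le> 2 * e * ?m" using e by (intro mult_left_mono mW.finite_measure_mono) auto
      finally have "\<bar>nP (?I - J)\<bar> \<le> 4 * e * ?m"
        using k1 cadd_split[OF cadd_nP, of ?I J] by simp
      moreover have lamI: "lam (?I - J) = lam ?I"
        using cadd_split[OF cadd_lam, of ?I J] set_integral_null_set[OF IJ] by (simp add: lam_def)
      have s1: "\<bar>LINT t:?I|lborel. (p * indicator {0..T} t - g1 t)\<bar> \<le> (LINT t:?I|lborel. e * indicator {0..T} t)"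
      proof (rule set_integral_le)
        fix t assume "t \<in> ?I"
        then have "t \<in> {0..T}" "\<bar>t - s\<bar> < d" using ab nr[of t] by auto
        then show "\<bar>p * indicator {0..T} t - g1 t\<bar> \<le> e * indicator {0..T} t"
          using near[of t] by (simp add: g1_def abs_minus_commute)
      qed (use integrable_ind integrable_g1 in auto)
      have si: "set_integrable lborel ?I (indicat_real {0..T})" "set_integrable lborel ?I g1"
        unfolding set_integrable_def using integrable_mult_indicator[OF _ integrable_ind, of ?I] integrable_mult_indicator[OF _ integrable_g1, of ?I] by auto
      have "(LINT t:?I|lborel. (p * indicator {0..T} t - g1 t)) = p * lam ?I - (LINT t:?I|lborel. g1 t)"
        using si by (simp add: lam_def)
      moreover have "(LINT t:?I|lborel. e * indicator {0..T} t) = e * lam ?I" by (simp add: lam_def)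
      moreover have "e * lam ?I \<le> e * ?m"
        using Ioc_le_W[of a b] lam_Ioc[of a b] smeas_W_Ioc[of a b] ab True e by (intro mult_left_mono) auto
      ultimately have s1': "\<bar>p * lam ?I - (LINT t:?I|lborel. g1 t)\<bar> \<le> e * ?m" using s1 by linarith
      have il: "integrable mu (\<lambda>t. l (h t))" by (rule integrable_bounded_linear[OF blinfun.bounded_linear_right integrable_h])
      have s2: "\<bar>LINT t:?I|mu. (l (h t) - g2 t)\<bar> \<le> (LINT t:?I|mu. e * norm (h t))"
      proof (rule set_integral_le)
        fix t assume "t \<in> ?I"
        then have "\<bar>t - s\<bar> < d" using nr[of t] by auto
        then have "norm (DE (clamp T t) (uc t) - l) \<le> e" using near by blast
        then have "norm (DE (clamp T t) (uc t) - l) * norm (h t) \<le> e * norm (h t)" by (intro mult_right_mono) auto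
        moreover have "\<bar>l (h t) - g2 t\<bar> \<le> norm (DE (clamp T t) (uc t) - l) * norm (h t)"
          using norm_blinfun[of "DE (clamp T t) (uc t) - l" "h t"] by (simp add: g2_def blinfun.diff_left abs_minus_commute)
        ultimately show "\<bar>l (h t) - g2 t\<bar> \<le> e * norm (h t)" by simp
      qed (use il integrable_g2 integrable_norm[OF integrable_h] in auto)
      have I0: "?I \<subseteq> {0<..T}" using ab by auto
      have "l (nu0 (?I - J)) = l (LINT t:?I|mu. h t)" using nu0_nu[OF _ I0] h_integral[of ?I] by simp
      also have "\<dots> = (LINT t:?I|mu. l (h t))"
        unfolding set_lebesgue_integral_def
        by (subst integral_bounded_linear[OF blinfun.bounded_linear_right[of l], symmetric])
          (auto intro!: integrable_mult_indicator integrable_h simp: blinfun.scaleR_right)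
      finally have l1: "l (nu0 (?I - J)) = (LINT t:?I|mu. l (h t))" .
      have si2: "set_integrable mu ?I (\<lambda>t. l (h t))" "set_integrable mu ?I g2"
        unfolding set_integrable_def using integrable_mult_indicator[OF _ il, of ?I] integrable_mult_indicator[OF _ integrable_g2, of ?I] by auto
      have s2': "\<bar>l (nu0 (?I - J)) - (LINT t:?I|mu. g2 t)\<bar> \<le> e * q ?I"
        using s2 si2 unfolding l1 by (simp add: q_def)
      have "kappa ?I = nP (?I - J) + (p * lam ?I - (LINT t:?I|lborel. g1 t)) + (l (nu0 (?I - J)) - (LINT t:?I|mu. g2 t))"
        unfolding kappa_def nP_def lamI by simp
      then have "\<bar>kappa ?I\<bar> \<le> 4 * e * ?m + e * ?m + e * q ?I"
        using s1' s2' \<open>\<bar>nP (?I - J)\<bar> \<le> 4 * e * ?m\<close> by linarith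
      also have "\<dots> \<le> 5 * e * (?m + measure (smeas W) {a..<b} + q ?I)"
        using e q_nonneg[of ?I] measure_nonneg[of "smeas W" "{a..<b}"] by (simp add: algebra_simps)
      also have "\<dots> = 5 * e * (H b - H a)" using H_diff[OF True] by simp
      finally show ?thesis .
    next
      case False
      then have "a = b" using abs by simp
      then show ?thesis using cadd_empty[OF cadd_kappa] by simp
    qed
  qed
qed

lemma kappa_zero:
  assumes t: "0 \<le> t" "t \<le> T" shows "kappa {0<..t} = 0"
proof -
  have bound: "\<bar>kappa {0<..t}\<bar> \<le> 5 * e * (H t - H 0)" if e: "e > 0" for e
  proof -
    \<comment> \<open>Both \<open>kappa\<close> on half-open intervals and the increments of
      \<open>H\<close> add up over adjacent intervals, as bisection demands. The range condition
      stays inside the property because the local neighbourhoods may leave [0,T].\<close>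
    have "0 \<le> (0::real) \<and> t \<le> T \<longrightarrow> \<bar>kappa {0<..t}\<bar> \<le> 5 * e * (H t - H 0)"
    proof (rule Bolzano[OF t(1), where P="\<lambda>a b. 0 \<le> a \<and> b \<le> T \<longrightarrow> \<bar>kappa {a<..b}\<bar> \<le> 5 * e * (H b - H a)"])
      fix a b c :: real
      assume ab: "0 \<le> a \<and> b \<le> T \<longrightarrow> \<bar>kappa {a<..b}\<bar> \<le> 5 * e * (H b - H a)"
        and bc: "0 \<le> b \<and> c \<le> T \<longrightarrow> \<bar>kappa {b<..c}\<bar> \<le> 5 * e * (H c - H b)" and abc: "a \<le> b" "b \<le> c"
      show "0 \<le> a \<and> c \<le> T \<longrightarrow> \<bar>kappa {a<..c}\<bar> \<le> 5 * e * (H c - H a)"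
      proof
        assume ac: "0 \<le> a \<and> c \<le> T"
        have "kappa ({a<..b} \<union> {b<..c}) = kappa {a<..b} + kappa {b<..c}" by (rule cadd_Un[OF cadd_kappa]) auto
        moreover have "{a<..b} \<union> {b<..c} = {a<..c}" using abc by auto
        ultimately have "\<bar>kappa {a<..c}\<bar> \<le> \<bar>kappa {a<..b}\<bar> + \<bar>kappa {b<..c}\<bar>" by simp
        also have "\<dots> \<le> 5 * e * (H b - H a) + 5 * e * (H c - H b)" using ab bc abc ac by (intro add_mono) auto
        finally show "\<bar>kappa {a<..c}\<bar> \<le> 5 * e * (H c - H a)" by (simp add: algebra_simps)
      qed
    next
      fix x assume x: "0 \<le> x" "x \<le> t"
      show "\<exists>d>0. \<forall>a b. a \<le> x \<and> x \<le> b \<and> b - a < d \<longrightarrow> 0 \<le> a \<and> b \<le> T \<longrightarrow> \<bar>kappa {a<..b}\<bar> \<le> 5 * e * (H b - H a)"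
      proof (cases "x \<in> J")
        case True
        have "5 * e > 0" using e by simp
        from local_jump[OF True this] show ?thesis by blast
      next
        case False
        then show ?thesis using x t e by (intro local_regular) auto
      qed
    qed
    then show ?thesis using t by simp
  qed
  have "\<bar>kappa {0<..t}\<bar> \<le> 0 + d" if d: "d > 0" for d
  proof -
    \<comment> \<open>The summand 1 keeps the denominator positive when \<open>H\<close> does not
      grow on the interval.\<close>
    have Hp: "H t - H 0 + 1 > 0"
      using H_diff[of 0 t] q_nonneg[of "{0<..t}"] measure_nonneg[of "smeas W" "{0<..t}"] measure_nonneg[of "smeas W" "{0..<t}"] t
      by (cases "t = 0") (simp_all add: add_nonneg_pos)
    have "\<bar>kappa {0<..t}\<bar> \<le> 5 * (d / (5 * (H t - H 0 + 1))) * (H t - H 0)"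
      by (rule bound) (use d Hp in simp)
    also have "\<dots> \<le> d" using d Hp by (simp add: field_simps)
    finally show ?thesis by simp
  qed
  then show ?thesis using field_le_epsilon[of "\<bar>kappa {0<..t}\<bar>" 0] by simp
qed

text \<open>Jumps of the energy are dominated by atoms of a multiple of \<open>W\<close>, whose
  total mass is finite.\<close>

lemma has_sum_energy_jumps:
  "((\<lambda>r. E r (rlim uc r) - E r (llim uc r)) has_sum F.nu0 (J \<inter> {0<..<t})) (J \<inter> {0<..<t})"
proof -
  have 1: "((\<lambda>r. F.nu0 {r}) has_sum F.nu0 (J \<inter> {0<..<t})) (J \<inter> {0<..<t})"
  proof (rule cadd_has_sum[OF F.cadd_nu0 F.finite_smeas_W, where e=1])
    show "countable (J \<inter> {0<..<t})" using countable_J by auto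
    show "norm (F.nu0 {r}) \<le> 1 * measure (smeas (\<lambda>t. 2 * L * W t)) {r}" for r
      using F.dom_jump[of r] unfolding F.smeas_W_point F.nu0_point by simp
  qed auto
  have eq: "F.nu0 {r} = E r (rlim uc r) - E r (llim uc r)" if "r \<in> J \<inter> {0<..<t}" for r
    using that J_iff[of r] F.nu0_point[of r] rlim_F[of r] llim_F[of r] by simp
  show ?thesis by (rule iffD1[OF has_sum_cong[OF eq] 1])
qed

lemma set_integral_Icc_Ioc:
  fixes f :: "real \<Rightarrow> real"
  assumes "integrable N f" "sets N = sets borel" "{0} \<in> null_sets N" "0 \<le> t"
  shows "(LINT s:{0..t}|N. f s) = (LINT s:{0<..t}|N. f s)"
proof -
  have "{0<..t} = {0..t} - {0}" by auto
  then show ?thesis using cadd_Diff[OF cadd_set_integral[OF assms(1,2)], of "{0..t}" "{0}"] assms(4)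
    set_integral_null_set[OF assms(3), of f] by simp
qed

text \<open>The ends are one-sided: only the transitions from u(0) to u(0+) and from u(t-) to u(t)
  belong to [0,t]. They are kept apart in the form in which the pseudo-total variation has
  them.\<close>

lemma chain_rule:
  assumes t: "0 < t" "t \<le> T"
  shows "E t (u t) - E 0 (u 0) = (E t (u t) - E t (llim uc t)) + (E 0 (rlim uc 0) - E 0 (u 0))
    + (LINT s:{0..t}|lborel. dtE s (u s)) + (LINT s:{0..t}|mu. blinfun_apply (DE s (u s)) (h s))
    + F.nu0 (J \<inter> {0<..<t})"
proof -
  have "(LINT s:{0..t}|lborel. dtE s (u s)) = (LINT s:{0..t}|lborel. g1 s)"
    by (rule set_lebesgue_integral_cong) (use t in \<open>auto simp: g1_def clamp_id uc_id\<close>)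
  also have "\<dots> = (LINT s:{0<..t}|lborel. g1 s)"
    by (rule set_integral_Icc_Ioc[OF integrable_g1 _ lborel_singleton_null]) (use t in auto)
  finally have 1: "(LINT s:{0..t}|lborel. dtE s (u s)) = (LINT s:{0<..t}|lborel. g1 s)" .
  have "(LINT s:{0..t}|mu. blinfun_apply (DE s (u s)) (h s)) = (LINT s:{0..t}|mu. g2 s)"
    by (rule set_lebesgue_integral_cong) (use t in \<open>auto simp: g2_def clamp_id uc_id\<close>)
  also have "\<dots> = (LINT s:{0<..t}|mu. g2 s)"
    by (rule set_integral_Icc_Ioc[OF integrable_g2 _ mu_point]) (use t in auto)
  finally have 2: "(LINT s:{0..t}|mu. blinfun_apply (DE s (u s)) (h s)) = (LINT s:{0<..t}|mu. g2 s)" .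
  have 3: "F.nu0 ({0<..t} - J) = (LINT s:{0<..t}|lborel. g1 s) + (LINT s:{0<..t}|mu. g2 s)"
    using kappa_zero[of t] t by (simp add: kappa_def)
  have "F.nu0 ({0<..t} - J) = F.nu0 ({0<..<t} - J)"
  proof (cases "t \<in> J")
    case True
    have "x \<in> {0<..t} - J \<longleftrightarrow> x \<in> {0<..<t} - J" for x
      by (cases "x = t") (use True in auto)
    then have "{0<..t} - J = {0<..<t} - J" by blast
    then show ?thesis by simp
  next
    case False
    have "x \<in> {0<..t} - J \<longleftrightarrow> x \<in> ({0<..<t} - J) \<union> {t}" for x
      by (cases "x = t") (use False t in auto)
    then have "{0<..t} - J = ({0<..<t} - J) \<union> {t}" by blast
    moreover have "F.nu0 (({0<..<t} - J) \<union> {t}) = F.nu0 ({0<..<t} - J) + F.nu0 {t}"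
      by (rule cadd_Un[OF F.cadd_nu0]) auto
    moreover have "F.nu0 {t} = 0"
      using False t J_iff[of t] F.nu0_point[of t] rlim_F[of t] llim_F[of t] by simp
    ultimately show ?thesis by simp
  qed
  then have "F.nu0 {0<..<t} = (LINT s:{0<..t}|lborel. g1 s) + (LINT s:{0<..t}|mu. g2 s) + F.nu0 (J \<inter> {0<..<t})"
    using cadd_split[OF F.cadd_nu0, of "{0<..<t}" J] 3 by (simp add: Int_commute)
  moreover have "F.nu0 {0<..<t} = E t (llim uc t) - E 0 (rlim uc 0)"
    using F.nu0_Ioo[OF t(1)] rlim_F[of 0] llim_F[of t] t by simp
  ultimately show ?thesis using 1 2 by simp
qed

end

section \<open>Lebesgue differentiation\<close>

lemma interval_as_cball: "{y..z::real} = cball ((y + z) / 2) ((z - y) / 2)"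
  by (auto simp: cball_eq_atLeastAtMost field_simps)

lemma finite_outer_open:
  assumes \<rho>: "finite_measure \<rho>" "sets \<rho> = sets (borel :: real measure)" and A: "A \<in> sets borel" and e: "e > 0"
  shows "\<exists>U. open U \<and> A \<subseteq> U \<and> measure \<rho> (U - A) < e"
proof -
  interpret finite_measure \<rho> by fact
  have "emeasure \<rho> A = (INF U\<in>{U. A \<subseteq> U \<and> open U}. emeasure \<rho> U)"
    by (rule outer_regular[OF \<rho>(2) _ A]) simp
  moreover have "emeasure \<rho> A < emeasure \<rho> A + ennreal e" using e by (simp add: emeasure_eq_measure ennreal_plus[symmetric] ennreal_less_iff del: ennreal_plus)
  ultimately obtain U where U: "A \<subseteq> U" "open U" "emeasure \<rho> U < emeasure \<rho> A + ennreal e"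
    by (metis (mono_tags, lifting) INF_less_iff mem_Collect_eq)
  have UA: "U \<in> sets \<rho>" "A \<in> sets \<rho>" using U A \<rho>(2) by auto
  have "measure \<rho> U < measure \<rho> A + e"
    using U(3) e by (simp add: emeasure_eq_measure ennreal_plus[symmetric] ennreal_less_iff del: ennreal_plus)
  then have "measure \<rho> (U - A) < e" using finite_measure_Diff[OF UA U(1)] by simp
  then show ?thesis using U by blast
qed

text \<open>Cover \<open>A\<close> by an open set \<open>U\<close> with \<rho>-mass below k e.
  Vitali covering selects disjoint intervals inside \<open>U\<close>, each of \<rho>-mass more than
  \<open>k\<close> times its length, so their total length is at most \<open>e\<close>. Intervals
  need only contain the point, which admits one-sided ones.\<close>

lemma negligible_positive_density:
  assumes \<rho>: "finite_measure \<rho>" "sets \<rho> = sets (borel :: real measure)" and A: "A \<in> sets borel" "measure \<rho> A = 0" and k: "k > 0"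
  shows "negligible {x\<in>A. \<forall>d>0. \<exists>y r. x \<in> cball y r \<and> 0 < r \<and> r < d \<and> measure \<rho> (cball y r) > k * (2 * r)}"
    (is "negligible ?N")
  unfolding negligible_outer_le
proof (intro allI impI)
  fix e :: real assume e: "e > 0"
  interpret finite_measure \<rho> by fact
  obtain U where U: "open U" "A \<subseteq> U" "measure \<rho> (U - A) < k * e"
    using finite_outer_open[OF \<rho> A(1), of "k * e"] k e by auto
  have Ub: "U \<in> sets borel" using U(1) by simp
  have rU: "measure \<rho> U < k * e"
    using U Ub A \<rho>(2) finite_measure_Diff[of U A] by simp
  define K where "K = {(y, r). 0 < r \<and> cball y r \<subseteq> U \<and> measure \<rho> (cball y r) > k * (2 * r)}"
  obtain C where C: "countable C" "C \<subseteq> K"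
    "pairwise (\<lambda>i j. disjnt (cball (fst i) (snd i)) (cball (fst j) (snd j))) C"
    "negligible (?N - (\<Union>i\<in>C. cball (fst i) (snd i)))"
  proof (rule Vitali_covering_theorem_cballs[where K=K and r=snd and a=fst and S="?N"])
    show "0 < snd i" if "i \<in> K" for i using that by (auto simp: K_def)
    fix x d assume x: "x \<in> ?N" and d: "(0::real) < d"
    then have "x \<in> U" using U by auto
    then obtain \<eta> where \<eta>: "\<eta> > 0" "ball x \<eta> \<subseteq> U" using U(1) openE by blast
    have "0 < min d (\<eta> / 2)" using d \<eta> by simp
    then obtain y r where yr: "x \<in> cball y r" "0 < r" "r < min d (\<eta> / 2)" "measure \<rho> (cball y r) > k * (2 * r)"
      using x by blast
    have "cball y r \<subseteq> ball x \<eta>"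
    proof
      fix z assume "z \<in> cball y r"
      then show "z \<in> ball x \<eta>" using yr dist_triangle[of x z y] by (auto simp: dist_commute)
    qed
    then have "(y, r) \<in> K" using yr \<eta> by (auto simp: K_def)
    then show "\<exists>i. i \<in> K \<and> x \<in> cball (fst i) (snd i) \<and> snd i < d" using yr by (intro exI[of _ "(y, r)"]) auto
  qed
  let ?X = "\<lambda>i. cball (fst i) (snd i) :: real set"
  let ?Y = "\<Union>i\<in>C. ?X i"
  have disj: "disjoint_family_on ?X C"
    using C(3) by (auto simp: disjoint_family_on_def pairwise_def disjnt_def)
  have Yb: "?Y \<in> sets borel" using C(1) by (intro sets.countable_UN'') auto
  have "ennreal k * emeasure lborel ?Y = (\<integral>\<^sup>+i. ennreal k * emeasure lborel (?X i) \<partial>count_space C)"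
    using C(1) disj by (subst emeasure_UN_countable) (auto simp: nn_integral_cmult)
  also have "\<dots> \<le> (\<integral>\<^sup>+i. emeasure \<rho> (?X i) \<partial>count_space C)"
  proof (rule nn_integral_mono)
    fix i assume "i \<in> space (count_space C)"
    then have i: "0 < snd i" "k * (2 * snd i) < measure \<rho> (?X i)" using C(2) by (auto simp: K_def)
    have "ennreal k * emeasure lborel (?X i) = ennreal (k * (2 * snd i))"
      using i(1) k by (simp add: cball_eq_atLeastAtMost ennreal_mult)
    then show "ennreal k * emeasure lborel (?X i) \<le> emeasure \<rho> (?X i)"
      using i(2) by (simp add: emeasure_eq_measure ennreal_leI)
  qed
  also have "\<dots> = emeasure \<rho> ?Y"
    using C(1) disj \<rho>(2) by (subst emeasure_UN_countable) auto
  also have "\<dots> \<le> emeasure \<rho> U"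
  proof (rule emeasure_mono)
    have "?X i \<subseteq> U" if "i \<in> C" for i
    proof -
      have "i \<in> K" using C(2) that by blast
      then show ?thesis unfolding K_def case_prod_unfold by blast
    qed
    then show "?Y \<subseteq> U" by blast
  qed (use Ub \<rho>(2) in simp)
  also have "\<dots> \<le> ennreal k * ennreal e"
    using rU k e by (simp add: emeasure_eq_measure ennreal_mult[symmetric] ennreal_leI)
  finally have le: "emeasure lborel ?Y \<le> ennreal e"
    using k by (subst (asm) ennreal_mult_le_mult_iff) auto
  have Yl: "?Y \<in> lmeasurable" "measure lebesgue ?Y \<le> e"
  proof -
    have "emeasure lebesgue ?Y = emeasure lborel ?Y" using Yb by simp
    then show "?Y \<in> lmeasurable" using le Yb by (intro fmeasurableI) (auto simp: le_less_trans)
    show "measure lebesgue ?Y \<le> e"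
      unfolding measure_def using le \<open>emeasure lebesgue ?Y = emeasure lborel ?Y\<close> e
      by (simp add: enn2real_leI)
  qed
  have nl: "?N - ?Y \<in> lmeasurable" "measure lebesgue (?N - ?Y) = 0"
    using C(4) negligible_iff_measure by blast+
  show "\<exists>T. ?N \<subseteq> T \<and> T \<in> lmeasurable \<and> measure lebesgue T \<le> e"
  proof (intro exI conjI)
    show "?N \<subseteq> (?N - ?Y) \<union> ?Y" by blast
    show "(?N - ?Y) \<union> ?Y \<in> lmeasurable" using nl Yl by (intro fmeasurable.Un)
    have "measure lebesgue ((?N - ?Y) \<union> ?Y) \<le> measure lebesgue (?N - ?Y) + measure lebesgue ?Y"
      using nl Yl by (intro measure_Un_le fmeasurableD)
    then show "measure lebesgue ((?N - ?Y) \<union> ?Y) \<le> e" using nl Yl by simp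
  qed
qed

lemma negligible_AE_lborel: "negligible N \<Longrightarrow> AE x in lborel. x \<notin> N"
  unfolding negligible_iff_null_sets using AE_not_in AE_completion_iff by blast

text \<open>The excess (g - a)^+ defines a measure without mass on {g < a}, so almost everywhere on
  that set its upper density is zero. Averages of \<open>g\<close> near \<open>x\<close> are then at
  most \<open>a\<close> plus a small error, with \<open>a\<close> slightly above g(x).\<close>

lemma lebesgue_upper_density:
  fixes g :: "real \<Rightarrow> real"
  assumes g: "integrable lborel g" and pq: "p < q"
  shows "AE x in lborel. x \<in> {p<..<q} \<longrightarrow> (\<forall>\<eta>>0. \<exists>d>0. \<forall>y z. y \<le> x \<and> x \<le> z \<and> y < z \<and> z - y < d \<longrightarrow>
    (LINT t:{y..z}|lborel. g t) \<le> (g x + \<eta>) * (z - y))"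
proof -
  have [measurable]: "g \<in> borel_measurable borel" using g by simp
  have ind: "integrable lborel (indicat_real {p..q})" by (rule integrable_real_indicator) (use pq in auto)
  define w where "w a t = indicator {p..q} t * max 0 (g t - a)" for a t :: real
  have [measurable]: "w a \<in> borel_measurable borel" for a unfolding w_def[abs_def] by measurable
  have w: "integrable lborel (w a)" for a
  proof (rule Bochner_Integration.integrable_bound)
    show "integrable lborel (\<lambda>t. \<bar>g t\<bar> + \<bar>a\<bar> * indicator {p..q} t)" using g ind by simp
    show "AE t in lborel. norm (w a t) \<le> norm (\<bar>g t\<bar> + \<bar>a\<bar> * indicator {p..q} t)"
      by (rule AE_I2) (auto simp: w_def split: split_indicator)
  qed simp
  have w0: "w a t \<ge> 0" for a t by (simp add: w_def)
  define \<rho> where "\<rho> a = density lborel (\<lambda>t. ennreal (w a t))" for a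
  have \<rho>s: "sets (\<rho> a) = sets borel" for a by (simp add: \<rho>_def)
  have \<rho>m: "measure (\<rho> a) A = (LINT t:A|lborel. w a t)" if "A \<in> sets borel" for a A
  proof -
    have "emeasure (\<rho> a) A = (\<integral>\<^sup>+t. ennreal (indicator A t *\<^sub>R w a t) \<partial>lborel)"
      unfolding \<rho>_def using that by (simp add: emeasure_density ennreal_mult' mult.commute) (auto intro!: nn_integral_cong split: split_indicator)
    also have "\<dots> = ennreal (LINT t:A|lborel. w a t)"
      unfolding set_lebesgue_integral_def using that w w0
      by (intro nn_integral_eq_integral integrable_mult_indicator) auto
    finally show ?thesis
      unfolding measure_def using w0 by (simp add: set_lebesgue_integral_def integral_nonneg_AE)
  qed
  have \<rho>f: "finite_measure (\<rho> a)" for a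
  proof (rule finite_measureI)
    have "emeasure (\<rho> a) (space (\<rho> a)) = (\<integral>\<^sup>+t. ennreal (w a t) \<partial>lborel)"
      unfolding \<rho>_def by (simp add: emeasure_density)
    also have "\<dots> = ennreal (LINT t|lborel. w a t)" using w w0 by (intro nn_integral_eq_integral) auto
    finally show "emeasure (\<rho> a) (space (\<rho> a)) \<noteq> \<infinity>" by simp
  qed
  define Bad where "Bad a k = {x\<in>{t. g t < a}. \<forall>d>0. \<exists>y r. x \<in> cball y r \<and> 0 < r \<and> r < d \<and> measure (\<rho> a) (cball y r) > k * (2 * r)}" for a k
  have Bad: "negligible (Bad a k)" if "k > 0" for a k
    unfolding Bad_def
  proof (rule negligible_positive_density[OF \<rho>f \<rho>s _ _ that])
    show A: "{t. g t < a} \<in> sets borel" by measurable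
    have "(LINT t:{t. g t < a}|lborel. w a t) = (LINT t:{t. g t < a}|lborel. 0)"
      by (rule set_lebesgue_integral_cong) (use A in \<open>auto simp: w_def\<close>)
    then show "measure (\<rho> a) {t. g t < a} = 0" using \<rho>m[OF A] by simp
  qed
  have "AE x in lborel. \<forall>a\<in>\<rat>. \<forall>n. x \<notin> Bad a (step n)"
    by (intro AE_ball_countable[THEN iffD2] AE_all_countable[THEN iffD2] ballI allI negligible_AE_lborel Bad step_pos countable_rat)
  then show ?thesis
  proof eventually_elim
    case (elim x)
    show ?case
    proof (intro impI allI)
      fix \<eta> :: real assume x: "x \<in> {p<..<q}" and \<eta>: "\<eta> > 0"
      \<comment> \<open>Rational levels and the sequence \<open>step\<close> keep the exceptional
        sets countable in number.\<close>
      obtain a where a: "a \<in> \<rat>" "g x < a" "a < g x + \<eta> / 2" using Rats_dense_in_real[of "g x" "g x + \<eta> / 2"] \<eta> by auto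
      have "\<forall>\<^sub>F n in sequentially. step n < \<eta> / 2" using \<eta> by (intro order_tendstoD(2)[OF step_tendsto]) simp
      then obtain n where n: "step n < \<eta> / 2" by (auto simp: eventually_sequentially)
      obtain d where d: "d > 0" "\<And>y r. x \<in> cball y r \<Longrightarrow> 0 < r \<Longrightarrow> r < d \<Longrightarrow> measure (\<rho> a) (cball y r) \<le> step n * (2 * r)"
      proof -
        have "x \<notin> Bad a (step n)" using elim a by blast
        then have "\<exists>d>0. \<forall>y r. x \<in> cball y r \<and> 0 < r \<and> r < d \<longrightarrow> \<not> measure (\<rho> a) (cball y r) > step n * (2 * r)"
          using a unfolding Bad_def by blast
        then show ?thesis using that by (meson not_less)
      qed
      show "\<exists>d>0. \<forall>y z. y \<le> x \<and> x \<le> z \<and> y < z \<and> z - y < d \<longrightarrow> (LINT t:{y..z}|lborel. g t) \<le> (g x + \<eta>) * (z - y)"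
      proof (intro exI[of _ "min d (min (x - p) (q - x))"] conjI allI impI; (elim conjE)?)
        show "min d (min (x - p) (q - x)) > 0" using d x by auto
        fix y z assume yz: "y \<le> x" "x \<le> z" "y < z" "z - y < min d (min (x - p) (q - x))"
        have sub: "{y..z} \<subseteq> {p..q}" using yz by auto
        have "measure (\<rho> a) (cball ((y + z) / 2) ((z - y) / 2)) \<le> step n * (2 * ((z - y) / 2))"
          by (rule d(2)) (use yz d(1) in \<open>auto simp: interval_as_cball[symmetric]\<close>)
        moreover have "2 * ((z - y) / 2) = z - y" by simp
        ultimately have "measure (\<rho> a) {y..z} \<le> step n * (z - y)"
          unfolding interval_as_cball[symmetric] by (simp only:)
        then have 1: "(LINT t:{y..z}|lborel. w a t) \<le> step n * (z - y)" using \<rho>m by simp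
        have gi: "set_integrable lborel {y..z} g" "set_integrable lborel {y..z} (w a)" "set_integrable lborel {y..z} (\<lambda>_. a)"
        proof -
          show "set_integrable lborel {y..z} g" "set_integrable lborel {y..z} (w a)"
            unfolding set_integrable_def by (rule integrable_mult_indicator[OF _ g]; simp) (rule integrable_mult_indicator[OF _ w]; simp)
          have "integrable lborel (indicat_real {y..z})" by (rule integrable_real_indicator) (use yz in auto)
          then show "set_integrable lborel {y..z} (\<lambda>_. a)" unfolding set_integrable_def by simp
        qed
        have "(LINT t:{y..z}|lborel. g t) \<le> (LINT t:{y..z}|lborel. w a t + a)"
          by (intro set_integral_mono set_integral_add(1) gi) (use sub in \<open>auto simp: w_def\<close>)
        also have "\<dots> = (LINT t:{y..z}|lborel. w a t) + (LINT t:{y..z}|lborel. a)"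
          using gi by (intro set_integral_add(2))
        also have "(LINT t:{y..z}|lborel. a) = a * (z - y)" using yz by (simp add: set_lebesgue_integral_def)
        also have "(LINT t:{y..z}|lborel. w a t) + a * (z - y) \<le> (step n + a) * (z - y)" using 1 by (simp add: algebra_simps)
        also have "\<dots> \<le> (g x + \<eta>) * (z - y)" using n a yz by (intro mult_right_mono) auto
        finally show "(LINT t:{y..z}|lborel. g t) \<le> (g x + \<eta>) * (z - y)" .
      qed
    qed
  qed
qed

text \<open>The upper bound for averages, applied to \<open>g\<close> and to its negative, encloses
  the difference quotients from both sides.\<close>

lemma lebesgue_differentiation:
  fixes f g :: "real \<Rightarrow> real"
  assumes g: "integrable lborel g" and pq: "p < q"
    and f: "\<And>y z. p \<le> y \<Longrightarrow> y \<le> z \<Longrightarrow> z \<le> q \<Longrightarrow> f z - f y = (LINT t:{y..z}|lborel. g t)"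
  shows "AE x in lborel. x \<in> {p<..<q} \<longrightarrow> (f has_real_derivative g x) (at x)"
proof -
  have ng: "integrable lborel (\<lambda>t. - g t)" using g by simp
  show ?thesis using lebesgue_upper_density[OF g pq] lebesgue_upper_density[OF ng pq]
  proof eventually_elim
    case (elim x)
    show ?case
    proof
      assume x: "x \<in> {p<..<q}"
      have "(\<lambda>y. (f y - f x) / (y - x)) \<midarrow>x\<rightarrow> g x"
        unfolding LIM_eq
      proof (intro allI impI)
        fix e :: real assume e: "e > 0"
        obtain d1 where d1: "d1 > 0" "\<And>y z. y \<le> x \<Longrightarrow> x \<le> z \<Longrightarrow> y < z \<Longrightarrow> z - y < d1 \<Longrightarrow>
            (LINT t:{y..z}|lborel. g t) \<le> (g x + e / 2) * (z - y)"
          using elim(1) x e by (meson half_gt_zero)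
        obtain d2 where d2: "d2 > 0" "\<And>y z. y \<le> x \<Longrightarrow> x \<le> z \<Longrightarrow> y < z \<Longrightarrow> z - y < d2 \<Longrightarrow>
            (LINT t:{y..z}|lborel. - g t) \<le> (- g x + e / 2) * (z - y)"
          using elim(2) x e by (meson half_gt_zero)
        define d where "d = min (min d1 d2) (min (x - p) (q - x))"
        have key: "\<bar>(f z - f y) / (z - y) - g x\<bar> < e" if yz: "y \<le> x" "x \<le> z" "y < z" "z - y < d" for y z
        proof -
          have eq: "f z - f y = (LINT t:{y..z}|lborel. g t)" using yz by (intro f) (auto simp: d_def)
          have gi: "set_integrable lborel {y..z} g" unfolding set_integrable_def by (rule integrable_mult_indicator[OF _ g]) simp
          have "f z - f y \<le> (g x + e / 2) * (z - y)" unfolding eq using yz by (intro d1(2)) (auto simp: d_def)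
          moreover have "- (f z - f y) \<le> (- g x + e / 2) * (z - y)"
            unfolding eq set_integral_uminus[OF gi, symmetric] using yz by (intro d2(2)) (auto simp: d_def)
          ultimately have "\<bar>(f z - f y) - g x * (z - y)\<bar> \<le> e / 2 * (z - y)"
            unfolding distrib_right mult_minus_left by linarith
          also have "\<dots> < e * (z - y)" using yz e by simp
          finally have lt: "\<bar>(f z - f y) - g x * (z - y)\<bar> < e * (z - y)" .
          have "(f z - f y) / (z - y) - g x = ((f z - f y) - g x * (z - y)) / (z - y)" using yz by (simp add: field_simps)
          then have "\<bar>(f z - f y) / (z - y) - g x\<bar> = \<bar>(f z - f y) - g x * (z - y)\<bar> / (z - y)" using yz by simp
          then show ?thesis using lt yz by (simp add: divide_less_eq)
        qed
        show "\<exists>s>0. \<forall>y. y \<noteq> x \<and> norm (y - x) < s \<longrightarrow> norm ((f y - f x) / (y - x) - g x) < e"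
        proof (intro exI[of _ d] conjI allI impI; (elim conjE)?)
          show "d > 0" using d1 d2 x by (auto simp: d_def)
          fix y assume y: "y \<noteq> x" "norm (y - x) < d"
          show "norm ((f y - f x) / (y - x) - g x) < e"
          proof (cases "x < y")
            case True
            then show ?thesis using key[of x y] y by simp
          next
            case False
            have "(f y - f x) / (y - x) = (f x - f y) / (x - y)" by (metis minus_diff_eq minus_divide_divide)
            then show ?thesis using key[of y x] y False by simp
          qed
        qed
      qed
      then show "(f has_real_derivative g x) (at x)" by (simp add: has_field_derivative_iff)
    qed
  qed
qed

section \<open>Absolutely continuous curves\<close>

lemma AC_D:
  assumes "AC p q f" "e > 0"
  obtains d where "d > 0" "\<And>(n::nat) a b. (\<And>i. i < n \<Longrightarrow> p \<le> a i \<and> a i \<le> b i \<and> b i \<le> q) \<Longrightarrow>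
     disjoint_family_on (\<lambda>i. {a i<..<b i}) {..<n} \<Longrightarrow> (\<Sum>i<n. b i - a i) < d \<Longrightarrow>
     (\<Sum>i<n. norm (f (b i) - f (a i))) < e"
proof -
  have "\<exists>d>0. \<forall>(n::nat) a b. (\<forall>i<n. p \<le> a i \<and> a i \<le> b i \<and> b i \<le> q) \<and>
     disjoint_family_on (\<lambda>i. {a i<..<b i}) {..<n} \<and> (\<Sum>i<n. b i - a i) < d \<longrightarrow>
     (\<Sum>i<n. norm (f (b i) - f (a i))) < e"
    by (rule mp[OF spec[OF assms(1)[unfolded AC_def], of e] assms(2)])
  then obtain d where d0: "d > 0" and d: "\<forall>(n::nat) a b. (\<forall>i<n. p \<le> a i \<and> a i \<le> b i \<and> b i \<le> q) \<and>
     disjoint_family_on (\<lambda>i. {a i<..<b i}) {..<n} \<and> (\<Sum>i<n. b i - a i) < d \<longrightarrow>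
     (\<Sum>i<n. norm (f (b i) - f (a i))) < e" by (elim exE conjE)
  show ?thesis
  proof (rule that[OF d0])
    fix n :: nat and a b
    assume "\<And>i. i < n \<Longrightarrow> p \<le> a i \<and> a i \<le> b i \<and> b i \<le> q"
      "disjoint_family_on (\<lambda>i. {a i<..<b i}) {..<n}" "(\<Sum>i<n. b i - a i) < d"
    then show "(\<Sum>i<n. norm (f (b i) - f (a i))) < e" by (intro d[rule_format] conjI) auto
  qed
qed

lemma AC_continuous:
  assumes "AC p q f" "e > 0"
  obtains d where "d > 0" "\<And>x y. p \<le> x \<Longrightarrow> x \<le> y \<Longrightarrow> y \<le> q \<Longrightarrow> y - x < d \<Longrightarrow> norm (f y - f x) < e"
proof -
  obtain d where d: "d > 0" "\<And>(n::nat) a b. (\<And>i. i < n \<Longrightarrow> p \<le> a i \<and> a i \<le> b i \<and> b i \<le> q) \<Longrightarrow>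
     disjoint_family_on (\<lambda>i. {a i<..<b i}) {..<n} \<Longrightarrow> (\<Sum>i<n. b i - a i) < d \<Longrightarrow>
     (\<Sum>i<n. norm (f (b i) - f (a i))) < e"
    using AC_D[OF assms] by blast
  have "norm (f y - f x) < e" if "p \<le> x" "x \<le> y" "y \<le> q" "y - x < d" for x y
    using d(2)[of 1 "\<lambda>_. x" "\<lambda>_. y"] that by (simp add: disjoint_family_on_def)
  then show ?thesis using that d(1) by blast
qed

definition chain_in :: "real \<Rightarrow> real \<Rightarrow> nat \<Rightarrow> (nat \<Rightarrow> real) \<Rightarrow> bool" where
  "chain_in p q n s \<longleftrightarrow> (\<forall>i\<le>n. s i \<in> {p..q}) \<and> (\<forall>i<n. s i \<le> s (Suc i))"

lemma chain_in_mono: "chain_in p q n s \<Longrightarrow> i \<le> j \<Longrightarrow> j \<le> n \<Longrightarrow> s i \<le> s j"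
proof (induction j)
  case (Suc j)
  show ?case
  proof (cases "i = Suc j")
    case False
    then have "s i \<le> s j" using Suc by simp
    also have "s j \<le> s (Suc j)" using Suc.prems by (simp add: chain_in_def)
    finally show ?thesis .
  qed simp
qed simp

text \<open>On intervals shorter than the \<delta> for \<epsilon> = 1 every chain has variation at
  most 1; bisection joins such intervals.\<close>

lemma AC_bounded_variation:
  assumes ac: "AC p q f" and pq: "p \<le> q"
  shows "\<exists>M. \<forall>n s. chain_in p q n s \<longrightarrow> (\<Sum>i<n. norm (f (s (Suc i)) - f (s i))) \<le> M"
proof -
  define P where "P a b \<longleftrightarrow> (p \<le> a \<and> b \<le> q \<longrightarrow> (\<exists>M. \<forall>n s. chain_in a b n s \<longrightarrow> (\<Sum>i<n. norm (f (s (Suc i)) - f (s i))) \<le> M))" for a b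
  have "P p q" using pq
  proof (rule Bolzano)
    fix a b c assume ab: "P a b" and bc: "P b c" and abc: "a \<le> b" "b \<le> c"
    show "P a c" unfolding P_def
    proof
      assume ac: "p \<le> a \<and> c \<le> q"
      obtain M1 where M1: "\<And>n s. chain_in a b n s \<Longrightarrow> (\<Sum>i<n. norm (f (s (Suc i)) - f (s i))) \<le> M1"
        using ab ac abc unfolding P_def by auto
      obtain M2 where M2: "\<And>n s. chain_in b c n s \<Longrightarrow> (\<Sum>i<n. norm (f (s (Suc i)) - f (s i))) \<le> M2"
        using bc ac abc unfolding P_def by auto
      show "\<exists>M. \<forall>n s. chain_in a c n s \<longrightarrow> (\<Sum>i<n. norm (f (s (Suc i)) - f (s i))) \<le> M"
      proof (intro exI[of _ "M1 + M2"] allI impI)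
        fix n s assume ch: "chain_in a c n s"
        \<comment> \<open>Truncating all nodes at \<open>b\<close> from above and from below splits
          the chain without inserting a node; repeated nodes contribute zero.\<close>
        have "chain_in a b n (\<lambda>i. min (s i) b)" "chain_in b c n (\<lambda>i. max (s i) b)"
          using ch abc unfolding chain_in_def by (auto simp: min_def max_def)
        note m = M1[OF this(1)] M2[OF this(2)]
        have "(\<Sum>i<n. norm (f (s (Suc i)) - f (s i))) \<le>
          (\<Sum>i<n. norm (f (min (s (Suc i)) b) - f (min (s i) b)) + norm (f (max (s (Suc i)) b) - f (max (s i) b)))"
        proof (rule sum_mono)
          fix i assume "i \<in> {..<n}"
          then have le: "s i \<le> s (Suc i)" using ch by (auto simp: chain_in_def)
          have "f (s (Suc i)) - f (s i) = (f (min (s (Suc i)) b) - f (min (s i) b)) + (f (max (s (Suc i)) b) - f (max (s i) b))"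
            using le by (auto simp: min_def max_def)
          then show "norm (f (s (Suc i)) - f (s i)) \<le> norm (f (min (s (Suc i)) b) - f (min (s i) b)) + norm (f (max (s (Suc i)) b) - f (max (s i) b))"
            by (metis norm_triangle_ineq)
        qed
        also have "\<dots> \<le> M1 + M2" using m by (simp add: sum.distrib)
        finally show "(\<Sum>i<n. norm (f (s (Suc i)) - f (s i))) \<le> M1 + M2" .
      qed
    qed
  next
    fix x assume "p \<le> x" "x \<le> q"
    obtain d where d: "d > 0" "\<And>(n::nat) a b. (\<And>i. i < n \<Longrightarrow> p \<le> a i \<and> a i \<le> b i \<and> b i \<le> q) \<Longrightarrow>
       disjoint_family_on (\<lambda>i. {a i<..<b i}) {..<n} \<Longrightarrow> (\<Sum>i<n. b i - a i) < d \<Longrightarrow>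
       (\<Sum>i<n. norm (f (b i) - f (a i))) < 1"
      using AC_D[OF ac zero_less_one] by blast
    show "\<exists>d>0. \<forall>a b. a \<le> x \<and> x \<le> b \<and> b - a < d \<longrightarrow> P a b"
    proof (intro exI[of _ d] conjI allI impI d(1), elim conjE)
      fix a b assume ab: "a \<le> x" "x \<le> b" "b - a < d"
      show "P a b" unfolding P_def
      proof (intro impI exI[of _ 1] allI)
        fix n s assume pab: "p \<le> a \<and> b \<le> q" and ch: "chain_in a b n s"
        have "(\<Sum>i<n. norm (f (s (Suc i)) - f (s i))) < 1"
        proof (rule d(2))
          show "p \<le> s i \<and> s i \<le> s (Suc i) \<and> s (Suc i) \<le> q" if "i < n" for i
          proof -
            have "s i \<in> {a..b}" "s (Suc i) \<in> {a..b}" "s i \<le> s (Suc i)" using ch that by (auto simp: chain_in_def)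
            then show ?thesis using pab by auto
          qed
          show "disjoint_family_on (\<lambda>i. {s i<..<s (Suc i)}) {..<n}"
            unfolding disjoint_family_on_def
          proof (intro ballI impI)
            fix i j assume ij: "i \<in> {..<n}" "j \<in> {..<n}" "i \<noteq> j"
            consider "Suc i \<le> j" | "Suc j \<le> i" using ij by linarith
            then show "{s i<..<s (Suc i)} \<inter> {s j<..<s (Suc j)} = {}"
            proof cases
              case 1
              then show ?thesis using chain_in_mono[OF ch 1] ij by auto
            next
              case 2
              then show ?thesis using chain_in_mono[OF ch 2] ij by auto
            qed
          qed
          have "s n \<in> {a..b}" "s 0 \<in> {a..b}" using ch unfolding chain_in_def by auto
          then show "(\<Sum>i<n. s (Suc i) - s i) < d" using ab by (simp add: sum_lessThan_telescope)
        qed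
        then show "(\<Sum>i<n. norm (f (s (Suc i)) - f (s i))) \<le> 1" by simp
      qed
    qed
  qed
  then show ?thesis by (simp add: P_def)
qed

text \<open>The components are countably many open intervals; idle indices receive the empty
  interval from \<open>p\<close> to \<open>p\<close>.\<close>

lemma open_real_disjoint_intervals:
  assumes U: "open U" "U \<subseteq> {p<..<q::real}" and pq: "p < q"
  shows "\<exists>a b. disjoint_family (\<lambda>i::nat. {a i<..<b i}) \<and> U = (\<Union>i. {a i<..<b i}) \<and> (\<forall>i. p \<le> a i \<and> a i \<le> b i \<and> b i \<le> q)"
proof -
  let ?C = "components U"
  have op: "open I" if "I \<in> ?C" for I using open_components[OF U(1) that] .
  have pw: "pairwise disjnt ?C" using pairwise_disjoint_components by (auto simp: pairwise_def disjnt_def)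
  have cnt: "countable ?C" by (rule countable_disjoint_open_subsets[OF op pw])
  have form: "\<exists>a b. I = {a<..<b} \<and> p \<le> a \<and> a \<le> b \<and> b \<le> q" if I: "I \<in> ?C" for I
  proof (intro exI conjI)
    have ne: "I \<noteq> {}" using in_components_nonempty[OF I] .
    have sub: "I \<subseteq> {p<..<q}" using in_components_subset[OF I] U(2) by blast
    have bd: "bdd_below I" "bdd_above I"
      by (rule bdd_belowI[of _ p], use sub in force) (rule bdd_aboveI[of _ q], use sub in force)
    have int: "x \<in> I" if "y \<in> I" "z \<in> I" "y \<le> x" "x \<le> z" for x y z
      using in_components_connected[OF I] that by (meson connectedD_interval)
    show "I = {Inf I<..<Sup I}"
    proof (intro equalityI subsetI)
      fix x assume x: "x \<in> I"
      then obtain d where d: "d > 0" "ball x d \<subseteq> I" using op[OF I] openE by blast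
      have "x - d/2 \<in> I" "x + d/2 \<in> I" using d by (auto simp: subset_iff dist_real_def)
      then have "Inf I \<le> x - d/2" "x + d/2 \<le> Sup I" using bd by (auto intro: cInf_lower cSup_upper)
      then show "x \<in> {Inf I<..<Sup I}" using d by auto
    next
      fix x assume x: "x \<in> {Inf I<..<Sup I}"
      obtain y where "y \<in> I" "y < x" using x cInf_less_iff[OF ne bd(1)] by auto
      moreover obtain z where "z \<in> I" "x < z" using x less_cSup_iff[OF ne bd(2)] by auto
      ultimately show "x \<in> I" using int by (meson less_imp_le)
    qed
    show "p \<le> Inf I" using ne sub by (intro cInf_greatest) (auto intro: less_imp_le)
    show "Sup I \<le> q" using ne sub by (intro cSup_least) (auto intro: less_imp_le)
    obtain x where "x \<in> I" using ne by blast
    then show "Inf I \<le> Sup I" using bd by (meson cInf_lower cSup_upper order_trans)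
  qed
  have "\<exists>a b. \<Union>(ptset ?C n) = {a<..<b} \<and> p \<le> a \<and> a \<le> b \<and> b \<le> q" for n
  proof (cases "ptset ?C n = {}")
    case True
    then show ?thesis using pq by (intro exI[of _ p]) auto
  next
    case False
    then obtain I where "I \<in> ?C" "ptset ?C n = {I}" using ptset(3)[OF cnt, of n] by blast
    then show ?thesis using form[of I] by simp
  qed
  then obtain a b where ab: "\<And>n. \<Union>(ptset ?C n) = {a n<..<b n} \<and> p \<le> a n \<and> a n \<le> b n \<and> b n \<le> q" by metis
  have "disjoint_family (\<lambda>n. {a n<..<b n})"
    unfolding disjoint_family_on_def
  proof (intro ballI impI)
    fix m n :: nat assume "m \<noteq> n"
    then have pm: "ptset ?C m \<inter> ptset ?C n = {}" using ptset(2)[OF cnt] by (auto simp: disjoint_family_on_def)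
    have "I \<inter> I' = {}" if "I \<in> ptset ?C m" "I' \<in> ptset ?C n" for I I'
    proof -
      have "I \<in> ?C" "I' \<in> ?C" using that by (auto simp: ptset_def)
      moreover have "I \<noteq> I'" using that pm by blast
      ultimately show ?thesis using pairwiseD[OF pw] by (simp add: disjnt_def)
    qed
    then have "\<Union>(ptset ?C m) \<inter> \<Union>(ptset ?C n) = {}" by blast
    then show "{a m<..<b m} \<inter> {a n<..<b n} = {}" using ab by simp
  qed
  moreover have "U = (\<Union>n. {a n<..<b n})"
  proof -
    have "(\<Union>n. {a n<..<b n}) = (\<Union>n. \<Union>(ptset ?C n))" using ab by simp
    also have "\<dots> = \<Union>(\<Union>n. ptset ?C n)" by blast
    also have "\<dots> = U" using ptset(1)[OF cnt] by simp
    finally show ?thesis ..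
  qed
  ultimately show ?thesis using ab by (intro exI[of _ a] exI[of _ b] conjI allI) simp_all
qed

text \<open>The Stieltjes measure of \<open>f\<close> vanishes on Lebesgue null sets, since these
  have covers by disjoint intervals of small total length, on which absolute continuity bounds the
  increments. Its density is the derivative almost everywhere by Lebesgue differentiation.\<close>

lemma AC_FTC:
  fixes f :: "real \<Rightarrow> real"
  assumes ac: "AC p q f" and pq: "p < q"
  shows "\<exists>g. integrable lborel g \<and> (AE x in lborel. x \<in> {p<..<q} \<longrightarrow> (f has_real_derivative g x) (at x)) \<and>
    (LINT t:{p..q}|lborel. g t) = f q - f p"
proof -
  obtain V M where V: "\<And>a b. p \<le> a \<Longrightarrow> a \<le> b \<Longrightarrow> b \<le> q \<Longrightarrow> norm (f b - f a) \<le> V b - V a"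
    "\<And>t. t \<in> {p..q} \<Longrightarrow> 0 \<le> V t \<and> V t \<le> (M::real)"
    using variation_dominating[of p q f] AC_bounded_variation[OF ac] pq unfolding chain_in_def by fastforce
  define cl where "cl t = max p (min q t)" for t
  have cl: "cl t \<in> {p..q}" "a \<le> b \<Longrightarrow> cl a \<le> cl b" "t \<in> {p..q} \<Longrightarrow> cl t = t" "\<bar>cl a - cl b\<bar> \<le> \<bar>a - b\<bar>" for t a b
    using pq by (auto simp: cl_def)
  interpret fr: fin_coords "{1::real}" "\<lambda>_ x. x" by (rule fin_coords_real)
  interpret S: bvf_coords "\<lambda>t. f (cl t)" "\<lambda>t. V (cl t)" M "{1::real}" "\<lambda>_ x. x"
  proof
    show "norm (f (cl b) - f (cl a)) \<le> V (cl b) - V (cl a)" if "a \<le> b" for a b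
      using cl(1)[of a] cl(1)[of b] cl(2)[OF that] by (intro V(1)) auto
    show "\<bar>V (cl t)\<bar> \<le> M" for t using V(2)[OF cl(1)[of t]] by auto
  qed
  have cont: "isCont (\<lambda>t. f (cl t)) t" for t
    unfolding continuous_at_eps_delta
  proof (intro allI impI)
    fix e :: real assume "e > 0"
    then obtain d where d: "d > 0" "\<And>x y. p \<le> x \<Longrightarrow> x \<le> y \<Longrightarrow> y \<le> q \<Longrightarrow> y - x < d \<Longrightarrow> norm (f y - f x) < e"
      using AC_continuous[OF ac] by blast
    show "\<exists>d>0. \<forall>x'. dist x' t < d \<longrightarrow> dist (f (cl x')) (f (cl t)) < e"
    proof (intro exI[of _ d] conjI d(1) allI impI)
      fix x assume "dist x t < d"
      then have "\<bar>cl x - cl t\<bar> < d" using cl(4)[of x t] by (simp add: dist_real_def)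
      then show "dist (f (cl x)) (f (cl t)) < e"
        using d(2)[of "cl x" "cl t"] d(2)[of "cl t" "cl x"] cl(1)[of x] cl(1)[of t]
        by (cases "cl x \<le> cl t") (auto simp: dist_real_def abs_minus_commute)
    qed
  qed
  have lims: "rlim (\<lambda>t. f (cl t)) t = f (cl t)" "llim (\<lambda>t. f (cl t)) t = f (cl t)" for t
    using cont[of t] by (auto simp: isCont_def filterlim_at_split intro!: tendsto_Lim)
  have nu_Ioo: "S.nu0 {a<..<b} = f b - f a" if "p \<le> a" "a \<le> b" "b \<le> q" for a b
    using that S.nu0_Ioo[of a b] cl(3)[of a] cl(3)[of b] lims cadd_empty[OF S.cadd_nu0] by (cases "a = b") auto
  define \<nu> where "\<nu> A = S.nu0 (A \<inter> {p<..<q})" for A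
  have c\<nu>: "cadd \<nu>" unfolding \<nu>_def[abs_def] by (intro cadd_restrict S.cadd_nu0) simp
  interpret VV: finite_measure "vm_variation \<nu>" by (rule fr.finite_vm_variation[OF c\<nu>])
  have null: "\<nu> N = 0" if N: "N \<in> sets borel" "emeasure lborel (N \<inter> {p..q}) = 0" for N
  proof -
    let ?N = "N \<inter> {p<..<q}"
    have Nb: "?N \<in> sets borel" using N by auto
    have N0: "emeasure lborel ?N = 0"
    proof -
      have "?N \<subseteq> N \<inter> {p..q}" by auto
      then show ?thesis using emeasure_mono[of ?N "N \<inter> {p..q}" lborel] N by simp
    qed
    have "\<bar>\<nu> ?N\<bar> \<le> 0 + e" if e: "e > 0" for e
    proof -
      obtain d where d: "d > 0" "\<And>(n::nat) a b. (\<And>i. i < n \<Longrightarrow> p \<le> a i \<and> a i \<le> b i \<and> b i \<le> q) \<Longrightarrow>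
         disjoint_family_on (\<lambda>i. {a i<..<b i}) {..<n} \<Longrightarrow> (\<Sum>i<n. b i - a i) < d \<Longrightarrow>
         (\<Sum>i<n. norm (f (b i) - f (a i))) < e / 2"
        using AC_D[OF ac half_gt_zero[OF e]] by blast
      obtain U1 where U1: "open U1" "?N \<subseteq> U1" "measure (vm_variation \<nu>) (U1 - ?N) < e / 2"
        using finite_outer_open[OF VV.finite_measure_axioms sets_vm_variation Nb half_gt_zero[OF e]] by blast
      obtain U2 where U2: "open U2" "?N \<subseteq> U2" "emeasure lborel (U2 - ?N) < ennreal d"
        using outer_regular_lborel[OF Nb d(1)] by blast
      \<comment> \<open>\<open>U1\<close> makes the measure of what is added to the null set small,
        \<open>U2\<close> makes the total length small.\<close>
      define U where "U = U1 \<inter> U2 \<inter> {p<..<q}"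
      have U: "open U" "U \<subseteq> {p<..<q}" "?N \<subseteq> U" unfolding U_def using U1 U2 by auto
      have Ub: "U \<in> sets borel" using U(1) by simp
      obtain a b where ab: "disjoint_family (\<lambda>i::nat. {a i<..<b i})" "U = (\<Union>i. {a i<..<b i})"
        "\<And>i. p \<le> a i \<and> a i \<le> b i \<and> b i \<le> q" using open_real_disjoint_intervals[OF U(1,2) pq] by blast
      have eU: "emeasure lborel U < ennreal d"
      proof -
        have "emeasure lborel U \<le> emeasure lborel ((U2 - ?N) \<union> ?N)"
          using U U2(1) Nb by (intro emeasure_mono) (auto simp: U_def)
        also have "\<dots> \<le> emeasure lborel (U2 - ?N) + emeasure lborel ?N"
          using U2(1) Nb by (intro emeasure_subadditive) auto
        finally show ?thesis using U2(3) N0 by simp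
      qed
      have part: "(\<Sum>i<n. norm (f (b i) - f (a i))) < e / 2" for n
      proof (rule d(2))
        show "p \<le> a i \<and> a i \<le> b i \<and> b i \<le> q" for i by (rule ab(3))
        show dj: "disjoint_family_on (\<lambda>i. {a i<..<b i}) {..<n}"
          using ab(1) by (auto simp: disjoint_family_on_def)
        have "ennreal (\<Sum>i<n. b i - a i) = (\<Sum>i<n. emeasure lborel {a i<..<b i})"
          using ab(3) by (simp add: sum_ennreal)
        also have "\<dots> = emeasure lborel (\<Union>i<n. {a i<..<b i})"
          using dj by (intro sum_emeasure) auto
        also have "\<dots> \<le> emeasure lborel U" using ab(2) Ub by (intro emeasure_mono) auto
        finally have "ennreal (\<Sum>i<n. b i - a i) < ennreal d" using eU by simp
        then show "(\<Sum>i<n. b i - a i) < d"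
          using ab(3) by (subst (asm) ennreal_less_iff) (auto intro!: sum_nonneg)
      qed
      have \<nu>ab: "\<nu> {a i<..<b i} = f (b i) - f (a i)" for i
      proof -
        have "{a i<..<b i} \<inter> {p<..<q} = {a i<..<b i}" using ab(3)[of i] by auto
        then show ?thesis unfolding \<nu>_def using nu_Ioo[of "a i" "b i"] ab(3)[of i] by simp
      qed
      have "(\<lambda>n. \<bar>\<Sum>i<n. \<nu> {a i<..<b i}\<bar>) \<longlonglongrightarrow> \<bar>\<nu> U\<bar>"
        using cadd_sums[OF c\<nu>, of "\<lambda>i. {a i<..<b i}"] ab(1,2) unfolding sums_def by (intro tendsto_rabs) auto
      moreover have "\<bar>\<Sum>i<n. \<nu> {a i<..<b i}\<bar> \<le> e / 2" for n
        unfolding \<nu>ab using part[of n] sum_abs[of "\<lambda>i. f (b i) - f (a i)" "{..<n}"]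
        unfolding real_norm_def by linarith
      ultimately have 1: "\<bar>\<nu> U\<bar> \<le> e / 2" by (intro LIMSEQ_le_const2) auto
      have "\<bar>\<nu> (U - ?N)\<bar> \<le> measure (vm_variation \<nu>) (U - ?N)"
        using fr.norm_le_measure_variation[OF c\<nu>, of "U - ?N"] Ub Nb by auto
      also have "\<dots> \<le> measure (vm_variation \<nu>) (U1 - ?N)"
        using U1(1) Nb by (intro VV.finite_measure_mono) (auto simp: U_def)
      finally have "\<bar>\<nu> (U - ?N)\<bar> \<le> e / 2" using U1(3) by simp
      moreover have "\<nu> (U - ?N) = \<nu> U - \<nu> ?N" by (rule cadd_Diff[OF c\<nu> Ub Nb U(3)])
      ultimately show ?thesis using 1 by linarith
    qed
    then have "\<bar>\<nu> ?N\<bar> \<le> 0" by (rule field_le_epsilon)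
    moreover have "\<nu> ?N = \<nu> N" by (simp add: \<nu>_def Int_assoc)
    ultimately show ?thesis by simp
  qed
  \<comment> \<open>Lebesgue measure cut down to [p,q], because the density theorem is stated for
    finite measures.\<close>
  define L where "L = density lborel (\<lambda>t. indicator {p..q} t)"
  have eL: "emeasure L A = emeasure lborel (A \<inter> {p..q})" if "A \<in> sets borel" for A
    unfolding L_def using that by (simp add: emeasure_density Int_commute flip: indicator_inter_arith)
  have Ls: "sets L = sets borel" by (simp add: L_def)
  have Lf: "finite_measure L"
  proof (rule finite_measureI)
    have "emeasure L (space L) = emeasure lborel {p..q}" by (subst eL) (auto simp: L_def)
    then show "emeasure L (space L) \<noteq> \<infinity>" using pq by simp
  qed
  have "\<nu> A = 0" if A: "A \<in> null_sets L" for A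
  proof -
    have "A \<in> sets borel" "emeasure L A = 0" using A Ls by auto
    then show ?thesis using null[of A] eL[of A] by simp
  qed
  then obtain g0 where g0: "integrable L g0" "\<And>A. A \<in> sets borel \<Longrightarrow> \<nu> A = (LINT t:A|L. g0 t)"
    using fr.vm_RN[OF c\<nu> Lf Ls] by blast
  have g0m [measurable]: "g0 \<in> borel_measurable borel" using borel_measurable_integrable[OF g0(1)] by (simp add: L_def)
  define g where "g t = indicator {p..q} t * g0 t" for t
  have Lreal: "L = density lborel (\<lambda>t. ennreal (indicator {p..q} t))" unfolding L_def by (simp add: ennreal_indicator)
  have gi: "integrable lborel g"
    using g0(1) unfolding Lreal g_def by (subst (asm) integrable_density) auto
  have gint: "\<nu> A = (LINT t:A|lborel. g t)" if A: "A \<in> sets borel" for A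
  proof -
    have "\<nu> A = (LINT t|lborel. indicator {p..q} t *\<^sub>R (indicator A t *\<^sub>R g0 t))"
      unfolding g0(2)[OF A] set_lebesgue_integral_def Lreal using A by (subst integral_density) auto
    then show ?thesis by (simp add: set_lebesgue_integral_def g_def mult_ac)
  qed
  have incr: "f z - f y = (LINT t:{y..z}|lborel. g t)" if yz: "p \<le> y" "y \<le> z" "z \<le> q" for y z
  proof -
    have "{y<..<z} \<inter> {p<..<q} = {y<..<z}" using yz by auto
    then have "f z - f y = \<nu> {y<..<z}" using nu_Ioo[OF yz] by (simp add: \<nu>_def)
    also have "\<nu> {y<..<z} = \<nu> {y..z}"
    proof (cases "y = z")
      case True
      then show ?thesis using null[of "{z}"] emeasure_mono[of "{z} \<inter> {p..q}" "{z}" lborel] cadd_empty[OF c\<nu>] by auto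
    next
      case False
      have "\<nu> ({y..z} - {y, z}) = \<nu> {y..z} - \<nu> {y, z}" using yz by (intro cadd_Diff[OF c\<nu>]) auto
      moreover have "{y..z} - {y, z} = {y<..<z}" by auto
      moreover have "\<nu> {y, z} = 0"
        using emeasure_mono[of "{y, z} \<inter> {p..q}" "{y, z}" lborel] countable_imp_null_set_lborel[of "{y, z}"]
        by (intro null) (auto simp: null_sets_def)
      ultimately show ?thesis by simp
    qed
    also have "\<dots> = (LINT t:{y..z}|lborel. g t)" by (rule gint) simp
    finally show ?thesis .
  qed
  show ?thesis
  proof (intro exI conjI)
    show "AE x in lborel. x \<in> {p<..<q} \<longrightarrow> (f has_real_derivative g x) (at x)"
      by (rule lebesgue_differentiation[OF gi pq incr])
    show "(LINT t:{p..q}|lborel. g t) = f q - f p" using incr[of p q] pq by simp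
  qed (rule gi)
qed

section \<open>The Finsler cost\<close>

locale viscosity =
  fixes Psi :: "'a::real_normed_vector \<Rightarrow> real"
  assumes Psi_nonneg: "Psi v \<ge> 0" and Psi_zero: "Psi 0 = 0"
    and Psi_superlinear: "filterlim (\<lambda>v. Psi v / norm v) at_top at_infinity"
begin

text \<open>Superlinearity lets \<open>Psi\<close> dominate the functional outside a ball. Inside,
  the norm of e v is bounded, so that of v is at most a constant over e. The bound serves twice: for
  fixed e the real supremum is finite, and for large e it is small.\<close>

lemma legendre_bound:
  obtains R where "R \<ge> 0" "\<And>e v. e > 0 \<Longrightarrow> blinfun_apply w v - Psi_eps Psi e v \<le> R / e"
proof -
  have "\<forall>\<^sub>F v in at_infinity. norm w \<le> Psi v / norm v"
    using Psi_superlinear by (simp add: filterlim_at_top)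
  then obtain b where b: "\<And>v. b \<le> norm v \<Longrightarrow> norm w \<le> Psi v / norm v" by (auto simp: eventually_at_infinity)
  define R where "R = max b 1"
  have R: "R > 0" "\<And>v. R \<le> norm v \<Longrightarrow> norm w * norm v \<le> Psi v"
  proof -
    show "R > 0" by (simp add: R_def)
    fix v :: 'a assume "R \<le> norm v"
    then have "norm v > 0" "b \<le> norm v" by (auto simp: R_def)
    then show "norm w * norm v \<le> Psi v" using b[of v] by (simp add: le_divide_eq)
  qed
  have "blinfun_apply w v - Psi_eps Psi e v \<le> (norm w * R) / e" if e: "e > 0" for e v
  proof (cases "R \<le> norm (e *\<^sub>R v)")
    case True
    then have "norm w * (e * norm v) \<le> Psi (e *\<^sub>R v)" using R(2)[of "e *\<^sub>R v"] e by simp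
    then have "norm w * norm v \<le> Psi_eps Psi e v" using e by (simp add: Psi_eps_def le_divide_eq mult_ac)
    moreover have "blinfun_apply w v \<le> norm w * norm v" using norm_blinfun[of w v] by simp
    ultimately have "blinfun_apply w v - Psi_eps Psi e v \<le> 0" by simp
    also have "\<dots> \<le> (norm w * R) / e" using e R(1) by simp
    finally show ?thesis .
  next
    case False
    then have "norm v \<le> R / e" using e by (simp add: le_divide_eq mult.commute)
    then have "norm w * norm v \<le> norm w * (R / e)" by (intro mult_left_mono) auto
    moreover have "blinfun_apply w v \<le> norm w * norm v" using norm_blinfun[of w v] by simp
    moreover have "Psi_eps Psi e v \<ge> 0" using Psi_nonneg e by (simp add: Psi_eps_def)
    ultimately show ?thesis by simp
  qed
  then show ?thesis using that[of "norm w * R"] R(1) by simp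
qed

lemma fenchel:
  assumes e: "e > 0"
  shows "blinfun_apply w v \<le> Psi_eps Psi e v + legendre_conj (Psi_eps Psi e) w"
proof -
  obtain R where R: "\<And>e v. e > 0 \<Longrightarrow> blinfun_apply w v - Psi_eps Psi e v \<le> R / e" using legendre_bound by blast
  have "bdd_above (range (\<lambda>v. blinfun_apply w v - Psi_eps Psi e v))"
    using R[OF e] by (intro bdd_aboveI[of _ "R / e"]) auto
  then have "blinfun_apply w v - Psi_eps Psi e v \<le> legendre_conj (Psi_eps Psi e) w"
    unfolding legendre_conj_def by (rule cSUP_upper[OF UNIV_I])
  then show ?thesis by simp
qed

lemma contact_ge: "blinfun_apply w v \<le> contact_potential Psi v w"
  unfolding contact_potential_def
  by (rule cINF_greatest) (use fenchel zero_less_one in \<open>auto intro!: exI[of _ 1]\<close>)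

text \<open>At zero velocity only the conjugate remains, and it tends to zero as the viscosity
  parameter grows.\<close>

lemma contact_zero: "contact_potential Psi 0 w = 0"
proof (rule antisym)
  obtain R where R: "R \<ge> 0" "\<And>e v. e > 0 \<Longrightarrow> blinfun_apply w v - Psi_eps Psi e v \<le> R / e" using legendre_bound by blast
  have bdd: "bdd_below ((\<lambda>e. Psi_eps Psi e 0 + legendre_conj (Psi_eps Psi e) w) ` {0<..})"
    using fenchel[of _ w 0] by (intro bdd_belowI[of _ 0]) (auto simp: blinfun.zero_right)
  have "contact_potential Psi 0 w \<le> 0 + d" if d: "d > 0" for d
  proof -
    \<comment> \<open>Large enough for R / e \<le> d; the summand 1 keeps it positive when
      \<open>R\<close> is zero.\<close>
    define e where "e = (R + 1) / d"
    have e: "e > 0" using R d by (simp add: e_def)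
    have "contact_potential Psi 0 w \<le> Psi_eps Psi e 0 + legendre_conj (Psi_eps Psi e) w"
      unfolding contact_potential_def using e by (intro cINF_lower[OF bdd]) simp
    also have "Psi_eps Psi e 0 = 0" by (simp add: Psi_eps_def Psi_zero)
    also have "legendre_conj (Psi_eps Psi e) w \<le> R / e"
      unfolding legendre_conj_def using R(2)[OF e] by (intro cSUP_least) auto
    also have "R / e \<le> d" using R(1) d by (simp add: e_def divide_simps mult_ac)
    finally show ?thesis by simp
  qed
  then show "contact_potential Psi 0 w \<le> 0" by (rule field_le_epsilon)
  show "0 \<le> contact_potential Psi 0 w" using contact_ge[of w 0] by (simp add: blinfun.zero_right)
qed

end

section \<open>Operations on absolutely continuous curves\<close>

lemma AC_lipschitz:
  assumes ac: "AC p q f" and K: "K > 0" and le: "\<And>x y. x \<in> {p..q} \<Longrightarrow> y \<in> {p..q} \<Longrightarrow> norm (g y - g x) \<le> K * norm (f y - f x)"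
  shows "AC p q g"
  unfolding AC_def
proof (intro allI impI)
  fix e :: real assume e: "e > 0"
  then have eK: "e / K > 0" using K by simp
  obtain d where d: "d > 0" "\<And>(n::nat) a b. (\<And>i. i < n \<Longrightarrow> p \<le> a i \<and> a i \<le> b i \<and> b i \<le> q) \<Longrightarrow>
     disjoint_family_on (\<lambda>i. {a i<..<b i}) {..<n} \<Longrightarrow> (\<Sum>i<n. b i - a i) < d \<Longrightarrow>
     (\<Sum>i<n. norm (f (b i) - f (a i))) < e / K"
    using AC_D[OF ac eK] by blast
  show "\<exists>\<delta>>0. \<forall>(n::nat) a b. (\<forall>i<n. p \<le> a i \<and> a i \<le> b i \<and> b i \<le> q) \<and>
     disjoint_family_on (\<lambda>i. {a i<..<b i}) {..<n} \<and> (\<Sum>i<n. b i - a i) < \<delta> \<longrightarrow>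
     (\<Sum>i<n. norm (g (b i) - g (a i))) < e"
  proof (intro exI[of _ d] conjI d(1) allI impI)
    fix n :: nat and a b :: "nat \<Rightarrow> real"
    assume *: "(\<forall>i<n. p \<le> a i \<and> a i \<le> b i \<and> b i \<le> q) \<and> disjoint_family_on (\<lambda>i. {a i<..<b i}) {..<n} \<and> (\<Sum>i<n. b i - a i) < d"
    have "(\<Sum>i<n. norm (g (b i) - g (a i))) \<le> (\<Sum>i<n. K * norm (f (b i) - f (a i)))"
      using * by (intro sum_mono le) (auto intro: order_trans)
    also have "\<dots> = K * (\<Sum>i<n. norm (f (b i) - f (a i)))" by (simp add: sum_distrib_left)
    also have "\<dots> < K * (e / K)" using * K by (intro mult_strict_left_mono d(2)) auto
    finally show "(\<Sum>i<n. norm (g (b i) - g (a i))) < e" using K by simp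
  qed
qed

lemma AC_const: "AC p q (\<lambda>_. x)"
  unfolding AC_def by (auto intro: exI[of _ 1])

lemma AC_cong:
  assumes "AC p q f" "\<And>x. x \<in> {p..q} \<Longrightarrow> g x = f x" shows "AC p q g"
  by (rule AC_lipschitz[OF assms(1), of 1]) (use assms(2) in auto)

lemma AC_bounded:
  assumes ac: "AC p q f" and pq: "p \<le> q"
  obtains R where "\<And>x. x \<in> {p..q} \<Longrightarrow> norm (f x) \<le> R"
proof -
  obtain M where M: "\<And>n s. chain_in p q n s \<Longrightarrow> (\<Sum>i<n. norm (f (s (Suc i)) - f (s i))) \<le> M"
    using AC_bounded_variation[OF assms] by blast
  have "norm (f x) \<le> norm (f p) + M" if x: "x \<in> {p..q}" for x
  proof -
    have "chain_in p q 1 (\<lambda>i. if i = 0 then p else x)" using x by (auto simp: chain_in_def)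
    from M[OF this] have "norm (f x - f p) \<le> M" by simp
    then show ?thesis by norm
  qed
  then show ?thesis using that by blast
qed

lemma AC_shift:
  assumes "AC p q f" shows "AC (p + s) (q + s) (\<lambda>r. f (r - s))"
  unfolding AC_def
proof (intro allI impI)
  fix e :: real assume e: "e > 0"
  obtain d where d: "d > 0" "\<And>(n::nat) a b. (\<And>i. i < n \<Longrightarrow> p \<le> a i \<and> a i \<le> b i \<and> b i \<le> q) \<Longrightarrow>
     disjoint_family_on (\<lambda>i. {a i<..<b i}) {..<n} \<Longrightarrow> (\<Sum>i<n. b i - a i) < d \<Longrightarrow>
     (\<Sum>i<n. norm (f (b i) - f (a i))) < e"
    using AC_D[OF assms e] by blast
  show "\<exists>\<delta>>0. \<forall>(n::nat) a b. (\<forall>i<n. p + s \<le> a i \<and> a i \<le> b i \<and> b i \<le> q + s) \<and>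
     disjoint_family_on (\<lambda>i. {a i<..<b i}) {..<n} \<and> (\<Sum>i<n. b i - a i) < \<delta> \<longrightarrow>
     (\<Sum>i<n. norm (f (b i - s) - f (a i - s))) < e"
  proof (intro exI[of _ d] conjI d(1) allI impI)
    fix n :: nat and a b :: "nat \<Rightarrow> real"
    assume *: "(\<forall>i<n. p + s \<le> a i \<and> a i \<le> b i \<and> b i \<le> q + s) \<and> disjoint_family_on (\<lambda>i. {a i<..<b i}) {..<n} \<and> (\<Sum>i<n. b i - a i) < d"
    show "(\<Sum>i<n. norm (f (b i - s) - f (a i - s))) < e"
    proof (rule d(2))
      show "p \<le> a i - s \<and> a i - s \<le> b i - s \<and> b i - s \<le> q" if "i < n" for i using * that by (auto simp: algebra_simps)
      show "(\<Sum>i<n. (b i - s) - (a i - s)) < d" using * by simp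
      show "disjoint_family_on (\<lambda>i. {a i - s<..<b i - s}) {..<n}"
        unfolding disjoint_family_on_def
      proof (intro ballI impI)
        fix i j assume "i \<in> {..<n}" "j \<in> {..<n}" "i \<noteq> j"
        then have dj: "{a i<..<b i} \<inter> {a j<..<b j} = {}" using * by (auto simp: disjoint_family_on_def)
        have False if "x \<in> {a i - s<..<b i - s} \<inter> {a j - s<..<b j - s}" for x
        proof -
          have "x + s \<in> {a i<..<b i} \<inter> {a j<..<b j}" using that by auto
          then show False using dj by blast
        qed
        then show "{a i - s<..<b i - s} \<inter> {a j - s<..<b j - s} = {}" by blast
      qed
    qed
  qed
qed

text \<open>Truncation at \<open>m\<close> by \<open>min\<close> and \<open>max\<close> splits each
  interval into one on either side; disjointness is kept and lengths do not grow.\<close>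

lemma AC_join:
  assumes ac1: "AC p m f" and ac2: "AC m q f" and pm: "p \<le> m" "m \<le> q"
  shows "AC p q f"
  unfolding AC_def
proof (intro allI impI)
  fix e :: real assume e: "e > 0"
  obtain d1 where d1: "d1 > 0" "\<And>(n::nat) a b. (\<And>i. i < n \<Longrightarrow> p \<le> a i \<and> a i \<le> b i \<and> b i \<le> m) \<Longrightarrow>
     disjoint_family_on (\<lambda>i. {a i<..<b i}) {..<n} \<Longrightarrow> (\<Sum>i<n. b i - a i) < d1 \<Longrightarrow>
     (\<Sum>i<n. norm (f (b i) - f (a i))) < e / 2"
    using AC_D[OF ac1 half_gt_zero[OF e]] by blast
  obtain d2 where d2: "d2 > 0" "\<And>(n::nat) a b. (\<And>i. i < n \<Longrightarrow> m \<le> a i \<and> a i \<le> b i \<and> b i \<le> q) \<Longrightarrow>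
     disjoint_family_on (\<lambda>i. {a i<..<b i}) {..<n} \<Longrightarrow> (\<Sum>i<n. b i - a i) < d2 \<Longrightarrow>
     (\<Sum>i<n. norm (f (b i) - f (a i))) < e / 2"
    using AC_D[OF ac2 half_gt_zero[OF e]] by blast
  show "\<exists>\<delta>>0. \<forall>(n::nat) a b. (\<forall>i<n. p \<le> a i \<and> a i \<le> b i \<and> b i \<le> q) \<and>
     disjoint_family_on (\<lambda>i. {a i<..<b i}) {..<n} \<and> (\<Sum>i<n. b i - a i) < \<delta> \<longrightarrow>
     (\<Sum>i<n. norm (f (b i) - f (a i))) < e"
  proof (intro exI[of _ "min d1 d2"] conjI allI impI)
    show "min d1 d2 > 0" using d1 d2 by simp
    fix n :: nat and a b :: "nat \<Rightarrow> real"
    assume *: "(\<forall>i<n. p \<le> a i \<and> a i \<le> b i \<and> b i \<le> q) \<and> disjoint_family_on (\<lambda>i. {a i<..<b i}) {..<n} \<and> (\<Sum>i<n. b i - a i) < min d1 d2"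
    have dj: "{a i<..<b i} \<inter> {a j<..<b j} = {}" if "i < n" "j < n" "i \<noteq> j" for i j
      using * that by (auto simp: disjoint_family_on_def)
    have sub: "{min (a i) m<..<min (b i) m} \<subseteq> {a i<..<b i}" "{max (a i) m<..<max (b i) m} \<subseteq> {a i<..<b i}" for i
      by auto
    have s1: "(\<Sum>i<n. norm (f (min (b i) m) - f (min (a i) m))) < e / 2"
    proof (rule d1(2))
      show "p \<le> min (a i) m \<and> min (a i) m \<le> min (b i) m \<and> min (b i) m \<le> m" if "i < n" for i using * that pm by auto
      show "disjoint_family_on (\<lambda>i. {min (a i) m<..<min (b i) m}) {..<n}"
        unfolding disjoint_family_on_def
      proof (intro ballI impI)
        fix i j assume "i \<in> {..<n}" "j \<in> {..<n}" "i \<noteq> j"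
        then have "{a i<..<b i} \<inter> {a j<..<b j} = {}" using dj by simp
        then show "{min (a i) m<..<min (b i) m} \<inter> {min (a j) m<..<min (b j) m} = {}" using sub(1)[of i] sub(1)[of j] by blast
      qed
      have "(\<Sum>i<n. min (b i) m - min (a i) m) \<le> (\<Sum>i<n. b i - a i)" using * by (intro sum_mono) auto
      then show "(\<Sum>i<n. min (b i) m - min (a i) m) < d1" using * by simp
    qed
    have s2: "(\<Sum>i<n. norm (f (max (b i) m) - f (max (a i) m))) < e / 2"
    proof (rule d2(2))
      show "m \<le> max (a i) m \<and> max (a i) m \<le> max (b i) m \<and> max (b i) m \<le> q" if "i < n" for i using * that pm by auto
      show "disjoint_family_on (\<lambda>i. {max (a i) m<..<max (b i) m}) {..<n}"
        unfolding disjoint_family_on_def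
      proof (intro ballI impI)
        fix i j assume "i \<in> {..<n}" "j \<in> {..<n}" "i \<noteq> j"
        then have "{a i<..<b i} \<inter> {a j<..<b j} = {}" using dj by simp
        then show "{max (a i) m<..<max (b i) m} \<inter> {max (a j) m<..<max (b j) m} = {}" using sub(2)[of i] sub(2)[of j] by blast
      qed
      have "(\<Sum>i<n. max (b i) m - max (a i) m) \<le> (\<Sum>i<n. b i - a i)" using * by (intro sum_mono) auto
      then show "(\<Sum>i<n. max (b i) m - max (a i) m) < d2" using * by simp
    qed
    have "(\<Sum>i<n. norm (f (b i) - f (a i))) \<le>
      (\<Sum>i<n. norm (f (min (b i) m) - f (min (a i) m)) + norm (f (max (b i) m) - f (max (a i) m)))"
    proof (rule sum_mono)
      fix i assume "i \<in> {..<n}"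
      then have "a i \<le> b i" using * by auto
      then have "f (b i) - f (a i) = (f (min (b i) m) - f (min (a i) m)) + (f (max (b i) m) - f (max (a i) m))"
        by (auto simp: min_def max_def)
      then show "norm (f (b i) - f (a i)) \<le> norm (f (min (b i) m) - f (min (a i) m)) + norm (f (max (b i) m) - f (max (a i) m))"
        by (metis norm_triangle_ineq)
    qed
    then show "(\<Sum>i<n. norm (f (b i) - f (a i))) < e" using s1 s2 by (simp add: sum.distrib)
  qed
qed

text \<open>Integrands of the Finsler cost need not be measurable, so \<open>nn_integral\<close> is a lower integral here.\<close>

lemma nn_integral_le_split:
  assumes A: "A \<in> sets M"
  shows "integral\<^sup>N M f \<le> (\<integral>\<^sup>+x. f x * indicator A x \<partial>M) + (\<integral>\<^sup>+x. f x * indicator (- A) x \<partial>M)"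
  unfolding nn_integral_def[of M f]
proof (rule SUP_least, clarify)
  fix g assume g: "simple_function M g" "g \<le> f"
  have gm: "g \<in> borel_measurable M" using g(1) by (rule borel_measurable_simple_function)
  have cA: "space M - A \<in> sets M" using A by auto
  have eq: "(\<integral>\<^sup>+x. g x * indicator (- A) x \<partial>M) = (\<integral>\<^sup>+x. g x * indicator (space M - A) x \<partial>M)"
    by (rule nn_integral_cong) (auto split: split_indicator)
  have "integral\<^sup>S M g = (\<integral>\<^sup>+x. g x \<partial>M)" by (rule nn_integral_eq_simple_integral[OF g(1), symmetric])
  also have "\<dots> = (\<integral>\<^sup>+x. g x * indicator A x + g x * indicator (space M - A) x \<partial>M)"
    by (rule nn_integral_cong) (auto split: split_indicator)
  also have "\<dots> = (\<integral>\<^sup>+x. g x * indicator A x \<partial>M) + (\<integral>\<^sup>+x. g x * indicator (- A) x \<partial>M)"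
    unfolding eq using gm A cA by (intro nn_integral_add) auto
  also have "\<dots> \<le> (\<integral>\<^sup>+x. f x * indicator A x \<partial>M) + (\<integral>\<^sup>+x. f x * indicator (- A) x \<partial>M)"
    using g(2) by (intro add_mono nn_integral_mono mult_right_mono) (auto simp: le_fun_def)
  finally show "integral\<^sup>S M g \<le> (\<integral>\<^sup>+x. f x * indicator A x \<partial>M) + (\<integral>\<^sup>+x. f x * indicator (- A) x \<partial>M)" .
qed

text \<open>The substitution is made for each simple minorant, which is measurable even where the
  integrand may fail to be.\<close>

lemma nn_integral_shift_le:
  fixes f :: "real \<Rightarrow> ennreal"
  shows "(\<integral>\<^sup>+x. f (x - s) \<partial>lborel) \<le> (\<integral>\<^sup>+x. f x \<partial>lborel)"
  unfolding nn_integral_def[of lborel "\<lambda>x. f (x - s)"]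
proof (rule SUP_least, clarify)
  fix g :: "real \<Rightarrow> ennreal" assume g: "simple_function lborel g" "g \<le> (\<lambda>x. f (x - s))"
  have gm: "g \<in> borel_measurable borel" using borel_measurable_simple_function[OF g(1)] by simp
  have "integral\<^sup>S lborel g = (\<integral>\<^sup>+x. g x \<partial>lborel)" by (rule nn_integral_eq_simple_integral[OF g(1), symmetric])
  also have "\<dots> = (\<integral>\<^sup>+x. g (s + 1 * x) \<partial>lborel)"
    using nn_integral_real_affine[OF gm, of 1 s] by simp
  also have "\<dots> \<le> (\<integral>\<^sup>+x. f x \<partial>lborel)"
    using g(2) by (intro nn_integral_mono) (auto simp: le_fun_def dest: spec[of _ "s + _"])
  finally show "integral\<^sup>S lborel g \<le> (\<integral>\<^sup>+x. f x \<partial>lborel)" .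
qed

lemma has_vector_derivative_shift:
  fixes f :: "real \<Rightarrow> 'a::real_normed_vector"
  shows "((\<lambda>r. f (r - s)) has_vector_derivative D) (at r) \<longleftrightarrow> (f has_vector_derivative D) (at (r - s))"
proof
  assume "((\<lambda>r. f (r - s)) has_vector_derivative D) (at r)"
  moreover have "((\<lambda>x. x + s) has_vector_derivative 1) (at (r - s))" by (auto intro!: derivative_eq_intros)
  ultimately show "(f has_vector_derivative D) (at (r - s))"
    using vector_diff_chain_at[of "\<lambda>x. x + s" 1 "r - s" "\<lambda>r. f (r - s)" D] by (simp add: o_def)
next
  assume "(f has_vector_derivative D) (at (r - s))"
  moreover have "((\<lambda>x. x - s) has_vector_derivative 1) (at r)" by (auto intro!: derivative_eq_intros)
  ultimately show "((\<lambda>r. f (r - s)) has_vector_derivative D) (at r)"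
    using vector_diff_chain_at[of "\<lambda>x. x - s" 1 r f D] by (simp add: o_def)
qed

text \<open>Equality holds also where no derivative exists: both sides are then the same arbitrary
  choice, since the defining predicates coincide for every candidate.\<close>

lemma vector_derivative_cong_open:
  fixes f g :: "real \<Rightarrow> 'a::real_normed_vector"
  assumes "open S" "r \<in> S" "\<And>x. x \<in> S \<Longrightarrow> f x = g x"
  shows "vector_derivative f (at r) = vector_derivative g (at r)"
proof -
  have "(f has_vector_derivative D) (at r) \<longleftrightarrow> (g has_vector_derivative D) (at r)" for D
    using has_vector_derivative_transform_within_open[of f D r S g] has_vector_derivative_transform_within_open[of g D r S f] assms
    by auto
  then show ?thesis by (simp add: vector_derivative_def)
qed

lemma vector_derivative_shift:
  fixes f :: "real \<Rightarrow> 'a::real_normed_vector"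
  shows "vector_derivative (\<lambda>r. f (r - s)) (at r) = vector_derivative f (at (r - s))"
  unfolding vector_derivative_def has_vector_derivative_shift ..

section \<open>Metric properties of the transition cost\<close>

lemma finsler_cost_le:
  assumes "r0 < r1" "AC r0 r1 \<theta>" "\<theta> r0 = x" "\<theta> r1 = y"
  shows "finsler_cost p DE t x y \<le>
    (\<integral>\<^sup>+r\<in>{r0..r1}. ennreal (p (vector_derivative \<theta> (at r)) (- DE t (\<theta> r))) \<partial>lborel)"
  unfolding finsler_cost_def using assms by (intro Inf_lower) blast

lemma finsler_cost_refl:
  assumes "\<And>w. p 0 w = 0" shows "finsler_cost p DE t x x = 0"
proof -
  have "finsler_cost p DE t x x \<le> (\<integral>\<^sup>+r\<in>{0..1}. ennreal (p (vector_derivative (\<lambda>_. x) (at r)) (- DE t x)) \<partial>lborel)"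
    by (rule finsler_cost_le) (auto intro: AC_const)
  also have "\<dots> = 0" by (simp add: assms)
  finally show ?thesis by simp
qed

text \<open>Two nearly optimal curves are concatenated, the second one shifted in its parameter;
  free endpoints of the parameter interval make this admissible without rescaling.\<close>

lemma finsler_cost_triangle:
  "finsler_cost p DE t x z \<le> finsler_cost p DE t x y + finsler_cost p DE t y z"
proof (rule ennreal_le_epsilon)
  fix e :: real assume fin: "finsler_cost p DE t x y + finsler_cost p DE t y z < top" and e: "0 < e"
  let ?F = "\<lambda>\<theta> r. ennreal (p (vector_derivative \<theta> (at r)) (- DE t (\<theta> r)))"
  have less: "c < c + ennreal (e / 2)" if "c < top" for c :: ennreal
    using that e by (cases c) (auto simp: ennreal_plus[symmetric] ennreal_less_iff simp del: ennreal_plus)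
  have "finsler_cost p DE t x y < finsler_cost p DE t x y + ennreal (e / 2)"
    using fin by (intro less) (auto simp: less_top)
  then obtain \<theta>1 a0 a1 where 1: "a0 < a1" "AC a0 a1 \<theta>1" "\<theta>1 a0 = x" "\<theta>1 a1 = y"
    "(\<integral>\<^sup>+r\<in>{a0..a1}. ?F \<theta>1 r \<partial>lborel) < finsler_cost p DE t x y + ennreal (e / 2)"
    unfolding finsler_cost_def[of p DE t x y] Inf_less_iff by blast
  have "finsler_cost p DE t y z < finsler_cost p DE t y z + ennreal (e / 2)"
    using fin by (intro less) (auto simp: less_top)
  then obtain \<theta>2 b0 b1 where 2: "b0 < b1" "AC b0 b1 \<theta>2" "\<theta>2 b0 = y" "\<theta>2 b1 = z"
    "(\<integral>\<^sup>+r\<in>{b0..b1}. ?F \<theta>2 r \<partial>lborel) < finsler_cost p DE t y z + ennreal (e / 2)"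
    unfolding finsler_cost_def[of p DE t y z] Inf_less_iff by blast
  define s where "s = a1 - b0"
  define \<theta> where "\<theta> r = (if r \<le> a1 then \<theta>1 r else \<theta>2 (r - s))" for r
  have ac: "AC a0 (b1 + s) \<theta>"
  proof (rule AC_join[where m=a1])
    show "AC a0 a1 \<theta>" by (rule AC_cong[OF 1(2)]) (simp add: \<theta>_def)
    have "AC (b0 + s) (b1 + s) (\<lambda>r. \<theta>2 (r - s))" by (rule AC_shift[OF 2(2)])
    then have "AC (b0 + s) (b1 + s) \<theta>" by (rule AC_cong) (use 1 2 in \<open>auto simp: \<theta>_def s_def\<close>)
    then show "AC a1 (b1 + s) \<theta>" by (simp add: s_def)
  qed (use 1 2 in \<open>auto simp: s_def\<close>)
  have F1: "?F \<theta> r = ?F \<theta>1 r" if "r < a1" for r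
    using vector_derivative_cong_open[of "{..<a1}" r \<theta> \<theta>1] that by (simp add: \<theta>_def)
  have F2: "?F \<theta> r = ?F \<theta>2 (r - s)" if "a1 < r" for r
    using vector_derivative_cong_open[of "{a1<..}" r \<theta> "\<lambda>r. \<theta>2 (r - s)"] that
    by (simp add: \<theta>_def vector_derivative_shift)
  let ?G = "\<lambda>r. ?F \<theta> r * indicator {a0..b1 + s} r"
  \<comment> \<open>At the junction the derivative of the concatenated curve is unrelated to the
    pieces; a single point does not matter.\<close>
  have ne: "AE r in lborel. r \<noteq> a1" by (rule AE_lborel_singleton)
  have "finsler_cost p DE t x z \<le> integral\<^sup>N lborel ?G"
    by (rule finsler_cost_le[OF _ ac]) (use 1 2 in \<open>auto simp: \<theta>_def s_def\<close>)
  also have "\<dots> \<le> (\<integral>\<^sup>+r. ?G r * indicator {..a1} r \<partial>lborel) + (\<integral>\<^sup>+r. ?G r * indicator (- {..a1}) r \<partial>lborel)"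
    by (rule nn_integral_le_split) simp
  also have "(\<integral>\<^sup>+r. ?G r * indicator {..a1} r \<partial>lborel) \<le> (\<integral>\<^sup>+r\<in>{a0..a1}. ?F \<theta>1 r \<partial>lborel)"
  proof (rule nn_integral_mono_AE)
    show "AE r in lborel. ?G r * indicator {..a1} r \<le> ?F \<theta>1 r * indicator {a0..a1} r"
      using ne
    proof eventually_elim
      case (elim r)
      show ?case
      proof (cases "r < a1")
        case True
        then show ?thesis unfolding F1[OF True] by (auto split: split_indicator)
      next
        case False
        then have "r \<notin> {..a1}" using elim by auto
        then show ?thesis by simp
      qed
    qed
  qed
  also have "(\<integral>\<^sup>+r. ?G r * indicator (- {..a1}) r \<partial>lborel) \<le> (\<integral>\<^sup>+r. ?F \<theta>2 (r - s) * indicator {b0..b1} (r - s) \<partial>lborel)"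
  proof (rule nn_integral_mono)
    fix r
    show "?G r * indicator (- {..a1}) r \<le> ?F \<theta>2 (r - s) * indicator {b0..b1} (r - s)"
    proof (cases "a1 < r")
      case True
      then show ?thesis unfolding F2[OF True] by (auto split: split_indicator simp: s_def)
    next
      case False
      then have "r \<in> {..a1}" by auto
      then show ?thesis by simp
    qed
  qed
  also have "\<dots> \<le> (\<integral>\<^sup>+r\<in>{b0..b1}. ?F \<theta>2 r \<partial>lborel)"
    by (rule nn_integral_shift_le[where f="\<lambda>r. ?F \<theta>2 r * indicator {b0..b1} r"])
  finally have "finsler_cost p DE t x z \<le> (\<integral>\<^sup>+r\<in>{a0..a1}. ?F \<theta>1 r \<partial>lborel) + (\<integral>\<^sup>+r\<in>{b0..b1}. ?F \<theta>2 r \<partial>lborel)"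
    by (simp add: add_left_mono add_right_mono)
  also have "\<dots> \<le> (finsler_cost p DE t x y + ennreal (e / 2)) + (finsler_cost p DE t y z + ennreal (e / 2))"
    using 1(5) 2(5) by (intro add_mono less_imp_le)
  also have "\<dots> = finsler_cost p DE t x y + finsler_cost p DE t y z + (ennreal (e / 2) + ennreal (e / 2))"
    by (simp add: ac_simps)
  also have "ennreal (e / 2) + ennreal (e / 2) = ennreal e"
    using e by (simp add: ennreal_plus[symmetric] del: ennreal_plus)
  finally show "finsler_cost p DE t x z \<le> finsler_cost p DE t x y + finsler_cost p DE t y z + ennreal e" .
qed

lemma ennreal_integral_le_nn_integral:
  assumes "integrable M (f :: _ \<Rightarrow> real)" shows "ennreal (LINT x|M. f x) \<le> (\<integral>\<^sup>+x. ennreal (f x) \<partial>M)"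
proof -
  have "(LINT x|M. f x) \<le> (LINT x|M. max 0 (f x))" using assms by (intro integral_mono) auto
  then have "ennreal (LINT x|M. f x) \<le> ennreal (LINT x|M. max 0 (f x))" by (rule ennreal_leI)
  also have "\<dots> = (\<integral>\<^sup>+x. ennreal (max 0 (f x)) \<partial>M)" using assms by (intro nn_integral_eq_integral[symmetric]) auto
  also have "\<dots> = (\<integral>\<^sup>+x. ennreal (f x) \<partial>M)" by (rule nn_integral_cong) (simp add: max_def ennreal_neg)
  finally show ?thesis .
qed

lemma (in C1_energy) E_curve_derivative:
  assumes t: "t \<in> {0..T}" and \<theta>: "(\<theta> has_vector_derivative v) (at r)"
  shows "((\<lambda>r. E t (\<theta> r)) has_real_derivative blinfun_apply (DE t (\<theta> r)) v) (at r)"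
proof -
  have d1: "((\<lambda>r. (t, \<theta> r)) has_derivative (\<lambda>x. (0, x *\<^sub>R v))) (at r within UNIV)"
    using \<theta> unfolding has_vector_derivative_def by (intro has_derivative_Pair) auto
  have sub: "(\<lambda>r. (t, \<theta> r)) ` UNIV \<subseteq> {0..T} \<times> UNIV" using t by auto
  have "((\<lambda>(s, y). E s y) has_derivative (\<lambda>(s, y). s * dtE t (\<theta> r) + blinfun_apply (DE t (\<theta> r)) y))
        (at (t, \<theta> r) within (\<lambda>r. (t, \<theta> r)) ` UNIV)"
    by (rule has_derivative_subset[OF E_deriv[OF t] sub])
  from has_derivative_in_compose[OF d1 this] show ?thesis
    by (simp add: has_field_derivative_def blinfun.scaleR_right mult_commute_abs)
qed

text \<open>Coordinates of an absolutely continuous curve are differentiable almost everywhere,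
  hence so is the curve. The energy is Lipschitz on a ball containing it, so the energy along it is
  absolutely continuous and recovered from its derivative. When the energy increases, the left side
  is zero.\<close>

lemma finsler_cost_lower_bound:
  assumes fc: "fin_coords (B :: 'a::{banach,second_countable_topology} set) c"
    and en: "C1_energy T E dtE (DE :: real \<Rightarrow> 'a \<Rightarrow> _)" and t: "t \<in> {0..T}"
    and p: "\<And>v w. blinfun_apply w v \<le> p v w"
  shows "ennreal (E t x - E t y) \<le> finsler_cost p DE t x y"
  unfolding finsler_cost_def
proof (rule Inf_greatest, clarify)
  interpret fin_coords B c by fact
  interpret C1_energy T E dtE DE by fact
  fix \<theta> :: "real \<Rightarrow> 'a" and r0 r1 :: real assume r: "r0 < r1" and ac: "AC r0 r1 \<theta>"
  obtain R where R: "\<And>r. r \<in> {r0..r1} \<Longrightarrow> norm (\<theta> r) \<le> R" using AC_bounded[OF ac less_imp_le[OF r]] by blast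
  obtain L where L: "L \<ge> 0" "\<And>x::'a. norm x \<le> R \<Longrightarrow> \<bar>dtE t x\<bar> \<le> L \<and> norm (DE t x) \<le> L"
    using C1_energy_bound[OF fc en, of R] t by blast
  have Elip: "\<bar>E t x - E t y\<bar> \<le> 2 * L * norm (x - y)" if "norm x \<le> R" "norm y \<le> R" for x y :: 'a
  proof -
    have "\<bar>E t x - E t y - 0 * (t - t) - (0 :: 'a \<Rightarrow>\<^sub>L real) (x - y)\<bar> \<le> 2 * L * (\<bar>t - t\<bar> + norm (x - y))"
    proof (rule E_linearization)
      show "convex ({t} \<times> cball (0::'a) R)" by (intro convex_Times) auto
    qed (use L(2) t that in auto)
    then show ?thesis by simp
  qed
  have acE: "AC r0 r1 (\<lambda>r. E t (\<theta> r))"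
  proof (rule AC_lipschitz[OF ac, of "2 * L + 1"])
    fix r s assume "r \<in> {r0..r1}" "s \<in> {r0..r1}"
    then have "\<bar>E t (\<theta> s) - E t (\<theta> r)\<bar> \<le> 2 * L * norm (\<theta> s - \<theta> r)" by (intro Elip R)
    also have "\<dots> \<le> (2 * L + 1) * norm (\<theta> s - \<theta> r)" by (intro mult_right_mono) auto
    finally show "norm (E t (\<theta> s) - E t (\<theta> r)) \<le> (2 * L + 1) * norm (\<theta> s - \<theta> r)" by simp
  qed (use L in simp)
  obtain g where g: "integrable lborel g" "AE r in lborel. r \<in> {r0<..<r1} \<longrightarrow> ((\<lambda>r. E t (\<theta> r)) has_real_derivative g r) (at r)"
    "(LINT r:{r0..r1}|lborel. g r) = E t (\<theta> r1) - E t (\<theta> r0)" using AC_FTC[OF acE r] by blast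
  obtain K where K: "K > 0" "\<And>b x. b \<in> B \<Longrightarrow> \<bar>c b x\<bar> \<le> K * norm x" using coord_bound by blast
  have "\<exists>g. AE r in lborel. r \<in> {r0<..<r1} \<longrightarrow> ((\<lambda>r. c b (\<theta> r)) has_real_derivative g r) (at r)" if b: "b \<in> B" for b
  proof -
    interpret cb: bounded_linear "c b" using c_bl[OF b] .
    have "AC r0 r1 (\<lambda>r. c b (\<theta> r))"
      by (rule AC_lipschitz[OF ac K(1)]) (use K(2)[OF b] in \<open>simp flip: cb.diff\<close>)
    from AC_FTC[OF this r] show ?thesis by blast
  qed
  then obtain gb where gb: "\<And>b. b \<in> B \<Longrightarrow> AE r in lborel. r \<in> {r0<..<r1} \<longrightarrow> ((\<lambda>r. c b (\<theta> r)) has_real_derivative gb b r) (at r)"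
    by metis
  have "AE r in lborel. \<forall>b\<in>B. r \<in> {r0<..<r1} \<longrightarrow> ((\<lambda>r. c b (\<theta> r)) has_real_derivative gb b r) (at r)"
    using gb by (intro AE_finite_allI finB)
  then have main: "AE r in lborel. r \<noteq> r0 \<and> r \<noteq> r1 \<longrightarrow> ennreal (indicator {r0..r1} r *\<^sub>R (- g r)) \<le>
      ennreal (p (vector_derivative \<theta> (at r)) (- DE t (\<theta> r))) * indicator {r0..r1} r"
    using g(2)
  proof eventually_elim
    case (elim r)
    show ?case
    proof
      assume ne: "r \<noteq> r0 \<and> r \<noteq> r1"
      show "ennreal (indicator {r0..r1} r *\<^sub>R (- g r)) \<le> ennreal (p (vector_derivative \<theta> (at r)) (- DE t (\<theta> r))) * indicator {r0..r1} r"
      proof (cases "r \<in> {r0..r1}")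
        case True
        then have rin: "r \<in> {r0<..<r1}" using ne by auto
        have "((\<lambda>r. \<Sum>b\<in>B. c b (\<theta> r) *\<^sub>R b) has_vector_derivative (\<Sum>b\<in>B. gb b r *\<^sub>R b)) (at r)"
        proof (rule has_vector_derivative_sum)
          fix b assume "b \<in> B"
          then have "((\<lambda>r. c b (\<theta> r)) has_real_derivative gb b r) (at r)" using elim(1) rin by blast
          then have "((\<lambda>r. c b (\<theta> r) *\<^sub>R b) has_vector_derivative (c b (\<theta> r) *\<^sub>R 0 + gb b r *\<^sub>R b)) (at r)"
            by (intro has_vector_derivative_scaleR has_vector_derivative_const)
          then show "((\<lambda>r. c b (\<theta> r) *\<^sub>R b) has_vector_derivative gb b r *\<^sub>R b) (at r)" by simp
        qed
        then have vd: "(\<theta> has_vector_derivative (\<Sum>b\<in>B. gb b r *\<^sub>R b)) (at r)" by (simp add: c_sum)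
        define v where "v = (\<Sum>b\<in>B. gb b r *\<^sub>R b)"
        have vdv: "vector_derivative \<theta> (at r) = v" using vd unfolding v_def by (rule vector_derivative_at)
        have "((\<lambda>r. E t (\<theta> r)) has_real_derivative blinfun_apply (DE t (\<theta> r)) v) (at r)"
          using E_curve_derivative[OF t vd] by (simp add: v_def)
        moreover have "((\<lambda>r. E t (\<theta> r)) has_real_derivative g r) (at r)" using elim(2) rin by blast
        ultimately have "g r = blinfun_apply (DE t (\<theta> r)) v" by (rule DERIV_unique[symmetric])
        then have "- g r = blinfun_apply (- DE t (\<theta> r)) v" by (simp add: blinfun.minus_left)
        also have "\<dots> \<le> p v (- DE t (\<theta> r))" by (rule p)
        finally show ?thesis using True vdv by (simp add: ennreal_leI)
      qed simp
    qed
  qed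
  have gi: "integrable lborel (\<lambda>r. indicator {r0..r1} r *\<^sub>R (- g r))"
    using g(1) by (intro integrable_mult_indicator) auto
  have "E t (\<theta> r0) - E t (\<theta> r1) = (LINT r|lborel. indicator {r0..r1} r *\<^sub>R (- g r))"
    using g(3) by (simp add: set_lebesgue_integral_def)
  then have "ennreal (E t (\<theta> r0) - E t (\<theta> r1)) \<le> (\<integral>\<^sup>+r. ennreal (indicator {r0..r1} r *\<^sub>R (- g r)) \<partial>lborel)"
    using ennreal_integral_le_nn_integral[OF gi] by simp
  also have "\<dots> \<le> (\<integral>\<^sup>+r\<in>{r0..r1}. ennreal (p (vector_derivative \<theta> (at r)) (- DE t (\<theta> r))) \<partial>lborel)"
  proof (rule nn_integral_mono_AE)
    show "AE r in lborel. ennreal (indicator {r0..r1} r *\<^sub>R (- g r)) \<le>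
      ennreal (p (vector_derivative \<theta> (at r)) (- DE t (\<theta> r))) * indicator {r0..r1} r"
      using main AE_lborel_singleton[of r0] AE_lborel_singleton[of r1] by eventually_elim blast
  qed
  finally show "ennreal (E t (\<theta> r0) - E t (\<theta> r1)) \<le> (\<integral>\<^sup>+r\<in>{r0..r1}. ennreal (p (vector_derivative \<theta> (at r)) (- DE t (\<theta> r))) \<partial>lborel)" .
qed

section \<open>BV solutions\<close>

lemma infsum_ennreal_of_has_sum:
  assumes x: "(x has_sum X) A" "\<And>r. r \<in> A \<Longrightarrow> 0 \<le> (x r :: real)"
  shows "(\<Sum>\<^sub>\<infinity>r\<in>A. ennreal (x r)) = ennreal X"
proof (rule infsumI)
  have "((\<lambda>F. ennreal (sum x F)) \<longlongrightarrow> ennreal X) (finite_subsets_at_top A)"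
    using x(1) unfolding has_sum_def by (rule tendsto_ennrealI)
  moreover have "\<forall>\<^sub>F F in finite_subsets_at_top A. ennreal (sum x F) = (\<Sum>r\<in>F. ennreal (x r))"
    unfolding eventually_finite_subsets_at_top
    using x(2) by (intro exI[of _ "{}"]) (auto intro!: sum_ennreal[symmetric])
  ultimately show "((\<lambda>r. ennreal (x r)) has_sum ennreal X) A"
    unfolding has_sum_def by (rule Lim_transform_eventually)
qed

lemma has_sum_of_infsum_ennreal:
  fixes f :: "'b \<Rightarrow> ennreal"
  assumes fin: "(\<Sum>\<^sub>\<infinity>r\<in>A. f r) < top"
  obtains x X where "\<And>r. r \<in> A \<Longrightarrow> 0 \<le> x r" "\<And>r. r \<in> A \<Longrightarrow> f r = ennreal (x r)" "(x has_sum X) A" "0 \<le> X"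
    "(\<Sum>\<^sub>\<infinity>r\<in>A. f r) = ennreal X"
proof -
  have le: "sum f F \<le> (\<Sum>\<^sub>\<infinity>r\<in>A. f r)" if F: "finite F" "F \<subseteq> A" for F
  proof -
    have "sum f F = (\<Sum>\<^sub>\<infinity>r\<in>F. f r)" using F by simp
    also have "\<dots> \<le> (\<Sum>\<^sub>\<infinity>r\<in>A. f r)" by (rule infsum_mono_neutral) (use F in \<open>auto intro: nonneg_summable_on_complete\<close>)
    finally show ?thesis .
  qed
  define x where "x r = enn2real (f r)" for r
  have fx: "f r = ennreal (x r)" if "r \<in> A" for r
    using le[of "{r}"] that fin unfolding x_def by (auto simp: le_less_trans)
  have sx: "x summable_on A"
  proof (rule nonneg_bdd_above_summable_on)
    show "bdd_above (sum x ` {F. F \<subseteq> A \<and> finite F})"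
    proof (rule bdd_aboveI)
      fix s assume "s \<in> sum x ` {F. F \<subseteq> A \<and> finite F}"
      then obtain F where F: "F \<subseteq> A" "finite F" "s = sum x F" by blast
      have "sum f F = (\<Sum>r\<in>F. ennreal (x r))" by (rule sum.cong[OF refl]) (use F(1) fx in blast)
      also have "\<dots> = ennreal s" unfolding F(3) by (rule sum_ennreal) (simp add: x_def)
      finally have "ennreal s = sum f F" ..
      also have "\<dots> \<le> ennreal (enn2real (\<Sum>\<^sub>\<infinity>r\<in>A. f r))" using le[OF F(2,1)] fin by simp
      finally show "s \<le> enn2real (\<Sum>\<^sub>\<infinity>r\<in>A. f r)" by (subst (asm) ennreal_le_iff) auto
    qed
  qed (simp add: x_def)
  then obtain X where X: "(x has_sum X) A" by (auto simp: summable_on_def)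
  have X0: "0 \<le> X" by (rule has_sum_nonneg[OF X]) (simp add: x_def)
  have "(\<Sum>\<^sub>\<infinity>r\<in>A. f r) = (\<Sum>\<^sub>\<infinity>r\<in>A. ennreal (x r))" by (rule infsum_cong[OF fx])
  also have "\<dots> = ennreal X" by (rule infsum_ennreal_of_has_sum[OF X]) (simp add: x_def)
  finally have eq: "(\<Sum>\<^sub>\<infinity>r\<in>A. f r) = ennreal X" .
  show ?thesis by (rule that[OF _ fx X X0 eq]) (simp add: x_def)
qed

text \<open>A jump condition in extended reals contains two facts: the energy does not increase, and
  the cost is finite and equal to the drop.\<close>

lemma ereal_eq_uminus_enn2ereal:
  "ereal x = - enn2ereal D \<longleftrightarrow> x \<le> 0 \<and> D = ennreal (- x)"
proof (cases D)
  case (real r)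
  then show ?thesis by (auto simp: enn2ereal_ennreal)
next
  case top
  then show ?thesis by (auto simp: enn2ereal_top)
qed

lemma enn2ereal_add_eq_ereal:
  "enn2ereal D + ereal x = ereal y \<longleftrightarrow> x \<le> y \<and> D = ennreal (y - x)"
proof (cases D)
  case (real r)
  then show ?thesis by (auto simp: enn2ereal_ennreal)
next
  case top
  then show ?thesis by (auto simp: enn2ereal_top)
qed

section \<open>Gauges and their subdifferentials\<close>

locale gauge =
  fixes Psi0 :: "'a::real_normed_vector \<Rightarrow> real"
  assumes Psi0_nonneg: "Psi0 v \<ge> 0"
    and Psi0_subadd: "Psi0 (v1 + v2) \<le> Psi0 v1 + Psi0 v2"
    and Psi0_homogeneous: "l \<ge> 0 \<Longrightarrow> Psi0 (l *\<^sub>R v) = l * Psi0 v"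
begin

lemma Psi0_zero: "Psi0 0 = 0"
  using Psi0_homogeneous[of 0 0] by simp

lemma subdifferential_zero_iff: "w \<in> subdifferential Psi0 0 \<longleftrightarrow> (\<forall>z. blinfun_apply w z \<le> Psi0 z)"
  by (simp add: subdifferential_def Psi0_zero)

text \<open>By homogeneity the test points 2 v and 0 give the two inequalities between the pairing
  and the gauge at \<open>v\<close>; the subgradient inequality then reduces to that at the
  origin.\<close>

lemma subdifferential_iff:
  "w \<in> subdifferential Psi0 v \<longleftrightarrow> w \<in> subdifferential Psi0 0 \<and> blinfun_apply w v = Psi0 v"
proof
  assume w: "w \<in> subdifferential Psi0 v"
  then have le: "Psi0 v + blinfun_apply w (z - v) \<le> Psi0 z" for z by (simp add: subdifferential_def)
  have eq: "blinfun_apply w v = Psi0 v"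
  proof (rule antisym)
    have "v + v - v = v" "v + v = 2 *\<^sub>R v" by (auto simp: scaleR_2)
    then show "blinfun_apply w v \<le> Psi0 v" using le[of "v + v"] Psi0_homogeneous[of 2 v] by simp
    show "Psi0 v \<le> blinfun_apply w v" using le[of 0] by (simp add: Psi0_zero blinfun.minus_right)
  qed
  have "blinfun_apply w z \<le> Psi0 z" for z using le[of z] eq by (simp add: blinfun.diff_right)
  then show "w \<in> subdifferential Psi0 0 \<and> blinfun_apply w v = Psi0 v" using eq by (simp add: subdifferential_zero_iff)
next
  assume "w \<in> subdifferential Psi0 0 \<and> blinfun_apply w v = Psi0 v"
  then show "w \<in> subdifferential Psi0 v"
    by (simp add: subdifferential_def Psi0_zero blinfun.diff_right)
qed

lemma inclusion_iff:
  "0 \<in> {\<xi> + D | \<xi>. \<xi> \<in> subdifferential Psi0 v} \<longleftrightarrow>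
     - D \<in> subdifferential Psi0 0 \<and> - blinfun_apply D v = Psi0 v"
proof -
  have "0 \<in> {\<xi> + D | \<xi>. \<xi> \<in> subdifferential Psi0 v} \<longleftrightarrow> - D \<in> subdifferential Psi0 v"
    by (auto simp: eq_neg_iff_add_eq_0[symmetric] intro: exI[of _ "- D"])
  then show ?thesis unfolding subdifferential_iff[of "- D" v] by (simp add: blinfun.minus_left)
qed

end

text \<open>A gauge need not be symmetric, so both signs of each basis vector enter the
  constant.\<close>

lemma gauge_bound:
  assumes "fin_coords (B :: 'a::{banach,second_countable_topology} set) c" "gauge (Psi0 :: 'a \<Rightarrow> real)"
  shows "\<exists>K\<ge>0. \<forall>v. Psi0 v \<le> K * norm v"
proof -
  interpret fin_coords B c by fact
  interpret gauge Psi0 by fact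
  obtain K where K: "K > 0" "\<And>b x. b \<in> B \<Longrightarrow> \<bar>c b x\<bar> \<le> K * norm x" using coord_bound by blast
  define m where "m b = max (Psi0 b) (Psi0 (- b))" for b
  have m0: "m b \<ge> 0" for b using Psi0_nonneg[of b] by (simp add: m_def)
  have sc: "Psi0 (k *\<^sub>R b) \<le> \<bar>k\<bar> * m b" for k b
  proof (cases "k \<ge> 0")
    case True
    then show ?thesis using Psi0_homogeneous[of k b] by (simp add: m_def mult_left_mono)
  next
    case False
    then show ?thesis using Psi0_homogeneous[of "- k" "- b"] by (simp add: m_def mult_left_mono)
  qed
  have sums: "Psi0 (\<Sum>b\<in>S. k b *\<^sub>R b) \<le> (\<Sum>b\<in>S. \<bar>k b\<bar> * m b)" if "finite S" for S k
    using that
  proof induction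
    case (insert b S)
    then show ?case using Psi0_subadd[of "k b *\<^sub>R b" "\<Sum>b\<in>S. k b *\<^sub>R b"] sc[of "k b" b] by simp
  qed (simp add: Psi0_zero)
  show ?thesis
  proof (intro exI[of _ "\<Sum>b\<in>B. K * m b"] conjI allI)
    show "0 \<le> (\<Sum>b\<in>B. K * m b)" using K(1) m0 by (intro sum_nonneg) simp
    fix v
    have "Psi0 v = Psi0 (\<Sum>b\<in>B. c b v *\<^sub>R b)" by (simp add: c_sum)
    also have "\<dots> \<le> (\<Sum>b\<in>B. \<bar>c b v\<bar> * m b)" by (rule sums[OF finB])
    also have "\<dots> \<le> (\<Sum>b\<in>B. (K * norm v) * m b)" using K(2) m0 by (intro sum_mono mult_right_mono)
    also have "\<dots> = (\<Sum>b\<in>B. K * m b) * norm v" by (simp add: sum_distrib_left sum_distrib_right mult_ac)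
    finally show "Psi0 v \<le> (\<Sum>b\<in>B. K * m b) * norm v" .
  qed
qed

section \<open>Equivalence of the energy balance with inclusion and jump conditions\<close>

locale bv_system = energy_curve B c T u V M E dtE DE L + gauge Psi0 + viscosity Psi
  for B :: "'a::{banach,second_countable_topology} set" and c T u V M
    and E dtE :: "real \<Rightarrow> 'a \<Rightarrow> real" and DE L
    and Psi0 Psi :: "'a \<Rightarrow> real" +
  assumes bv: "BV T u"
begin

abbreviation \<Delta> :: "real \<Rightarrow> 'a \<Rightarrow> 'a \<Rightarrow> ennreal" where
  "\<Delta> \<equiv> finsler_cost (contact_potential Psi) DE"
abbreviation ul :: "real \<Rightarrow> 'a" where "ul \<equiv> llim uc"
abbreviation ur :: "real \<Rightarrow> 'a" where "ur \<equiv> rlim uc"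

lemma cost_refl: "\<Delta> t x x = 0"
  by (rule finsler_cost_refl) (rule contact_zero)

lemma cost_lower: "t \<in> {0..T} \<Longrightarrow> ennreal (E t x - E t y) \<le> \<Delta> t x y"
  by (rule finsler_cost_lower_bound[OF fin_coords_axioms C1_energy_axioms _ contact_ge])

lemma ul_0: "ul 0 = u 0" and ur_T: "ur T = u T"
  using lim_left_eq[of 0] lim_right_eq[of T] T by (auto simp: lim_left_def lim_right_def)

lemma borel_Psi0 [measurable]: "Psi0 \<in> borel_measurable borel"
proof -
  obtain K where K: "K \<ge> 0" "\<And>v. Psi0 v \<le> K * norm v" using gauge_bound[OF fin_coords_axioms gauge_axioms] by blast
  \<comment> \<open>Subadditivity in both orders with the linear bound makes the gauge Lipschitz,
    hence continuous and Borel.\<close>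
  have lip: "\<bar>Psi0 x - Psi0 y\<bar> \<le> K * norm (x - y)" for x y
    using Psi0_subadd[of "x - y" y] Psi0_subadd[of "y - x" x] K(2)[of "x - y"] K(2)[of "y - x"]
    by (simp add: norm_minus_commute abs_le_iff)
  have "continuous_on UNIV Psi0"
  proof (rule continuous_on_iff[THEN iffD2], intro ballI allI impI)
    fix x and e :: real assume e: "e > 0"
    show "\<exists>d>0. \<forall>x'\<in>UNIV. dist x' x < d \<longrightarrow> dist (Psi0 x') (Psi0 x) < e"
    proof (intro exI[of _ "e / (K + 1)"] conjI ballI impI)
      show "e / (K + 1) > 0" using e K by simp
      fix y assume "dist y x < e / (K + 1)"
      then have "norm (y - x) * (K + 1) < e" using K by (simp add: dist_norm less_divide_eq)
      moreover have "K * norm (y - x) \<le> norm (y - x) * (K + 1)" by (simp add: algebra_simps)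
      ultimately show "dist (Psi0 y) (Psi0 x) < e" using lip[of y x] by (simp add: dist_real_def)
    qed
  qed
  then show ?thesis by (rule borel_measurable_continuous_onI)
qed

lemma integrable_Psi0_h: "integrable mu (\<lambda>t. Psi0 (h t))"
proof -
  obtain K where K: "K \<ge> 0" "\<And>v. Psi0 v \<le> K * norm v" using gauge_bound[OF fin_coords_axioms gauge_axioms] by blast
  show ?thesis
  proof (rule Bochner_Integration.integrable_bound)
    show "integrable mu (\<lambda>t. K * norm (h t))" using integrable_norm[OF integrable_h] by simp
    show "AE t in mu. norm (Psi0 (h t)) \<le> norm (K * norm (h t))"
      using K Psi0_nonneg by (intro AE_I2) simp
  qed measurable
qed

lemma nn_integral_Psi0:
  "(\<integral>\<^sup>+s\<in>{0..t}. ennreal (Psi0 (h s)) \<partial>mu) = ennreal (LINT s:{0..t}|mu. Psi0 (h s))"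
proof -
  have "(\<integral>\<^sup>+s\<in>{0..t}. ennreal (Psi0 (h s)) \<partial>mu) = (\<integral>\<^sup>+s. ennreal (indicator {0..t} s *\<^sub>R Psi0 (h s)) \<partial>mu)"
    by (rule nn_integral_cong) (auto split: split_indicator)
  also have "\<dots> = ennreal (LINT s:{0..t}|mu. Psi0 (h s))"
    unfolding set_lebesgue_integral_def
    by (intro nn_integral_eq_integral integrable_mult_indicator integrable_Psi0_h) (auto simp: Psi0_nonneg)
  finally show ?thesis .
qed

lemma integrable_DE_h: "set_integrable mu {0..t} (\<lambda>s. Psi0 (h s))" "set_integrable mu {0..t} g2"
  unfolding set_integrable_def
  by (intro integrable_mult_indicator integrable_Psi0_h integrable_g2; simp)+

lemma set_integral_DE_h:
  "t \<le> T \<Longrightarrow> (LINT s:{0..t}|mu. blinfun_apply (DE s (u s)) (h s)) = (LINT s:{0..t}|mu. g2 s)"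
  by (rule set_lebesgue_integral_cong) (auto simp: g2_def clamp_id uc_id)

lemma pseudo_Var_eq:
  assumes "0 < t" "t \<le> T"
  shows "pseudo_Var T Psi0 (contact_potential Psi) DE u 0 t =
    ennreal (LINT s:{0..t}|mu. Psi0 (h s)) + \<Delta> 0 (u 0) (ur 0) + \<Delta> t (ul t) (u t)
      + (\<Sum>\<^sub>\<infinity>r\<in>J \<inter> {0<..<t}. \<Delta> r (ul r) (u r) + \<Delta> r (u r) (ur r))"
proof -
  have "(\<Sum>\<^sub>\<infinity>r\<in>J \<inter> {0<..<t}. finsler_cost3 (contact_potential Psi) DE r (lim_left u r) (u r) (lim_right T u r))
    = (\<Sum>\<^sub>\<infinity>r\<in>J \<inter> {0<..<t}. \<Delta> r (ul r) (u r) + \<Delta> r (u r) (ur r))"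
    using assms by (intro infsum_cong) (simp add: finsler_cost3_def lim_left_eq lim_right_eq)
  then show ?thesis
    using assms T unfolding pseudo_Var_def J_def[symmetric] nn_integral_Psi0
    by (simp add: lim_left_eq lim_right_eq)
qed

text \<open>At a point where \<open>u\<close> is continuous, a violated inequality for one direction
  \<open>z\<close> persists on an interval, contradicting stability almost everywhere. Single points
  must be reached because the Cantor part of \<mu> lives on a Lebesgue null set.\<close>

lemma stable_off_jumps:
  assumes ae: "AE t in lborel. t \<in> {0..T} - J \<longrightarrow> - DE t (u t) \<in> subdifferential Psi0 0"
    and t: "t \<in> {0..T}" "t \<notin> J"
  shows "- DE t (u t) \<in> subdifferential Psi0 0"
  unfolding subdifferential_zero_iff
proof (rule allI, rule ccontr)
  fix z assume "\<not> blinfun_apply (- DE t (u t)) z \<le> Psi0 z"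
  then have gt: "Psi0 z < - blinfun_apply (DE t (u t)) z" by (simp add: blinfun.minus_left)
  have "isCont uc t" using isCont_of_no_jump[of t] t J_iff uc_id by simp
  then have uct: "(uc \<longlongrightarrow> u t) (at t)" using uc_id[OF t(1)] by (simp add: isCont_def)
  have "((\<lambda>s. DE (clamp T s) (uc s)) \<longlongrightarrow> DE t (u t)) (at t)"
    by (intro tendsto_strip[OF DE_cont] clamp_tendsto t uct)
  then have "((\<lambda>s. - blinfun_apply (DE (clamp T s) (uc s)) z) \<longlongrightarrow> - blinfun_apply (DE t (u t)) z) (at t)"
    by (intro tendsto_intros)
  then have "\<forall>\<^sub>F s in at t. Psi0 z < - blinfun_apply (DE (clamp T s) (uc s)) z" using gt by (rule order_tendstoD)
  then obtain d where d: "d > 0" "\<And>s. s \<noteq> t \<Longrightarrow> dist s t < d \<Longrightarrow> Psi0 z < - blinfun_apply (DE (clamp T s) (uc s)) z"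
    unfolding eventually_at by auto
  \<comment> \<open>Cut down to [0,T], the neighbourhood is still a nondegenerate interval when
    \<open>t\<close> is an endpoint.\<close>
  define a b where "a = max 0 (t - d)" and "b = min T (t + d)"
  have ab: "a < b" using d(1) t T by (auto simp: a_def b_def)
  have "AE s in lborel. s \<notin> J" using AE_not_in[OF J_null] .
  then have "AE s in lborel. s \<notin> {a<..<b}" using ae AE_lborel_singleton[of t]
  proof eventually_elim
    case (elim s)
    show ?case
    proof
      assume s: "s \<in> {a<..<b}"
      then have sT: "s \<in> {0..T}" and sd: "dist s t < d" by (auto simp: a_def b_def dist_real_def)
      have "- DE s (u s) \<in> subdifferential Psi0 0" using elim sT by simp
      then have "- blinfun_apply (DE s (u s)) z \<le> Psi0 z" by (simp add: subdifferential_zero_iff blinfun.minus_left)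
      moreover have "Psi0 z < - blinfun_apply (DE s (u s)) z" using d(2)[of s] elim sd sT by (simp add: clamp_id uc_id)
      ultimately show False by simp
    qed
  qed
  then have "emeasure lborel {a<..<b} = 0" by (subst (asm) AE_iff_measurable[of "{a<..<b}"]) auto
  then show False using ab by simp
qed

definition inclusion :: bool where
  "inclusion \<longleftrightarrow> (AE t in mu. t \<in> {0..T} \<longrightarrow> 0 \<in> {\<xi> + DE t (u t) | \<xi>. \<xi> \<in> subdifferential Psi0 (h t)})"

definition jumps :: bool where
  "jumps \<longleftrightarrow> (\<forall>t\<in>J. ereal (E t (u t) - E t (ul t)) = - enn2ereal (\<Delta> t (ul t) (u t)) \<and>
     ereal (E t (ur t) - E t (u t)) = - enn2ereal (\<Delta> t (u t) (ur t)) \<and>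
     ereal (E t (ur t) - E t (ul t)) = - enn2ereal (\<Delta> t (ul t) (ur t)))"

lemma energy_identity:
  assumes inc: "inclusion" and j: "jumps" and t: "t \<in> {0..T}"
  shows "enn2ereal (pseudo_Var T Psi0 (contact_potential Psi) DE u 0 t) + ereal (E t (u t)) =
    ereal (E 0 (u 0) + (LINT s:{0..t}|lborel. dtE s (u s)))"
proof (cases "t = 0")
  case True
  have "(LINT s:{0}|lborel. dtE s (u s)) = 0" by (rule set_integral_null_set[OF lborel_singleton_null])
  then show ?thesis using True by (simp add: pseudo_Var_def zero_ennreal.rep_eq)
next
  case False
  then have t': "0 < t" "t \<le> T" using t by auto
  \<comment> \<open>The cost equalities extend to all times: off the jump set the transition is
    trivial and both sides vanish. In particular they hold at the ends 0 and \<open>t\<close>, jump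
    or not.\<close>
  have D1: "E r (u r) \<le> E r (ul r) \<and> \<Delta> r (ul r) (u r) = ennreal (E r (ul r) - E r (u r))" if "r \<in> {0..T}" for r
  proof (cases "r \<in> J")
    case True
    then show ?thesis using j unfolding jumps_def ereal_eq_uminus_enn2ereal by auto
  next
    case False
    then show ?thesis using J_iff[of r] that cost_refl by simp
  qed
  have D2: "E r (ur r) \<le> E r (u r) \<and> \<Delta> r (u r) (ur r) = ennreal (E r (u r) - E r (ur r))" if "r \<in> {0..T}" for r
  proof (cases "r \<in> J")
    case True
    then show ?thesis using j unfolding jumps_def ereal_eq_uminus_enn2ereal by auto
  next
    case False
    then show ?thesis using J_iff[of r] that cost_refl by simp
  qed
  have "(LINT s:{0..t}|mu. Psi0 (h s)) = (LINT s:{0..t}|mu. - g2 s)"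
    unfolding set_lebesgue_integral_def
  proof (rule integral_cong_AE)
    have [measurable]: "g2 \<in> borel_measurable borel" using borel_measurable_integrable[OF integrable_g2] by simp
    show "(\<lambda>s. indicator {0..t} s *\<^sub>R - g2 s) \<in> borel_measurable mu" by measurable
    show "(\<lambda>s. indicator {0..t} s *\<^sub>R Psi0 (h s)) \<in> borel_measurable mu" by measurable
    show "AE s in mu. indicator {0..t} s *\<^sub>R Psi0 (h s) = indicator {0..t} s *\<^sub>R - g2 s"
      using inc[unfolded inclusion_def inclusion_iff]
    proof eventually_elim
      case (elim s)
      then show ?case using t' by (auto split: split_indicator simp: g2_def clamp_id uc_id)
    qed
  qed
  then have I: "(LINT s:{0..t}|mu. Psi0 (h s)) = - (LINT s:{0..t}|mu. g2 s)"
    using set_integral_uminus[OF integrable_DE_h(2)] by simp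
  have Inn: "0 \<le> (LINT s:{0..t}|mu. Psi0 (h s))"
    unfolding set_lebesgue_integral_def by (intro integral_nonneg_AE) (auto simp: Psi0_nonneg)
  let ?A = "J \<inter> {0<..<t}"
  let ?y = "\<lambda>r. - (E r (ur r) - E r (ul r))"
  have hs: "(?y has_sum - F.nu0 ?A) ?A" using has_sum_energy_jumps[of t] by (simp only: has_sum_uminus minus_minus)
  have yA: "0 \<le> ?y r \<and> \<Delta> r (ul r) (u r) + \<Delta> r (u r) (ur r) = ennreal (?y r)" if "r \<in> ?A" for r
  proof -
    have rT: "r \<in> {0..T}" using that t' by auto
    show ?thesis using D1[OF rT] D2[OF rT] by (simp add: ennreal_plus[symmetric] del: ennreal_plus)
  qed
  have nn: "0 \<le> - F.nu0 ?A" by (rule has_sum_nonneg[OF hs]) (use yA in blast)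
  have "(\<Sum>\<^sub>\<infinity>r\<in>?A. \<Delta> r (ul r) (u r) + \<Delta> r (u r) (ur r)) = (\<Sum>\<^sub>\<infinity>r\<in>?A. ennreal (?y r))"
    by (rule infsum_cong) (use yA in blast)
  also have "\<dots> = ennreal (- F.nu0 ?A)" by (rule infsum_ennreal_of_has_sum[OF hs]) (use yA in blast)
  finally have S: "(\<Sum>\<^sub>\<infinity>r\<in>?A. \<Delta> r (ul r) (u r) + \<Delta> r (u r) (ur r)) = ennreal (- F.nu0 ?A)" .
  have e0: "E 0 (ur 0) \<le> E 0 (u 0)" "\<Delta> 0 (u 0) (ur 0) = ennreal (E 0 (u 0) - E 0 (ur 0))" using D2[of 0] T by auto
  have et: "E t (u t) \<le> E t (ul t)" "\<Delta> t (ul t) (u t) = ennreal (E t (ul t) - E t (u t))" using D1[OF t] by auto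
  have "pseudo_Var T Psi0 (contact_potential Psi) DE u 0 t =
    ennreal ((LINT s:{0..t}|mu. Psi0 (h s)) + (E 0 (u 0) - E 0 (ur 0)) + (E t (ul t) - E t (u t)) + - F.nu0 ?A)"
    unfolding pseudo_Var_eq[OF t'] S e0(2) et(2) using Inn e0(1) et(1) nn by (simp add: ennreal_plus[symmetric] del: ennreal_plus)
  moreover have "(LINT s:{0..t}|mu. Psi0 (h s)) + (E 0 (u 0) - E 0 (ur 0)) + (E t (ul t) - E t (u t)) + - F.nu0 ?A
     = E 0 (u 0) + (LINT s:{0..t}|lborel. dtE s (u s)) - E t (u t)"
    using chain_rule[OF t'] set_integral_DE_h[OF t'(2)] I by linarith
  moreover have "0 \<le> (LINT s:{0..t}|mu. Psi0 (h s)) + (E 0 (u 0) - E 0 (ur 0)) + (E t (ul t) - E t (u t)) + - F.nu0 ?A"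
    using Inn e0(1) et(1) nn by linarith
  ultimately show ?thesis unfolding enn2ereal_add_eq_ereal by simp
qed

text \<open>Both costs are bounded below by the energy they release, and the two releases add up to
  the given total, which leaves no slack in either.\<close>

lemma cost_split_tight:
  assumes r: "r \<in> {0..T}" and fin: "\<Delta> r x y + \<Delta> r y z = ennreal (E r x - E r z)" and nn: "0 \<le> E r x - E r z"
  shows "E r y \<le> E r x \<and> \<Delta> r x y = ennreal (E r x - E r y) \<and> E r z \<le> E r y \<and> \<Delta> r y z = ennreal (E r y - E r z)"
proof -
  have "\<Delta> r x y < top" "\<Delta> r y z < top"
  proof -
    have "\<Delta> r x y + \<Delta> r y z < top" unfolding fin by simp
    then show "\<Delta> r x y < top" "\<Delta> r y z < top" by (auto simp: less_top)
  qed
  then obtain p q where p: "p \<ge> 0" "\<Delta> r x y = ennreal p" and q: "q \<ge> 0" "\<Delta> r y z = ennreal q"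
    by (metis ennreal_cases less_irrefl)
  have "ennreal (p + q) = ennreal (E r x - E r z)" using fin p q by simp
  then have "p + q = E r x - E r z" using p q nn by (subst (asm) ennreal_inj) auto
  moreover have "E r x - E r y \<le> p" using cost_lower[OF r, of x y] p by (simp add: ennreal_le_iff)
  moreover have "E r y - E r z \<le> q" using cost_lower[OF r, of y z] q by (simp add: ennreal_le_iff)
  ultimately have "p = E r x - E r y" "q = E r y - E r z" by auto
  then show ?thesis using p q by simp
qed

lemma tightness:
  assumes ae: "AE t in lborel. t \<in> {0..T} - J \<longrightarrow> - DE t (u t) \<in> subdifferential Psi0 0"
    and en: "enn2ereal (pseudo_Var T Psi0 (contact_potential Psi) DE u 0 T) + ereal (E T (u T)) =
      ereal (E 0 (u 0) + (LINT s:{0..T}|lborel. dtE s (u s)))"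
  shows "inclusion \<and> jumps"
proof -
  let ?A = "J \<inter> {0<..<T}"
  let ?I = "LINT s:{0..T}|mu. Psi0 (h s)" let ?G = "LINT s:{0..T}|mu. g2 s"
  define R where "R = E 0 (u 0) + (LINT s:{0..T}|lborel. dtE s (u s)) - E T (u T)"
  have T0: "0 \<in> {0..T}" "T \<in> {0..T}" using T by auto
  \<comment> \<open>Stability at every point off \<open>J\<close> becomes stability \<mu>-almost
    everywhere since \<open>J\<close> is \<mu>-null.\<close>
  have stable: "AE t in mu. t \<in> {0..T} \<longrightarrow> - DE t (u t) \<in> subdifferential Psi0 0"
    using AE_not_in[OF mu_J] by eventually_elim (use stable_off_jumps[OF ae] in blast)
  have AEle: "AE t in mu. 0 \<le> indicator {0..T} t *\<^sub>R (Psi0 (h t) + g2 t)"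
    using stable
  proof eventually_elim
    case (elim t)
    have "- blinfun_apply (DE t (u t)) (h t) \<le> Psi0 (h t)" if "t \<in> {0..T}"
      using elim that by (simp add: subdifferential_zero_iff blinfun.minus_left)
    then show ?case by (auto split: split_indicator simp: g2_def clamp_id uc_id)
  qed
  have IG: "?I + ?G = (LINT t|mu. indicator {0..T} t *\<^sub>R (Psi0 (h t) + g2 t))"
    using set_integral_add(2)[OF integrable_DE_h] by (simp add: set_lebesgue_integral_def)
  have IG0: "0 \<le> ?I + ?G" unfolding IG by (rule integral_nonneg_AE[OF AEle])
  have Inn: "0 \<le> ?I"
    unfolding set_lebesgue_integral_def by (intro integral_nonneg_AE) (auto simp: Psi0_nonneg)
  have R: "0 \<le> R" "pseudo_Var T Psi0 (contact_potential Psi) DE u 0 T = ennreal R"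
    using en unfolding enn2ereal_add_eq_ereal by (auto simp: R_def)
  have Var: "ennreal ?I + \<Delta> 0 (u 0) (ur 0) + \<Delta> T (ul T) (u T)
      + (\<Sum>\<^sub>\<infinity>r\<in>?A. \<Delta> r (ul r) (u r) + \<Delta> r (u r) (ur r)) = ennreal R"
    using R(2) pseudo_Var_eq[OF T order_refl] by simp
  then have "ennreal ?I + \<Delta> 0 (u 0) (ur 0) + \<Delta> T (ul T) (u T)
      + (\<Sum>\<^sub>\<infinity>r\<in>?A. \<Delta> r (ul r) (u r) + \<Delta> r (u r) (ur r)) < top" by simp
  then have fin: "\<Delta> 0 (u 0) (ur 0) < top" "\<Delta> T (ul T) (u T) < top"
    "(\<Sum>\<^sub>\<infinity>r\<in>?A. \<Delta> r (ul r) (u r) + \<Delta> r (u r) (ur r)) < top" by (auto simp: less_top)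
  obtain d0 where d0: "d0 \<ge> 0" "\<Delta> 0 (u 0) (ur 0) = ennreal d0" using fin(1) by (metis ennreal_cases less_irrefl)
  obtain dT where dT: "dT \<ge> 0" "\<Delta> T (ul T) (u T) = ennreal dT" using fin(2) by (metis ennreal_cases less_irrefl)
  obtain x X where x: "\<And>r. r \<in> ?A \<Longrightarrow> 0 \<le> x r" "\<And>r. r \<in> ?A \<Longrightarrow> \<Delta> r (ul r) (u r) + \<Delta> r (u r) (ur r) = ennreal (x r)"
    "(x has_sum X) ?A" "0 \<le> X" "(\<Sum>\<^sub>\<infinity>r\<in>?A. \<Delta> r (ul r) (u r) + \<Delta> r (u r) (ur r)) = ennreal X"
    by (rule has_sum_of_infsum_ennreal[OF fin(3)]) (rule that)
  have "ennreal (?I + d0 + dT + X) = ennreal R" using Var Inn d0 dT x(4,5) by simp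
  then have sumR: "?I + d0 + dT + X = R" using Inn d0 dT x(4) R(1) by (subst (asm) ennreal_inj) auto
  have low0: "E 0 (u 0) - E 0 (ur 0) \<le> d0" using cost_lower[OF T0(1), of "u 0" "ur 0"] d0 by (simp add: ennreal_le_iff)
  have lowT: "E T (ul T) - E T (u T) \<le> dT" using cost_lower[OF T0(2), of "ul T" "u T"] dT by (simp add: ennreal_le_iff)
  let ?y = "\<lambda>r. - (E r (ur r) - E r (ul r))"
  have hs: "(?y has_sum - F.nu0 ?A) ?A" using has_sum_energy_jumps[of T] by (simp only: has_sum_uminus minus_minus)
  have le: "?y r \<le> x r" if rA: "r \<in> ?A" for r
  proof -
    have rT: "r \<in> {0..T}" using rA by auto
    have "ennreal (?y r) = ennreal (E r (ul r) - E r (ur r))" by simp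
    also have "\<dots> \<le> \<Delta> r (ul r) (ur r)" by (rule cost_lower[OF rT])
    also have "\<dots> \<le> \<Delta> r (ul r) (u r) + \<Delta> r (u r) (ur r)" by (rule finsler_cost_triangle)
    also have "\<dots> = ennreal (x r)" by (rule x(2)[OF rA])
    finally show ?thesis using x(1)[OF rA] by (simp add: ennreal_le_iff)
  qed
  have hd: "((\<lambda>r. x r - ?y r) has_sum (X - - F.nu0 ?A)) ?A"
    using has_sum_add[OF x(3) has_sum_energy_jumps[of T]] by (simp only: diff_minus_eq_add)
  have Xle: "0 \<le> X - - F.nu0 ?A" by (rule has_sum_nonneg[OF hd]) (use le in \<open>simp add: algebra_simps\<close>)
  have Req: "R = - ?G + (E 0 (u 0) - E 0 (ur 0)) + (E T (ul T) - E T (u T)) - F.nu0 ?A"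
    using chain_rule[OF T order_refl] set_integral_DE_h[of T] unfolding R_def by simp
  \<comment> \<open>The energy identity and the chain rule say that four nonnegative gaps sum to
    zero: the diffuse one, the two boundary ones and that of the interior jumps.\<close>
  have tight: "?I + ?G = 0" "d0 = E 0 (u 0) - E 0 (ur 0)" "dT = E T (ul T) - E T (u T)" "X - - F.nu0 ?A = 0"
    using sumR Req IG0 low0 lowT Xle by linarith+
  have xy: "x r = ?y r" if rA: "r \<in> ?A" for r
  proof -
    \<comment> \<open>The gap of the interior jumps is a sum of nonnegative terms, so each single
      jump is tight.\<close>
    have "infsum (\<lambda>r. x r - ?y r) ?A \<le> 0" using infsumI[OF hd] tight(4) by simp
    moreover have "(\<lambda>r. x r - ?y r) summable_on ?A" using hd summable_on_def by blast
    ultimately have "x r - ?y r = 0" using nonneg_infsum_le_0D[of "\<lambda>r. x r - ?y r" ?A r] le rA by simp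
    then show ?thesis by simp
  qed
  have "AE t in mu. indicator {0..T} t *\<^sub>R (Psi0 (h t) + g2 t) = 0"
  proof (rule integral_nonneg_eq_0_iff_AE[THEN iffD1, OF _ AEle])
    show "integrable mu (\<lambda>t. indicator {0..T} t *\<^sub>R (Psi0 (h t) + g2 t))"
      by (intro integrable_mult_indicator Bochner_Integration.integrable_add integrable_Psi0_h integrable_g2) simp
    show "(LINT t|mu. indicator {0..T} t *\<^sub>R (Psi0 (h t) + g2 t)) = 0" using tight(1) IG by simp
  qed
  then have "inclusion" unfolding inclusion_def inclusion_iff using stable
  proof eventually_elim
    case (elim t)
    then show ?case by (auto simp: g2_def clamp_id uc_id)
  qed
  moreover have "jumps" unfolding jumps_def ereal_eq_uminus_enn2ereal
  proof
    fix r assume rJ: "r \<in> J"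
    then have rT: "r \<in> {0..T}" using J_iff by auto
    have both: "E r (u r) \<le> E r (ul r) \<and> \<Delta> r (ul r) (u r) = ennreal (E r (ul r) - E r (u r)) \<and>
        E r (ur r) \<le> E r (u r) \<and> \<Delta> r (u r) (ur r) = ennreal (E r (u r) - E r (ur r))"
    proof -
      \<comment> \<open>At 0 the transition from the left is trivial and at \<open>T\<close> that to
        the right, by the conventions on one-sided limits; the other half is a boundary
        term.\<close>
      consider "r \<in> ?A" | "r = 0" | "r = T" using rJ rT by fastforce
      then show ?thesis
      proof cases
        case 1
        show ?thesis
          by (rule cost_split_tight[OF rT]) (use x(1,2)[OF 1] xy[OF 1] in auto)
      next
        case 2
        then show ?thesis using d0 tight(2) ul_0 cost_refl by simp
      next
        case 3
        then show ?thesis using dT tight(3) ur_T cost_refl by simp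
      qed
    qed
    \<comment> \<open>The direct transition costs at most the sum of the two halves and at least the
      energy released, which are now the same number.\<close>
    have "\<Delta> r (ul r) (ur r) = ennreal (E r (ul r) - E r (ur r))"
    proof (rule antisym)
      have "\<Delta> r (ul r) (ur r) \<le> \<Delta> r (ul r) (u r) + \<Delta> r (u r) (ur r)" by (rule finsler_cost_triangle)
      also have "\<dots> = ennreal ((E r (ul r) - E r (u r)) + (E r (u r) - E r (ur r)))"
        using both by (simp add: ennreal_plus[symmetric] del: ennreal_plus)
      finally show "\<Delta> r (ul r) (ur r) \<le> ennreal (E r (ul r) - E r (ur r))" by simp
    qed (rule cost_lower[OF rT])
    then show "(E r (u r) - E r (ul r) \<le> 0 \<and> \<Delta> r (ul r) (u r) = ennreal (- (E r (u r) - E r (ul r)))) \<and>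
       (E r (ur r) - E r (u r) \<le> 0 \<and> \<Delta> r (u r) (ur r) = ennreal (- (E r (ur r) - E r (u r)))) \<and>
       (E r (ur r) - E r (ul r) \<le> 0 \<and> \<Delta> r (ul r) (ur r) = ennreal (- (E r (ur r) - E r (ul r))))"
      using both by auto
  qed
  ultimately show ?thesis by blast
qed

lemma BV_solution_iff:
  "BV_solution T Psi0 (contact_potential Psi) E dtE DE u \<longleftrightarrow> inclusion \<and> jumps"
proof
  assume "BV_solution T Psi0 (contact_potential Psi) E dtE DE u"
  then show "inclusion \<and> jumps"
    using T unfolding BV_solution_def J_def[symmetric] by (intro tightness) auto
next
  assume ij: "inclusion \<and> jumps"
  have "AE t in lborel. t \<in> {0..T} \<longrightarrow> (t \<in> {0..T} \<longrightarrow> - DE t (u t) \<in> subdifferential Psi0 0)"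
  proof (rule AE_mu_lborel)
    show "AE t in mu. t \<in> {0..T} \<longrightarrow> - DE t (u t) \<in> subdifferential Psi0 0"
      using conjunct1[OF ij] unfolding inclusion_def inclusion_iff by eventually_elim blast
  qed
  then have "AE t in lborel. t \<in> {0..T} - jump_set T u \<longrightarrow> - DE t (u t) \<in> subdifferential Psi0 0"
    by eventually_elim blast
  then show "BV_solution T Psi0 (contact_potential Psi) E dtE DE u"
    unfolding BV_solution_def using bv energy_identity ij by blast
qed

end

theorem theorem4p3:
  fixes Psi0 Psi :: "'a::{banach,second_countable_topology} \<Rightarrow> real"
    and T C :: real
    and E dtE :: "real \<Rightarrow> 'a \<Rightarrow> real"
    and DE :: "real \<Rightarrow> 'a \<Rightarrow> ('a \<Rightarrow>\<^sub>L real)"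
    and u :: "real \<Rightarrow> 'a"
  assumes finite_dim: "\<exists>B::'a set. finite B \<and> span B = UNIV"
    and T_pos: "T > 0"
    and Psi0_nonneg: "\<And>v. Psi0 v \<ge> 0"
    and Psi0_pos: "\<And>v. v \<noteq> 0 \<Longrightarrow> Psi0 v > 0"
    and Psi0_subadd: "\<And>v1 v2. Psi0 (v1 + v2) \<le> Psi0 v1 + Psi0 v2"
    and Psi0_homogeneous: "\<And>l v. l \<ge> 0 \<Longrightarrow> Psi0 (l *\<^sub>R v) = l * Psi0 v"
    and E_deriv: "\<And>t x. t \<in> {0..T} \<Longrightarrow>
      ((\<lambda>(s, y). E s y) has_derivative (\<lambda>(s, y). s * dtE t x + blinfun_apply (DE t x) y))
        (at (t, x) within {0..T} \<times> UNIV)"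
    and dtE_cont: "continuous_on ({0..T} \<times> UNIV) (\<lambda>(s, y). dtE s y)"
    and DE_cont: "continuous_on ({0..T} \<times> UNIV) (\<lambda>(s, y). DE s y)"
    and C_pos: "C > 0"
    and E_bounded_below: "\<And>t x. t \<in> {0..T} \<Longrightarrow> E t x \<ge> - C"
    and dtE_bound: "\<And>t x. t \<in> {0..T} \<Longrightarrow> \<bar>dtE t x\<bar> \<le> C * (1 + max (E t x) 0)"
    and Psi_nonneg: "\<And>v. Psi v \<ge> 0"
    and Psi_convex: "convex_on UNIV Psi"
    and Psi_zero: "Psi 0 = 0"
    and Psi_superlinear: "filterlim (\<lambda>v. Psi v / norm v) at_top at_infinity"
    and Psi_eps_limit: "\<And>v. ((\<lambda>e. Psi_eps Psi e v) \<longlongrightarrow> Psi0 v) (at_right 0)"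
    and u_BV: "BV T u"
  shows "BV_solution T Psi0 (contact_potential Psi) E dtE DE u \<longleftrightarrow>
    (AE t in mu_measure T u. t \<in> {0..T} \<longrightarrow>
       0 \<in> {\<xi> + DE t (u t) | \<xi>. \<xi> \<in> subdifferential Psi0 (co_density T u t)}) \<and>
    (\<forall>t\<in>jump_set T u.
       ereal (E t (u t) - E t (lim_left u t)) =
         - enn2ereal (finsler_cost (contact_potential Psi) DE t (lim_left u t) (u t)) \<and>
       ereal (E t (lim_right T u t) - E t (u t)) =
         - enn2ereal (finsler_cost (contact_potential Psi) DE t (u t) (lim_right T u t)) \<and>
       ereal (E t (lim_right T u t) - E t (lim_left u t)) =
         - enn2ereal (finsler_cost (contact_potential Psi) DE t (lim_left u t) (lim_right T u t)))"
proof -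
  obtain B c where fc: "fin_coords (B :: 'a set) c" using ex_fin_coords[OF finite_dim] by blast
  obtain V M where V: "\<And>a b. 0 \<le> a \<Longrightarrow> a \<le> b \<Longrightarrow> b \<le> T \<Longrightarrow> norm (u b - u a) \<le> V b - V a"
    "\<And>t. t \<in> {0..T} \<Longrightarrow> 0 \<le> V t \<and> V t \<le> M"
    using BV_dominating[OF u_BV less_imp_le[OF T_pos]] by blast
  have en: "C1_energy T E dtE DE"
    by (rule C1_energy.intro) (fact E_deriv dtE_cont DE_cont)+
  obtain L where L: "L \<ge> 0" "\<And>t x. t \<in> {0..T} \<Longrightarrow> norm x \<le> norm (u 0) + M \<Longrightarrow> \<bar>dtE t x\<bar> \<le> L \<and> norm (DE t x) \<le> L"
    using C1_energy_bound[OF fc en] by blast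
  have "bv_curve B c T u V M"
    by (intro bv_curve.intro fc bv_curve_axioms.intro T_pos V)
  then have ec: "energy_curve B c T u V M E dtE DE L"
    by (intro energy_curve.intro en energy_curve_axioms.intro L)
  have ga: "gauge Psi0"
    by (intro gauge.intro Psi0_nonneg Psi0_subadd Psi0_homogeneous)
  have vi: "viscosity Psi"
    by (intro viscosity.intro Psi_nonneg Psi_zero Psi_superlinear)
  interpret bv_system B c T u V M E dtE DE L Psi0 Psi
    by (intro bv_system.intro ec ga vi bv_system_axioms.intro u_BV)
  have jT: "t \<in> {0..T}" if "t \<in> jump_set T u" for t using that by (simp add: jump_set_def)
  show ?thesis
    unfolding BV_solution_iff inclusion_def jumps_def J_def
    using jT by (simp add: lim_left_eq lim_right_eq)
qed

end
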